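(* Assume $x+x=x$ for all $x\in\mathbb K$. Then $\mathcal P_{\mathbb K}$ is generated by totally ordered traces: for every term $P$ there exist finitely many traces $T_1,\dots,T_n$ whose orders $\le_{T_i}$ are total, and $k_1,\dots,k_n\in\mathbb K$, such that $P\simeq k_1\cdot\{T_1\}\oplus\cdots\oplus k_n\cdot\{T_n\}$.
   Context: Calculus: fix a commutative semiring $\mathbb K$, a countable set $\mathcal N$ of names, polarities $+,-$ ($\neg$ exchanges them). Actions $u^\varepsilon(x)$ (subject $u$, bound name $x$); $u(x):=u^+(x)$, $\bar u(x):=u^-(x)$; an action written without object has a fresh bound object. Terms $P::=k\mid\alpha.P\mid\diamond P\mid P|Q\mid P\parallel Q\mid\nu xP$ ($k\in\mathbb K$), up to injective renaming of bound names and commutation of restrictions. Positions: finite integer sequences, prefix order, independent = incomparable. Labels: visible $u^\varepsilon(x):\iota$, internal $(\iota,\kappa)$. Transitions: $\alpha.P\xrightarrow{\alpha:\epsilon}\diamond P$; if $P\xrightarrow{a}P'$ then $\diamond P\xrightarrow{1.a}\diamond P'$, $P|Q\xrightarrow{1.a}P'|Q$, $Q|P\xrightarrow{2.a}Q|P'$, likewise for $\parallel$, $\nu xP\xrightarrow{a}\nu xP'$ if $x\notin a$; if $P\xrightarrow{u^\varepsilon(x):\iota}P'$, $Q\xrightarrow{u^{\neg\varepsilon}(y):\kappa}Q'$ then $P|Q\xrightarrow{(1.\iota,2.\kappa)}\nu x(P'|Q'[x/y])$. Homotopy: smallest congruence on label sequences with $ab\sim ba$ when all positions of $a,b$ are pairwise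 independent. Run: homotopy class of maximal internal-label transition sequences from $P$, end term $P/\rho$. State $s(k)=k$, $s(\alpha.P)=1$, $s(\diamond P)=s(\nu xP)=s(P)$, $s(P|Q)=s(P\parallel Q)=s(P)s(Q)$; outcome $\langle P\rangle=\sum_{\rho\in\mathrm{Runs}(P)}s(P/\rho)$; $P\simeq Q$ iff $\langle P|R\rangle=\langle Q|R\rangle$ for all $R$; $\mathcal P_{\mathbb K}$ is the $\mathbb K$-module of $\simeq$-classes with $P\oplus Q:=\nu u((u.P|u.Q)|\bar u.1)$ ($u$ fresh), $k\cdot P:=k|P$. Linear action $\underline{\alpha}.P:=\nu w(\alpha.(P|w.1)|(w.0|\bar w.1))$ ($w$ fresh); a prefix without continuation has continuation $1$. Trace $T=(|T|,p,s,\le_T,N)$: finite set $|T|$ of events, $p:|T|\to\{+,-\}$, $s:|T|\to\mathcal N\uplus|T|$, partial order $\le_T$ on $|T|$ with $s(b)=a\Rightarrow a<b$, finite $N\subseteq\{+,-\}\times(\mathcal N\uplus|T|)$. Implementation $\{T\}$: with fresh names $x_{ab},y_{ab},z_a$ ($a,b\in|T|$), $\mathrm{act}(a)=s(a)^{p(a)}(z_a)$ if $s(a)\in\mathcal N$, else $z_{s(a)}^{p(a)}(z_a)$; $A_a^T:=\{\underline{x}_{ba}\}_{b<a}.\underline{\mathrm{act}(a)}.(\prod_{a<c}\underline{\bar y}_{ac}\parallel\prod_{s(c)=a}A_c^T\parallel\prod_{(\varepsilon,a)\in N}z_a^\varepsilon.0)$, where $\{\underline{x}_{ba}\}_{b<a}$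 is a sequence of linear prefixes $\underline{x_{ba}}$ for all $b<a$ and $\prod$ is $\parallel$-composition; $\{T\}:=\nu(x_{ab},y_{ab})_{a,b}(\prod_{s(a)\in\mathcal N}A_a^T\,|\,\prod_{a<b}\underline{y}_{ab}.\underline{\bar x}_{ab})\parallel\prod_{(\varepsilon,u)\in N,u\in\mathcal N}u^\varepsilon.0$. *)

theory Defs
  imports Main "HOL-Library.Nat_Bijection"
begin

section \<open>Syntax (locally nameless: atoms are nat, bound names are de Bruijn indices)\<close>

datatype pol = Pos | Neg

fun negp :: "pol \<Rightarrow> pol" where
  "negp Pos = Neg" | "negp Neg = Pos"

datatype nm = F nat | B nat

text \<open>Act e u P is the action u^e(x).P, the object x being the bound index 0 of P;
  Nu P is the restriction, binding index 0 of P.\<close>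
datatype 'k tm = Cst 'k | Act pol nm "'k tm" | Dia "'k tm"
  | Par "'k tm" "'k tm" | Sep "'k tm" "'k tm" | Nu "'k tm"

fun opn_n :: "nat \<Rightarrow> nat \<Rightarrow> nm \<Rightarrow> nm" where
  "opn_n k x (B i) = (if i = k then F x else B i)"
| "opn_n k x (F y) = F y"

fun opn :: "nat \<Rightarrow> nat \<Rightarrow> 'k tm \<Rightarrow> 'k tm" where
  "opn k x (Cst c) = Cst c"
| "opn k x (Act e u P) = Act e (opn_n k x u) (opn (Suc k) x P)"
| "opn k x (Dia P) = Dia (opn k x P)"
| "opn k x (Par P Q) = Par (opn k x P) (opn k x Q)"
| "opn k x (Sep P Q) = Sep (opn k x P) (opn k x Q)"
| "opn k x (Nu P) = Nu (opn (Suc k) x P)"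

fun cls_n :: "nat \<Rightarrow> nat \<Rightarrow> nm \<Rightarrow> nm" where
  "cls_n k x (F y) = (if y = x then B k else F y)"
| "cls_n k x (B i) = B i"

fun cls :: "nat \<Rightarrow> nat \<Rightarrow> 'k tm \<Rightarrow> 'k tm" where
  "cls k x (Cst c) = Cst c"
| "cls k x (Act e u P) = Act e (cls_n k x u) (cls (Suc k) x P)"
| "cls k x (Dia P) = Dia (cls k x P)"
| "cls k x (Par P Q) = Par (cls k x P) (cls k x Q)"
| "cls k x (Sep P Q) = Sep (cls k x P) (cls k x Q)"
| "cls k x (Nu P) = Nu (cls (Suc k) x P)"

fun sbst_n :: "nat \<Rightarrow> nat \<Rightarrow> nm \<Rightarrow> nm" where
  "sbst_n x y (F z) = F (if z = y then x else z)"
| "sbst_n x y (B i) = B i"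

fun sbst :: "nat \<Rightarrow> nat \<Rightarrow> 'k tm \<Rightarrow> 'k tm" where
  "sbst x y (Cst c) = Cst c"
| "sbst x y (Act e u P) = Act e (sbst_n x y u) (sbst x y P)"
| "sbst x y (Dia P) = Dia (sbst x y P)"
| "sbst x y (Par P Q) = Par (sbst x y P) (sbst x y Q)"
| "sbst x y (Sep P Q) = Sep (sbst x y P) (sbst x y Q)"
| "sbst x y (Nu P) = Nu (sbst x y P)"

fun fvn :: "nm \<Rightarrow> nat set" where
  "fvn (F x) = {x}" | "fvn (B i) = {}"

fun fv :: "'k tm \<Rightarrow> nat set" where
  "fv (Cst c) = {}"
| "fv (Act e u P) = fvn u \<union> fv P"
| "fv (Dia P) = fv P"
| "fv (Par P Q) = fv P \<union> fv Q"
| "fv (Sep P Q) = fv P \<union> fv Q"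
| "fv (Nu P) = fv P"

fun wfd_n :: "nat \<Rightarrow> nm \<Rightarrow> bool" where
  "wfd_n d (B i) = (i < d)" | "wfd_n d (F x) = True"

fun wfd :: "nat \<Rightarrow> 'k tm \<Rightarrow> bool" where
  "wfd d (Cst c) = True"
| "wfd d (Act e u P) = (wfd_n d u \<and> wfd (Suc d) P)"
| "wfd d (Dia P) = wfd d P"
| "wfd d (Par P Q) = (wfd d P \<and> wfd d Q)"
| "wfd d (Sep P Q) = (wfd d P \<and> wfd d Q)"
| "wfd d (Nu P) = wfd (Suc d) P"

text \<open>locally closed = a genuine term of the calculus\<close>
definition lc :: "'k tm \<Rightarrow> bool" where
  "lc P = wfd 0 P"

type_synonym pos = "int list"

datatype lbl = Vis pol nat nat pos  \<comment> \<open>u^e(x):iota\<close>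
             | Tau pos pos

fun pre :: "int \<Rightarrow> lbl \<Rightarrow> lbl" where
  "pre n (Vis e u x p) = Vis e u x (n # p)"
| "pre n (Tau p q) = Tau (n # p) (n # q)"

fun lnames :: "lbl \<Rightarrow> nat set" where
  "lnames (Vis e u x p) = {u, x}" | "lnames (Tau p q) = {}"

fun objfresh :: "lbl \<Rightarrow> 'k tm \<Rightarrow> bool" where
  "objfresh (Vis e u x p) Q = (x \<notin> fv Q)" | "objfresh (Tau p q) Q = True"

inductive step :: "'k tm \<Rightarrow> lbl \<Rightarrow> 'k tm \<Rightarrow> bool" where
  act: "x \<noteq> u \<Longrightarrow> x \<notin> fv P \<Longrightarrow> step (Act e (F u) P) (Vis e u x []) (Dia (opn 0 x P))"
| dia: "step P a P' \<Longrightarrow> step (Dia P) (pre 1 a) (Dia P')"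
| parL: "step P a P' \<Longrightarrow> objfresh a Q \<Longrightarrow> step (Par P Q) (pre 1 a) (Par P' Q)"
| parR: "step P a P' \<Longrightarrow> objfresh a Q \<Longrightarrow> step (Par Q P) (pre 2 a) (Par Q P')"
| sepL: "step P a P' \<Longrightarrow> objfresh a Q \<Longrightarrow> step (Sep P Q) (pre 1 a) (Sep P' Q)"
| sepR: "step P a P' \<Longrightarrow> objfresh a Q \<Longrightarrow> step (Sep Q P) (pre 2 a) (Sep Q P')"
| nu: "w \<notin> fv P \<Longrightarrow> w \<notin> lnames a \<Longrightarrow> step (opn 0 w P) a P'
       \<Longrightarrow> step (Nu P) a (Nu (cls 0 w P'))"
| sync: "step P (Vis e u x p) P' \<Longrightarrow> step Q (Vis (negp e) u y q) Q' \<Longrightarrow> x \<notin> fv Q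
       \<Longrightarrow> step (Par P Q) (Tau (1 # p) (2 # q)) (Nu (cls 0 x (Par P' (sbst x y Q'))))"

type_synonym ilbl = "pos \<times> pos"

definition istep :: "'k tm \<Rightarrow> ilbl \<Rightarrow> 'k tm \<Rightarrow> bool" where
  "istep P l P' = step P (Tau (fst l) (snd l)) P'"

inductive execs :: "'k tm \<Rightarrow> ilbl list \<Rightarrow> 'k tm \<Rightarrow> bool" where
  nil: "execs P [] P"
| cons: "istep P l P' \<Longrightarrow> execs P' ls Q \<Longrightarrow> execs P (l # ls) Q"

definition final :: "'k tm \<Rightarrow> bool" where
  "final Q = (\<not> (\<exists>l Q'. istep Q l Q'))"

definition cseq :: "'k tm \<Rightarrow> ilbl list set" where
  "cseq P = {ls. \<exists>Q. execs P ls Q \<and> final Q}"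

definition is_prefix :: "pos \<Rightarrow> pos \<Rightarrow> bool" where
  "is_prefix p q = (\<exists>r. q = p @ r)"

definition indep :: "pos \<Rightarrow> pos \<Rightarrow> bool" where
  "indep p q = (\<not> is_prefix p q \<and> \<not> is_prefix q p)"

definition indep_l :: "ilbl \<Rightarrow> ilbl \<Rightarrow> bool" where
  "indep_l a b = (\<forall>p\<in>{fst a, snd a}. \<forall>q\<in>{fst b, snd b}. indep p q)"

inductive hom :: "ilbl list \<Rightarrow> ilbl list \<Rightarrow> bool" where
  refl: "hom l l"
| sym: "hom l l' \<Longrightarrow> hom l' l"
| trans: "hom l l' \<Longrightarrow> hom l' l'' \<Longrightarrow> hom l l''"
| swap: "indep_l a b \<Longrightarrow> hom (xs @ a # b # ys) (xs @ b # a # ys)"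

definition runs :: "'k tm \<Rightarrow> ilbl list set set" where
  "runs P = (\<lambda>ls. {ls'. ls' \<in> cseq P \<and> hom ls ls'}) ` cseq P"

fun st :: "'k::comm_semiring_1 tm \<Rightarrow> 'k" where
  "st (Cst k) = k"
| "st (Act e u P) = 1"
| "st (Dia P) = st P"
| "st (Nu P) = st P"
| "st (Par P Q) = st P * st Q"
| "st (Sep P Q) = st P * st Q"

definition endt :: "'k tm \<Rightarrow> ilbl list set \<Rightarrow> 'k tm" where
  "endt P C = (SOME Q. \<exists>ls\<in>C. execs P ls Q \<and> final Q)"

definition outcome :: "'k::comm_semiring_1 tm \<Rightarrow> 'k" where
  "outcome P = (\<Sum>C\<in>runs P. st (endt P C))"

definition obs_eq :: "'k::comm_semiring_1 tm \<Rightarrow> 'k tm \<Rightarrow> bool" where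
  "obs_eq P Q = (\<forall>R. lc R \<longrightarrow> outcome (Par P R) = outcome (Par Q R))"

definition fresh_nm :: "nat set \<Rightarrow> nat" where
  "fresh_nm S = (LEAST x. x \<notin> S)"

definition msum2 :: "'k::comm_semiring_1 tm \<Rightarrow> 'k tm \<Rightarrow> 'k tm" where
  "msum2 P Q = (let u = fresh_nm (fv P \<union> fv Q) in
     Nu (cls 0 u (Par (Par (Act Pos (F u) P) (Act Pos (F u) Q)) (Act Neg (F u) (Cst 1)))))"

fun msum :: "'k::comm_semiring_1 tm list \<Rightarrow> 'k tm" where
  "msum [] = Cst 0"
| "msum [P] = P"
| "msum (P # Ps) = msum2 P (msum Ps)"

definition scal :: "'k \<Rightarrow> 'k tm \<Rightarrow> 'k tm" where
  "scal k P = Par (Cst k) P"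

definition lin :: "pol \<Rightarrow> nat \<Rightarrow> nat \<Rightarrow> 'k::comm_semiring_1 tm \<Rightarrow> 'k tm" where
  "lin e u x P = (let w = fresh_nm (insert u (insert x (fv P))) in
     Nu (cls 0 w (Par (Act e (F u) (cls 0 x (Par P (Act Pos (F w) (Cst 1)))))
                      (Par (Act Pos (F w) (Cst 0)) (Act Neg (F w) (Cst 1))))))"

definition lin0 :: "pol \<Rightarrow> nat \<Rightarrow> 'k::comm_semiring_1 tm \<Rightarrow> 'k tm" where
  "lin0 e u P = lin e u (fresh_nm (insert u (fv P))) P"

fun prod_sep :: "'k::comm_semiring_1 tm list \<Rightarrow> 'k tm" where
  "prod_sep [] = Cst 1"
| "prod_sep [P] = P"
| "prod_sep (P # Ps) = Sep P (prod_sep Ps)"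

text \<open>events are natural numbers; s(a) = Inl u (a name) or Inr b (an event)\<close>
record trc =
  tev :: "nat set"
  tpol :: "nat \<Rightarrow> pol"
  tsrc :: "nat \<Rightarrow> nat + nat"
  tord :: "(nat \<times> nat) set"
  tneg :: "(pol \<times> (nat + nat)) set"

definition tlt :: "trc \<Rightarrow> nat \<Rightarrow> nat \<Rightarrow> bool" where
  "tlt T a b = ((a, b) \<in> tord T \<and> a \<noteq> b)"

definition wf_trace :: "trc \<Rightarrow> bool" where
  "wf_trace T = (finite (tev T)
     \<and> partial_order_on (tev T) (tord T)
     \<and> (\<forall>a\<in>tev T. \<forall>b. tsrc T a = Inr b \<longrightarrow> b \<in> tev T \<and> tlt T b a)
     \<and> finite (tneg T)
     \<and> (\<forall>e a. (e, Inr a) \<in> tneg T \<longrightarrow> a \<in> tev T))"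

definition fnT :: "trc \<Rightarrow> nat set" where
  "fnT T = {u. \<exists>a\<in>tev T. tsrc T a = Inl u} \<union> {u. \<exists>e. (e, Inl u) \<in> tneg T}"

text \<open>fresh names x_ab, y_ab, z_a, all above the free names of T\<close>
definition base :: "trc \<Rightarrow> nat" where
  "base T = Suc (Max (insert 0 (fnT T)))"

definition xn :: "trc \<Rightarrow> nat \<Rightarrow> nat \<Rightarrow> nat" where
  "xn T a b = base T + 3 * prod_encode (a, b)"
definition yn :: "trc \<Rightarrow> nat \<Rightarrow> nat \<Rightarrow> nat" where
  "yn T a b = base T + 3 * prod_encode (a, b) + 1"
definition zn :: "trc \<Rightarrow> nat \<Rightarrow> nat" where
  "zn T a = base T + 3 * a + 2"

definition subj :: "trc \<Rightarrow> nat \<Rightarrow> nat" where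
  "subj T a = (case tsrc T a of Inl u \<Rightarrow> u | Inr b \<Rightarrow> zn T b)"

text \<open>A^T_a, computed with a depth bound (fuel) that is large enough for well-formed traces\<close>
fun implA :: "trc \<Rightarrow> nat \<Rightarrow> nat \<Rightarrow> 'k::comm_semiring_1 tm" where
  "implA T 0 a = Cst 0"
| "implA T (Suc n) a =
     foldr (\<lambda>b Q. lin0 Pos (xn T b a) Q) (sorted_list_of_set {b\<in>tev T. tlt T b a})
       (lin (tpol T a) (subj T a) (zn T a)
         (Sep (prod_sep (map (\<lambda>c. lin0 Neg (yn T a c) (Cst 1))
                          (sorted_list_of_set {c\<in>tev T. tlt T a c})))
          (Sep (prod_sep (map (implA T n) (sorted_list_of_set {c\<in>tev T. tsrc T c = Inr a})))
               (prod_sep (map (\<lambda>e. Act e (F (zn T a)) (Cst 0))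
                          (filter (\<lambda>e. (e, Inr a) \<in> tneg T) [Pos, Neg]))))))"

definition nus :: "nat list \<Rightarrow> 'k tm \<Rightarrow> 'k tm" where
  "nus xs P = foldr (\<lambda>v Q. Nu (cls 0 v Q)) xs P"

definition impl :: "trc \<Rightarrow> 'k::comm_semiring_1 tm" where
  "impl T = (let evs = sorted_list_of_set (tev T);
                 prs = List.product evs evs in
     Sep (nus (concat (map (\<lambda>(a, b). [xn T a b, yn T a b]) prs))
            (Par (prod_sep (map (implA T (card (tev T)))
                                (filter (\<lambda>a. \<exists>u. tsrc T a = Inl u) evs)))
                 (prod_sep (map (\<lambda>(a, b). lin0 Pos (yn T a b) (lin0 Neg (xn T a b) (Cst 1)))
                                (filter (\<lambda>(a, b). tlt T a b) prs)))))
         (prod_sep (map (\<lambda>(e, u). Act e (F u) (Cst 0))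
                    (map (\<lambda>u. (Pos, u)) (sorted_list_of_set {u. (Pos, Inl u) \<in> tneg T})
                     @ map (\<lambda>u. (Neg, u)) (sorted_list_of_set {u. (Neg, Inl u) \<in> tneg T})))))"

end

theory Submission
  imports Defs "HOL-Combinatorics.Transposition" "HOL-Library.Multiset"
begin

text \<open>
  Addition being idempotent, the outcome of a term is the sum of the \<^emph>\<open>set\<close> of the states of its
  reachable final terms; homotopy is irrelevant, because the state of a final term only depends on
  the set of fired positions. A run of \<open>P | R\<close> is a pair of runs of \<open>P\<close> and \<open>R\<close> whose visible actions
  are dual to each other, ending in final terms that offer no dual actions. Hence the behaviour of
  \<open>P\<close> in all contexts is determined by a finite set of triples: the sequence of visible actions of a
  run, the actions offered by its final term, and the state of this term. Up to renaming of the
  bound objects, the first two components form a totally ordered trace \<open>T\<close>. In \<open>{T}\<close> every linear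
  action that is not performed and every action of \<open>N\<close> that is performed makes the state 0, so the
  only triple of \<open>{T}\<close> with a nonzero state is the expected one, with state 1, and \<open>P\<close> is the
  sum of the traces of its triples weighted by the states.
\<close>

section \<open>Renaming and opening of names\<close>

text \<open>Bound objects are the main obstacle: the fresh names of a run of \<open>P | R\<close>
  must avoid \<open>R\<close>, which is not known when the traces are chosen. Runs therefore take
  their objects from a prescribed supply \<open>f\<close>, the triples are shown to depend on
  \<open>f\<close> only through a renaming, and traces are read off from sequences that mention the
  \<open>i\<close>-th object as \<open>Inr i\<close>. The implementation works because a pending
  linear action can always communicate with itself and give state 0, and the state of a term divides
  that of its successors, so a failure is never repaired. A nonzero final state thus means that
  every linear action was performed. As the order is total, the thread of event \<open>k\<close>
  waits for a signal of every earlier event; so after \<open>k\<close> visible actions only event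
  \<open>k\<close> can come next, however the signals interleave. Internal steps leave residues
  behind, and terms are described up to them: by the multiset of active prefixes, which in turn is
  given by a counter per event and the set of forwarders that took their signal.\<close>

fun ren_n :: "(nat \<Rightarrow> nat) \<Rightarrow> nm \<Rightarrow> nm" where
  "ren_n f (F x) = F (f x)"
| "ren_n f (B i) = B i"

fun ren :: "(nat \<Rightarrow> nat) \<Rightarrow> 'k tm \<Rightarrow> 'k tm" where
  "ren f (Cst c) = Cst c"
| "ren f (Act e u P) = Act e (ren_n f u) (ren f P)"
| "ren f (Dia P) = Dia (ren f P)"
| "ren f (Par P Q) = Par (ren f P) (ren f Q)"
| "ren f (Sep P Q) = Sep (ren f P) (ren f Q)"
| "ren f (Nu P) = Nu (ren f P)"

fun ren_l :: "(nat \<Rightarrow> nat) \<Rightarrow> lbl \<Rightarrow> lbl" where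
  "ren_l f (Vis e u x p) = Vis e (f u) (f x) p"
| "ren_l f (Tau p q) = Tau p q"

lemma finite_fvn[simp]: "finite (fvn u)" by (cases u) auto
lemma finite_fv[simp]: "finite (fv P)" by (induction P) auto

lemma ren_n_opn_n: "ren_n f (opn_n k x u) = opn_n k (f x) (ren_n f u)" by (cases u) auto
lemma ren_opn: "ren f (opn k x P) = opn k (f x) (ren f P)"
  by (induction P arbitrary: k) (auto simp: ren_n_opn_n)
lemma ren_n_cls_n: "inj f \<Longrightarrow> ren_n f (cls_n k x u) = cls_n k (f x) (ren_n f u)"
  by (cases u) (auto dest: injD)
lemma ren_cls: "inj f \<Longrightarrow> ren f (cls k x P) = cls k (f x) (ren f P)"
  by (induction P arbitrary: k) (auto simp: ren_n_cls_n)
lemma ren_n_sbst_n: "inj f \<Longrightarrow> ren_n f (sbst_n x y u) = sbst_n (f x) (f y) (ren_n f u)"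
  by (cases u) (auto dest: injD)
lemma ren_sbst: "inj f \<Longrightarrow> ren f (sbst x y P) = sbst (f x) (f y) (ren f P)"
  by (induction P) (auto simp: ren_n_sbst_n)
lemma fvn_ren_n: "fvn (ren_n f u) = f ` fvn u" by (cases u) auto
lemma fv_ren: "fv (ren f P) = f ` fv P" by (induction P) (auto simp: fvn_ren_n)
lemma ren_n_ident: "(\<And>x. x \<in> fvn u \<Longrightarrow> f x = x) \<Longrightarrow> ren_n f u = u" by (cases u) auto
lemma ren_ident: "(\<And>x. x \<in> fv P \<Longrightarrow> f x = x) \<Longrightarrow> ren f P = P"
  by (induction P) (auto simp: ren_n_ident)
lemma ren_n_ren_n: "ren_n f (ren_n g u) = ren_n (f \<circ> g) u" by (cases u) auto
lemma ren_ren: "ren f (ren g P) = ren (f \<circ> g) P"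
  by (induction P) (auto simp: ren_n_ren_n comp_def)
lemma st_ren[simp]: "st (ren f P) = st P" by (induction P) auto

lemma fvn_opn_n: "fvn (opn_n k x u) \<subseteq> insert x (fvn u)" by (cases u) auto
lemma fv_opn: "fv (opn k x P) \<subseteq> insert x (fv P)"
proof (induction P arbitrary: k)
  case (Act e u P)
  then show ?case using fvn_opn_n[of k x u] by fastforce
qed (simp_all; blast)+
lemma fvn_opn_n_sup: "fvn u \<subseteq> fvn (opn_n k x u)" by (cases u) auto
lemma fv_opn_sup: "fv P \<subseteq> fv (opn k x P)"
proof (induction P arbitrary: k)
  case (Act e u P)
  then show ?case using fvn_opn_n_sup[of u k x] by fastforce
qed (simp_all; blast)+
lemma fvn_cls_n[simp]: "fvn (cls_n k x u) = fvn u - {x}" by (cases u) auto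
lemma fv_cls[simp]: "fv (cls k x P) = fv P - {x}" by (induction P arbitrary: k) auto
lemma fvn_sbst_n: "fvn (sbst_n x y u) \<subseteq> insert x (fvn u - {y})" by (cases u) auto
lemma fv_sbst: "fv (sbst x y P) \<subseteq> insert x (fv P - {y})"
proof (induction P)
  case (Act e u P)
  then show ?case using fvn_sbst_n[of x y u] by fastforce
qed (simp_all; blast)+

lemma wfd_n_mono: "wfd_n k u \<Longrightarrow> k \<le> l \<Longrightarrow> wfd_n l u" by (cases u) auto
lemma wfd_mono: "wfd k P \<Longrightarrow> k \<le> l \<Longrightarrow> wfd l P"
proof (induction P arbitrary: k l)
  case (Act e u P)
  then show ?case using wfd_n_mono Act.IH[of "Suc k" "Suc l"] by auto
next
  case (Nu P)
  then show ?case using Nu.IH[of "Suc k" "Suc l"] by auto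
qed (simp_all, blast+)
lemma opn_n_wfd: "wfd_n k u \<Longrightarrow> k \<le> l \<Longrightarrow> opn_n l x u = u" by (cases u) auto
lemma opn_wfd: "wfd k P \<Longrightarrow> k \<le> l \<Longrightarrow> opn l x P = P"
  by (induction P arbitrary: k l) (auto simp: opn_n_wfd)
lemma opn_lc[simp]: "lc P \<Longrightarrow> opn l x P = P" by (simp add: lc_def opn_wfd)
lemma wfd_lc[simp]: "lc P \<Longrightarrow> wfd k P" by (auto simp: lc_def intro: wfd_mono)
lemma wfd_opn_n: "wfd_n (Suc k) u \<Longrightarrow> wfd_n k (opn_n k x u)" by (cases u) auto
lemma wfd_opn: "wfd (Suc k) P \<Longrightarrow> wfd k (opn k x P)"
  by (induction P arbitrary: k) (auto simp: wfd_opn_n)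
lemma wfd_cls_n: "wfd_n k u \<Longrightarrow> wfd_n (Suc k) (cls_n k x u)" by (cases u) auto
lemma wfd_cls: "wfd k P \<Longrightarrow> wfd (Suc k) (cls k x P)"
  by (induction P arbitrary: k) (auto simp: wfd_cls_n)
lemma opn_n_cls_n: "wfd_n k u \<Longrightarrow> opn_n k x (cls_n k x u) = u" by (cases u) auto
lemma opn_cls: "wfd k P \<Longrightarrow> opn k x (cls k x P) = P"
  by (induction P arbitrary: k) (auto simp: opn_n_cls_n)
lemma cls_n_opn_n: "x \<notin> fvn u \<Longrightarrow> cls_n k x (opn_n k x u) = u" by (cases u) auto
lemma cls_opn: "x \<notin> fv P \<Longrightarrow> cls k x (opn k x P) = P"
  by (induction P arbitrary: k) (auto simp: cls_n_opn_n)
lemma cls_n_fresh: "x \<notin> fvn u \<Longrightarrow> cls_n k x u = u" by (cases u) auto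
lemma cls_fresh[simp]: "x \<notin> fv P \<Longrightarrow> cls k x P = P"
  by (induction P arbitrary: k) (auto simp: cls_n_fresh)
lemma opn_n_cls_n_ren: "wfd_n k u \<Longrightarrow> y \<notin> fvn u - {x} \<Longrightarrow> opn_n k y (cls_n k x u) = ren_n (transpose x y) u"
  by (cases u) (auto simp: transpose_def)
text \<open>A swap, unlike a replacement, is injective, so \<open>step_ren\<close> applies to it.
  The same motive is behind \<open>sbst_ren\<close>.\<close>

lemma opn_cls_ren: "wfd k P \<Longrightarrow> y \<notin> fv P - {x} \<Longrightarrow> opn k y (cls k x P) = ren (transpose x y) P"
  by (induction P arbitrary: k) (auto simp: opn_n_cls_n_ren)
lemma cls_n_ren_n: "y \<notin> fvn u - {x} \<Longrightarrow> cls_n k y (ren_n (transpose x y) u) = cls_n k x u"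
  by (cases u) (auto simp: transpose_def)
lemma cls_ren: "y \<notin> fv P - {x} \<Longrightarrow> cls k y (ren (transpose x y) P) = cls k x P"
  by (induction P arbitrary: k) (auto simp: cls_n_ren_n ren_n_ident)
lemma sbst_n_ren: "x \<notin> fvn u - {y} \<Longrightarrow> sbst_n x y u = ren_n (transpose y x) u"
  by (cases u) (auto simp: transpose_def)
lemma sbst_ren: "x \<notin> fv P - {y} \<Longrightarrow> sbst x y P = ren (transpose y x) P"
  by (induction P) (auto simp: sbst_n_ren)

lemma lc_simps[simp]: "lc (Cst k)" "lc (Dia P) = lc P" "lc (Par P Q) = (lc P \<and> lc Q)"
  "lc (Sep P Q) = (lc P \<and> lc Q)" "lc (Act e (F u) P) = wfd (Suc 0) P" "lc (Nu P) = wfd (Suc 0) P"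
  by (auto simp: lc_def)

lemma lc_opn: "wfd (Suc 0) P \<Longrightarrow> lc (opn 0 x P)" by (simp add: lc_def wfd_opn)
lemma wfd_cls_lc: "lc P \<Longrightarrow> wfd (Suc 0) (cls 0 x P)" by (simp add: lc_def wfd_cls)
lemma wfd_sbst_n[simp]: "wfd_n k (sbst_n x y u) = wfd_n k u" by (cases u) auto
lemma wfd_sbst[simp]: "wfd k (sbst x y P) = wfd k P"
  by (induction P arbitrary: k) auto
lemma lc_sbst[simp]: "lc (sbst x y P) = lc P" by (simp add: lc_def)

lemma pre_inj_cases: "pre i a = Vis e u x p \<Longrightarrow> \<exists>q. a = Vis e u x q \<and> p = i # q"
  "pre i a = Tau p q \<Longrightarrow> \<exists>r s. a = Tau r s \<and> p = i # r \<and> q = i # s"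
  by (cases a; auto)+
lemma lnames_pre[simp]: "lnames (pre i a) = lnames a" by (cases a) auto
lemma ren_l_pre[simp]: "ren_l f (pre i a) = pre i (ren_l f a)" by (cases a) auto
lemma lnames_ren_l[simp]: "lnames (ren_l f a) = f ` lnames a" by (cases a) auto

fun lobj :: "lbl \<Rightarrow> nat set" where
  "lobj (Vis e u x p) = {x}" | "lobj (Tau p q) = {}"
fun lsub :: "lbl \<Rightarrow> nat set" where
  "lsub (Vis e u x p) = {u}" | "lsub (Tau p q) = {}"
lemma lobj_pre[simp]: "lobj (pre i a) = lobj a" by (cases a) auto
lemma lsub_pre[simp]: "lsub (pre i a) = lsub a" by (cases a) auto
lemma lnames_lsub_lobj: "lnames a = lsub a \<union> lobj a" by (cases a) auto
lemma objfresh_iff: "objfresh a Q \<longleftrightarrow> lobj a \<inter> fv Q = {}" by (cases a) auto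

text \<open>The side conditions on objects in the single rules add up to freshness for the whole
  source term; this is what later allows the object to be exchanged for another fresh name.\<close>

lemma step_fv: "step P a P' \<Longrightarrow> fv P' \<subseteq> fv P \<union> lobj a \<and> lsub a \<subseteq> fv P \<and> lobj a \<inter> fv P = {} \<and> lsub a \<inter> lobj a = {}"
proof (induction rule: step.induct)
  case (act x u P e)
  then show ?case using fv_opn[of 0 x P] by auto
next
  case (nu w P a P')
  then show ?case using fv_opn[of 0 w P] fv_opn_sup[of P 0 w] by (auto simp: lnames_lsub_lobj)
next
  case (sync P e u x p P' Q y q Q')
  then show ?case using fv_sbst[of x y Q'] by auto
qed (auto simp: objfresh_iff)

lemma step_lc: "step P a P' \<Longrightarrow> lc P \<Longrightarrow> lc P'"
proof (induction rule: step.induct)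
  case (act x u P e)
  then show ?case by (simp add: lc_opn)
next
  case (nu w P a P')
  then show ?case by (simp add: lc_opn wfd_cls_lc)
next
  case (sync P e u x p P' Q y q Q')
  then have "lc (Par P' (sbst x y Q'))" by simp
  from wfd_cls_lc[OF this, of x] show ?case by (simp only: lc_simps)
qed simp_all

lemma step_ren: "step P a P' \<Longrightarrow> inj f \<Longrightarrow> step (ren f P) (ren_l f a) (ren f P')"
proof (induction rule: step.induct)
  case (act x u P e)
  then show ?case by (simp add: ren_opn fv_ren inj_image_mem_iff inj_eq step.act)
next
  case (dia P a P')
  then show ?case by (auto intro: step.dia)
next
  case (parL P a P' Q)
  then show ?case by (cases a) (auto intro!: step.parL simp: fv_ren inj_image_mem_iff simp del: pre.simps)
next
  case (parR P a P' Q)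
  then show ?case by (cases a) (auto intro!: step.parR simp: fv_ren inj_image_mem_iff simp del: pre.simps)
next
  case (sepL P a P' Q)
  then show ?case by (cases a) (auto intro!: step.sepL simp: fv_ren inj_image_mem_iff simp del: pre.simps)
next
  case (sepR P a P' Q)
  then show ?case by (cases a) (auto intro!: step.sepR simp: fv_ren inj_image_mem_iff simp del: pre.simps)
next
  case (nu w P a P')
  then show ?case by (auto simp: ren_cls ren_opn fv_ren inj_image_mem_iff intro!: step.nu)
next
  case (sync P e u x p P' Q y q Q')
  then have "step (Par (ren f P) (ren f Q)) (Tau (1 # p) (2 # q))
     (Nu (cls 0 (f x) (Par (ren f P') (sbst (f x) (f y) (ren f Q')))))"
    by (intro step.sync) (auto simp: fv_ren inj_image_mem_iff)
  then show ?case using sync.prems by (simp add: ren_cls ren_sbst)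
qed

section \<open>Internal and visible transitions with positions forgotten\<close>

definition tau :: "'k tm \<Rightarrow> 'k tm \<Rightarrow> bool" where
  "tau P Q = (\<exists>p q. step P (Tau p q) Q)"

definition vis :: "'k tm \<Rightarrow> pol \<Rightarrow> nat \<Rightarrow> nat \<Rightarrow> 'k tm \<Rightarrow> bool" where
  "vis P e u x Q = (\<exists>p. step P (Vis e u x p) Q)"

lemma tau_lc: "tau P Q \<Longrightarrow> lc P \<Longrightarrow> lc Q" by (auto simp: tau_def intro: step_lc)
lemma vis_lc: "vis P e u x Q \<Longrightarrow> lc P \<Longrightarrow> lc Q" by (auto simp: vis_def intro: step_lc)
lemma tau_fv: "tau P Q \<Longrightarrow> fv Q \<subseteq> fv P" unfolding tau_def using step_fv[of P "Tau p q" Q for p q] by fastforce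
lemma vis_fv: "vis P e u x Q \<Longrightarrow> fv Q \<subseteq> insert x (fv P) \<and> u \<in> fv P \<and> x \<notin> fv P \<and> x \<noteq> u"
  unfolding vis_def using step_fv[of P "Vis e u x p" Q for p] by fastforce
lemma tau_ren: "tau P Q \<Longrightarrow> inj f \<Longrightarrow> tau (ren f P) (ren f Q)"
  unfolding tau_def using step_ren by fastforce
lemma vis_ren: "vis P e u x Q \<Longrightarrow> inj f \<Longrightarrow> vis (ren f P) e (f u) (f x) (ren f Q)"
  unfolding vis_def using step_ren by fastforce

lemma ren_transpose_fresh: "x \<notin> fv P \<Longrightarrow> y \<notin> fv P \<Longrightarrow> ren (transpose x y) P = P"
  by (rule ren_ident) (metis transpose_apply_other)

lemma ren_transpose_twice[simp]: "ren (transpose x y) (ren (transpose x y) P) = P"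
  by (simp add: ren_ren) (rule ren_ident, simp)

text \<open>The swap of two fresh names leaves \<open>P\<close> and the subject alone, so
  equivariance changes nothing but the object and its occurrences in the target.\<close>

lemma vis_fresh: assumes "vis P e u x Q" "y \<notin> fv P"
  shows "vis P e u y (ren (transpose x y) Q)"
proof -
  have *: "u \<in> fv P" "x \<notin> fv P" using vis_fv[OF assms(1)] by auto
  then have "transpose x y u = u" using assms(2) by (metis transpose_apply_other)
  then show ?thesis
    using vis_ren[OF assms(1), of "transpose x y"] * assms(2) by (simp add: ren_transpose_fresh)
qed

inductive_cases step_CstE: "step (Cst k) a Q"
inductive_cases step_ActE: "step (Act e v P) a Q"
inductive_cases step_DiaE: "step (Dia P) a Q"
inductive_cases step_SepE: "step (Sep P R) a Q"
inductive_cases step_ParE: "step (Par P R) a Q"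
inductive_cases step_NuE: "step (Nu P) a Q"

lemma tau_Cst[simp]: "\<not> tau (Cst k) Q" by (auto simp: tau_def elim: step_CstE)
lemma vis_Cst[simp]: "\<not> vis (Cst k) e u x Q" by (auto simp: vis_def elim: step_CstE)
lemma tau_Act[simp]: "\<not> tau (Act e v P) Q" by (auto simp: tau_def elim: step_ActE)
lemma vis_Act: "vis (Act e v P) e' u x Q \<longleftrightarrow> v = F u \<and> e' = e \<and> x \<noteq> u \<and> x \<notin> fv P \<and> Q = Dia (opn 0 x P)"
  by (auto simp: vis_def elim!: step_ActE intro: step.act)
lemma tau_Dia: "tau (Dia P) Q \<longleftrightarrow> (\<exists>P'. Q = Dia P' \<and> tau P P')"
proof
  assume "tau (Dia P) Q"
  then show "\<exists>P'. Q = Dia P' \<and> tau P P'"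
    unfolding tau_def by (auto elim!: step_DiaE dest!: pre_inj_cases(2)[OF HOL.sym])
next
  assume "\<exists>P'. Q = Dia P' \<and> tau P P'"
  then show "tau (Dia P) Q" unfolding tau_def using step.dia by fastforce
qed
lemma vis_Dia: "vis (Dia P) e u x Q \<longleftrightarrow> (\<exists>P'. Q = Dia P' \<and> vis P e u x P')"
proof
  assume "vis (Dia P) e u x Q"
  then show "\<exists>P'. Q = Dia P' \<and> vis P e u x P'"
    unfolding vis_def by (auto elim!: step_DiaE dest!: pre_inj_cases(1)[OF HOL.sym])
next
  assume "\<exists>P'. Q = Dia P' \<and> vis P e u x P'"
  then show "vis (Dia P) e u x Q" unfolding vis_def using step.dia by fastforce
qed
lemma tau_Sep: "tau (Sep P R) Q \<longleftrightarrow> (\<exists>P'. Q = Sep P' R \<and> tau P P') \<or> (\<exists>R'. Q = Sep P R' \<and> tau R R')" (is "?l \<longleftrightarrow> ?r")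
proof
  assume ?l
  then show ?r
    unfolding tau_def by (auto elim!: step_SepE dest!: pre_inj_cases(2)[OF HOL.sym])
next
  assume ?r
  then show ?l unfolding tau_def using step.sepL[of P "Tau p q" for p q] step.sepR[of R "Tau p q" for p q] by fastforce
qed
lemma vis_Sep: "vis (Sep P R) e u x Q \<longleftrightarrow> (\<exists>P'. Q = Sep P' R \<and> vis P e u x P' \<and> x \<notin> fv R) \<or> (\<exists>R'. Q = Sep P R' \<and> vis R e u x R' \<and> x \<notin> fv P)" (is "?l \<longleftrightarrow> ?r")
proof
  assume ?l
  then show ?r
    unfolding vis_def by (auto elim!: step_SepE dest!: pre_inj_cases(1)[OF HOL.sym])
next
  assume ?r
  then show ?l unfolding vis_def using step.sepL[of P "Vis e u x p" for p] step.sepR[of R "Vis e u x p" for p] by fastforce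
qed
lemma vis_Par: "vis (Par P R) e u x Q \<longleftrightarrow> (\<exists>P'. Q = Par P' R \<and> vis P e u x P' \<and> x \<notin> fv R) \<or> (\<exists>R'. Q = Par P R' \<and> vis R e u x R' \<and> x \<notin> fv P)" (is "?l \<longleftrightarrow> ?r")
proof
  assume ?l
  then show ?r
    unfolding vis_def by (auto elim!: step_ParE dest!: pre_inj_cases(1)[OF HOL.sym])
next
  assume ?r
  then show ?l unfolding vis_def using step.parL[of P "Vis e u x p" for p] step.parR[of R "Vis e u x p" for p] by fastforce
qed

text \<open>Rule \<open>sync\<close> lets the two sides choose their objects separately and then
  substitutes one for the other. Both objects can be exchanged for one prescribed fresh name, so a
  fixed \<open>x\<close> reaches all communications and the substitution disappears.\<close>

lemma tau_Par: assumes "x \<notin> fv P" "x \<notin> fv R"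
  shows "tau (Par P R) Q \<longleftrightarrow> (\<exists>P'. Q = Par P' R \<and> tau P P') \<or> (\<exists>R'. Q = Par P R' \<and> tau R R')
   \<or> (\<exists>e u P' R'. vis P e u x P' \<and> vis R (negp e) u x R' \<and> Q = Nu (cls 0 x (Par P' R')))" (is "?l \<longleftrightarrow> ?r")
proof
  assume ?l
  then obtain p q where "step (Par P R) (Tau p q) Q" by (auto simp: tau_def)
  then show ?r
  proof (cases rule: step.cases)
    case (parL a P')
    then show ?thesis using pre_inj_cases(2)[of 1 a p q] by (auto simp: tau_def)
  next
    case (parR a P')
    then show ?thesis using pre_inj_cases(2)[of 2 a p q] by (auto simp: tau_def)
  next
    case (sync e u z p' P' y q' Q')
    have 1: "vis P e u z P'" "vis R (negp e) u y Q'" using sync by (auto simp: vis_def)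
    have z: "z \<notin> fv P" "z \<notin> fv R" "fv P' \<subseteq> insert z (fv P)" "fv Q' \<subseteq> insert y (fv R)" "y \<notin> fv R"
      using vis_fv[OF 1(1)] vis_fv[OF 1(2)] sync by auto
    have "sbst z y Q' = ren (transpose y z) Q'" by (rule sbst_ren) (use z in auto)
    with vis_fresh[OF 1(2) z(2)] have 2: "vis R (negp e) u z (sbst z y Q')" by simp
    let ?Q = "sbst z y Q'" let ?t = "transpose z x"
    have fq: "fv ?Q \<subseteq> insert z (fv R)" using vis_fv[OF 2] by auto
    have "vis P e u x (ren ?t P')" "vis R (negp e) u x (ren ?t ?Q)"
      using vis_fresh[OF 1(1) assms(1)] vis_fresh[OF 2 assms(2)] by auto
    moreover have "cls 0 x (ren ?t (Par P' ?Q)) = cls 0 z (Par P' ?Q)"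
      by (rule cls_ren) (use fq z assms in auto)
    ultimately show ?thesis using sync by (metis ren.simps(4))
  qed
next
  assume ?r
  then consider (a) P' where "Q = Par P' R" "tau P P'" | (b) R' where "Q = Par P R'" "tau R R'"
    | (c) e u P' R' where "vis P e u x P'" "vis R (negp e) u x R'" "Q = Nu (cls 0 x (Par P' R'))" by blast
  then show ?l
  proof cases
    case a then show ?thesis unfolding tau_def using step.parL[of P "Tau p q" for p q] by fastforce
  next
    case b then show ?thesis unfolding tau_def using step.parR[of R "Tau p q" for p q] by fastforce
  next
    case c
    have "sbst x x R' = R'" by (subst sbst_ren) (auto intro: ren_ident)
    with c show ?thesis unfolding tau_def vis_def using step.sync[of P e u x _ P' R x _ R'] assms by metis
  qed
qed

text \<open>Equivariance turns the rule with a locally fresh name into a rule for the given name \<open>v\<close>.\<close>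
lemma step_Nu_cls:
  assumes "lc P" "v \<notin> lnames a"
  shows "step (Nu (cls 0 v P)) a Q \<longleftrightarrow> (\<exists>P'. Q = Nu (cls 0 v P') \<and> step P a P')"
proof
  assume "step (Nu (cls 0 v P)) a Q"
  then obtain w P' where w: "w \<notin> fv (cls 0 v P)" "w \<notin> lnames a" "Q = Nu (cls 0 w P')"
    "step (opn 0 w (cls 0 v P)) a P'" by (auto elim: step_NuE)
  let ?t = "transpose v w"
  have o: "opn 0 w (cls 0 v P) = ren ?t P" by (rule opn_cls_ren) (use w assms in auto)
  have ta: "ren_l ?t a = a" using w(2) assms(2) by (cases a) (auto simp: transpose_def)
  have s: "step P a (ren ?t P')" using step_ren[OF w(4), of ?t] by (simp add: o ta)
  have "fv P' \<subseteq> ?t ` fv P \<union> lobj a" using step_fv[OF w(4)] by (simp add: o fv_ren)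
  then have "v \<notin> fv P' - {w}" using w(1) assms(2) by (auto simp: lnames_lsub_lobj transpose_def split: if_splits)
  then have "cls 0 v (ren (transpose w v) P') = cls 0 w P'" by (rule cls_ren)
  then show "\<exists>P'. Q = Nu (cls 0 v P') \<and> step P a P'" using s w by (metis transpose_commute)
next
  assume "\<exists>P'. Q = Nu (cls 0 v P') \<and> step P a P'"
  then show "step (Nu (cls 0 v P)) a Q" using assms by (auto simp: opn_cls intro!: step.nu)
qed

lemma tau_Nu_cls: "lc P \<Longrightarrow> tau (Nu (cls 0 v P)) Q \<longleftrightarrow> (\<exists>P'. Q = Nu (cls 0 v P') \<and> tau P P')"
  by (auto simp: tau_def step_Nu_cls)
lemma vis_Nu_cls: "lc P \<Longrightarrow> v \<noteq> x \<Longrightarrow> vis (Nu (cls 0 v P)) e u x Q \<longleftrightarrow> (u \<noteq> v \<and> (\<exists>P'. Q = Nu (cls 0 v P') \<and> vis P e u x P'))"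
  using vis_fv[of "Nu (cls 0 v P)" e u x Q] by (cases "u = v") (auto simp: vis_def step_Nu_cls)

lemma Nu_opn_cls: "w \<notin> fv X \<Longrightarrow> Nu X = Nu (cls 0 w (opn 0 w X))" by (simp add: cls_opn)
lemma tau_Nu: "wfd (Suc 0) X \<Longrightarrow> w \<notin> fv X \<Longrightarrow> tau (Nu X) Q \<longleftrightarrow> (\<exists>P'. Q = Nu (cls 0 w P') \<and> tau (opn 0 w X) P')"
  by (subst Nu_opn_cls[of w]) (auto simp: tau_Nu_cls lc_opn)
lemma vis_Nu: "wfd (Suc 0) X \<Longrightarrow> w \<notin> fv X \<Longrightarrow> w \<noteq> x \<Longrightarrow> vis (Nu X) e u x Q \<longleftrightarrow> u \<noteq> w \<and> (\<exists>P'. Q = Nu (cls 0 w P') \<and> vis (opn 0 w X) e u x P')"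
  by (subst Nu_opn_cls[of w]) (auto simp: vis_Nu_cls lc_opn)

lemma ex_fresh: "finite A \<Longrightarrow> \<exists>x::nat. x \<notin> A" by (simp add: ex_new_if_finite)

text \<open>A locally closed \<open>P\<close> does not mention the restricted index. Such
  restrictions arise when a communicated object occurs on neither side.\<close>

lemma tau_Nu_lc: assumes "lc P" shows "tau (Nu P) Q \<longleftrightarrow> (\<exists>P'. Q = Nu P' \<and> tau P P')"
proof -
  obtain w where w: "w \<notin> fv P" using ex_fresh[of "fv P"] by auto
  have "\<And>P'. tau P P' \<Longrightarrow> cls 0 w P' = P'" using w tau_fv by (metis cls_fresh subsetD)
  then show ?thesis using tau_Nu[of P w Q] w assms by simp metis
qed
lemma vis_Nu_lc: assumes "lc P" shows "vis (Nu P) e u x Q \<longleftrightarrow> (\<exists>P'. Q = Nu P' \<and> vis P e u x P')"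
proof -
  obtain w where w: "w \<notin> insert x (fv P)" using ex_fresh[of "insert x (fv P)"] by auto
  have "\<And>P'. vis P e u x P' \<Longrightarrow> cls 0 w P' = P'" using w vis_fv by (metis cls_fresh subsetD)
  moreover have "vis P e u x P' \<Longrightarrow> u \<noteq> w" for P' using w vis_fv[of P e u x P'] by auto
  ultimately show ?thesis using vis_Nu[of P w x e u Q] w assms by simp metis
qed

section \<open>Final states and visible runs\<close>

fun num_acts :: "'k tm \<Rightarrow> nat" where
  "num_acts (Cst c) = 0"
| "num_acts (Act e u P) = Suc (num_acts P)"
| "num_acts (Dia P) = num_acts P"
| "num_acts (Par P Q) = num_acts P + num_acts Q"
| "num_acts (Sep P Q) = num_acts P + num_acts Q"
| "num_acts (Nu P) = num_acts P"

fun act_positions :: "'k tm \<Rightarrow> pos set" where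
  "act_positions (Cst c) = {}"
| "act_positions (Act e u P) = insert [] ((#) 1 ` act_positions P)"
| "act_positions (Dia P) = (#) 1 ` act_positions P"
| "act_positions (Par P Q) = (#) 1 ` act_positions P \<union> (#) 2 ` act_positions Q"
| "act_positions (Sep P Q) = (#) 1 ` act_positions P \<union> (#) 2 ` act_positions Q"
| "act_positions (Nu P) = act_positions P"

definition cut :: "int \<Rightarrow> pos set \<Rightarrow> pos set" where
  "cut i S = {q. i # q \<in> S}"

text \<open>The state of the term obtained by firing the actions at the positions in \<open>S\<close>.\<close>
fun st_fired :: "pos set \<Rightarrow> 'k::comm_semiring_1 tm \<Rightarrow> 'k" where
  "st_fired S (Cst c) = c"
| "st_fired S (Act e u P) = (if [] \<in> S then st_fired (cut 1 S) P else 1)"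
| "st_fired S (Dia P) = st_fired (cut 1 S) P"
| "st_fired S (Par P Q) = st_fired (cut 1 S) P * st_fired (cut 2 S) Q"
| "st_fired S (Sep P Q) = st_fired (cut 1 S) P * st_fired (cut 2 S) Q"
| "st_fired S (Nu P) = st_fired S P"

fun lbl_positions :: "lbl \<Rightarrow> pos set" where
  "lbl_positions (Vis e u x p) = {p}" | "lbl_positions (Tau p q) = {p, q}"

lemma cut_empty[simp]: "cut i {} = {}" by (simp add: cut_def)
lemma cut_pre[simp]: "cut i (S \<union> lbl_positions (pre j a)) = (if i = j then cut i S \<union> lbl_positions a else cut i S)"
  by (cases a) (auto simp: cut_def)
lemma Nil_pre[simp]: "[] \<notin> lbl_positions (pre i a)" by (cases a) auto
lemma lbl_positions_pre[simp]: "lbl_positions (pre i a) = (#) i ` lbl_positions a" by (cases a) auto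

lemma num_acts_opn[simp]: "num_acts (opn k x P) = num_acts P" by (induction P arbitrary: k) auto
lemma num_acts_cls[simp]: "num_acts (cls k x P) = num_acts P" by (induction P arbitrary: k) auto
lemma num_acts_sbst[simp]: "num_acts (sbst x y P) = num_acts P" by (induction P) auto
lemma act_positions_opn[simp]: "act_positions (opn k x P) = act_positions P" by (induction P arbitrary: k) auto
lemma act_positions_cls[simp]: "act_positions (cls k x P) = act_positions P" by (induction P arbitrary: k) auto
lemma act_positions_sbst[simp]: "act_positions (sbst x y P) = act_positions P" by (induction P) auto
lemma st_fired_opn[simp]: "st_fired S (opn k x P) = st_fired S P" by (induction P arbitrary: k S) auto
lemma st_fired_cls[simp]: "st_fired S (cls k x P) = st_fired S P" by (induction P arbitrary: k S) auto
lemma st_fired_sbst[simp]: "st_fired S (sbst x y P) = st_fired S P" by (induction P arbitrary: S) auto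
lemma st_opn[simp]: "st (opn k x P) = st P" by (induction P arbitrary: k) auto
lemma st_cls[simp]: "st (cls k x P) = st P" by (induction P arbitrary: k) auto
lemma st_sbst[simp]: "st (sbst x y P) = st P" by (induction P) auto
lemma finite_act_positions[simp]: "finite (act_positions P)" by (induction P) auto
lemma st_st_fired: "st P = st_fired {} P" by (induction P) auto

text \<open>Reduces the sets of fired positions to finitely many, which later bounds the states that
  runs can reach.\<close>

lemma st_fired_act_positions: "st_fired (S \<inter> act_positions P) P = st_fired S P"
proof (induction P arbitrary: S)
  case (Act e u P)
  have "cut 1 (S \<inter> act_positions (Act e u P)) = cut 1 S \<inter> act_positions P" by (auto simp: cut_def)
  then show ?case unfolding st_fired.simps using Act by auto
next
  case (Dia P)
  have "cut 1 (S \<inter> act_positions (Dia P)) = cut 1 S \<inter> act_positions P" by (auto simp: cut_def)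
  then show ?case using Dia by simp
next
  case (Par P Q)
  have "cut 1 (S \<inter> act_positions (Par P Q)) = cut 1 S \<inter> act_positions P" "cut 2 (S \<inter> act_positions (Par P Q)) = cut 2 S \<inter> act_positions Q"
    by (auto simp: cut_def)
  then show ?case using Par by simp
next
  case (Sep P Q)
  have "cut 1 (S \<inter> act_positions (Sep P Q)) = cut 1 S \<inter> act_positions P" "cut 2 (S \<inter> act_positions (Sep P Q)) = cut 2 S \<inter> act_positions Q"
    by (auto simp: cut_def)
  then show ?case using Sep by simp
qed auto

text \<open>A step keeps the shape of the term: a fired prefix becomes \<open>Dia\<close> at the
  same place and a new \<open>Nu\<close> takes no position, so positions of \<open>P'\<close> still
  address subterms of \<open>P\<close>.\<close>

lemma st_fired_step: "step P a P' \<Longrightarrow> st_fired S P' = st_fired (S \<union> lbl_positions a) P"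
proof (induction arbitrary: S rule: step.induct)
  case (act x u P e)
  have "cut 1 (S \<union> {[]}) = cut 1 S" by (auto simp: cut_def)
  then show ?case by simp
next
  case (sync P e u x p P' Q y q Q')
  have "cut 1 (S \<union> {1 # p, 2 # q}) = cut 1 S \<union> {p}" "cut 2 (S \<union> {1 # p, 2 # q}) = cut 2 S \<union> {q}"
    by (auto simp: cut_def)
  then show ?case using sync by simp
qed (simp_all del: lbl_positions_pre)

lemma step_act_positions: "step P a P' \<Longrightarrow> lbl_positions a \<subseteq> act_positions P \<and> act_positions P' \<subseteq> act_positions P"
  by (induction rule: step.induct) auto

lemma step_num_acts: "step P a P' \<Longrightarrow> num_acts P' < num_acts P"
  by (induction rule: step.induct) auto
lemma tau_num_acts: "tau P Q \<Longrightarrow> num_acts Q < num_acts P" by (auto simp: tau_def step_num_acts)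
lemma vis_num_acts: "vis P e u x Q \<Longrightarrow> num_acts Q < num_acts P" by (auto simp: vis_def step_num_acts)

text \<open>Guards count as 1, so firing them only multiplies the state by further constants.\<close>
lemma step_st_dvd: "step P a P' \<Longrightarrow> st P dvd st P'"
  by (induction rule: step.induct) (auto intro: mult_dvd_mono)

lemma st_zero_tau: "tau P Q \<Longrightarrow> st P = 0 \<Longrightarrow> st Q = 0" unfolding tau_def using step_st_dvd by fastforce
lemma st_zero_vis: "vis P e u x Q \<Longrightarrow> st P = 0 \<Longrightarrow> st Q = 0" unfolding vis_def using step_st_dvd by fastforce

definition fired_positions :: "ilbl list \<Rightarrow> pos set" where
  "fired_positions ls = fst ` set ls \<union> snd ` set ls"

lemma execs_st_fired: "execs P ls Q \<Longrightarrow> st_fired S Q = st_fired (S \<union> fired_positions ls) P"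
proof (induction arbitrary: S rule: execs.induct)
  case (cons P l P' ls Q)
  have "st_fired S Q = st_fired (S \<union> fired_positions ls) P'" using cons by simp
  also have "\<dots> = st_fired ((S \<union> fired_positions ls) \<union> {fst l, snd l}) P" using st_fired_step[OF cons(1)[unfolded istep_def]] by simp
  also have "(S \<union> fired_positions ls) \<union> {fst l, snd l} = S \<union> fired_positions (l # ls)" by (auto simp: fired_positions_def)
  finally show ?case .
qed (simp add: fired_positions_def)

lemma execs_bound: "execs P ls Q \<Longrightarrow> set ls \<subseteq> act_positions P \<times> act_positions P \<and> length ls \<le> num_acts P"
proof (induction rule: execs.induct)
  case (cons P l P' ls Q)
  then show ?case using step_act_positions[of P "Tau (fst l) (snd l)" P'] step_num_acts[of P "Tau (fst l) (snd l)" P']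
    by (cases l) (auto simp: istep_def)
qed simp

text \<open>All that homotopy contributes: equal label sets fire the same positions and hence give
  equal final states.\<close>

lemma hom_set: "hom l l' \<Longrightarrow> set l = set l'" by (induction rule: hom.induct) auto

lemma finite_cseq: "finite (cseq P)"
proof (rule finite_subset)
  show "cseq P \<subseteq> {ls. set ls \<subseteq> act_positions P \<times> act_positions P \<and> length ls \<le> num_acts P}"
    using execs_bound by (auto simp: cseq_def)
qed (simp add: finite_lists_length_le)

lemma final_tau: "final P \<longleftrightarrow> (\<forall>Q. \<not> tau P Q)" by (auto simp: final_def istep_def tau_def)

section \<open>Outcomes as sums over sets of reachable values\<close>

inductive val :: "'k::comm_semiring_1 tm \<Rightarrow> 'k \<Rightarrow> bool" where
  fin: "final P \<Longrightarrow> val P (st P)"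
| step: "tau P Q \<Longrightarrow> val Q v \<Longrightarrow> val P v"

lemma val_iff: "val P v \<longleftrightarrow> (final P \<and> v = st P) \<or> (\<exists>Q. tau P Q \<and> val Q v)"
  by (auto elim: val.cases intro: val.intros)

lemma val_execs: "val P v \<longleftrightarrow> (\<exists>ls Q. execs P ls Q \<and> final Q \<and> v = st Q)"
proof
  assume "val P v"
  then show "\<exists>ls Q. execs P ls Q \<and> final Q \<and> v = st Q"
  proof (induction rule: val.induct)
    case (fin P) then show ?case using execs.nil by blast
  next
    case (step P Q v)
    then obtain ls Q' l where "execs Q ls Q'" "final Q'" "v = st Q'" "istep P l Q"
      by (auto simp: tau_def istep_def)
    then have "execs P (l # ls) Q'" by (metis execs.cons)
    then show ?case using \<open>final Q'\<close> \<open>v = st Q'\<close> by blast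
  qed
next
  assume "\<exists>ls Q. execs P ls Q \<and> final Q \<and> v = st Q"
  then obtain ls Q where "execs P ls Q" "final Q" "v = st Q" by auto
  then show "val P v"
  proof (induction rule: execs.induct)
    case (nil P) then show ?case by (simp add: val.fin)
  next
    case (cons P l P' ls Q)
    then have "tau P P'" "val P' v" by (auto simp: tau_def istep_def)
    then show ?case by (rule val.step)
  qed
qed

text \<open>Equal values are absorbed one by one. From here on multiplicities of runs are gone and
  only the set of values counts.\<close>

lemma sum_idem_image:
  assumes idem: "\<And>x::'k::comm_semiring_1. x + x = x" and "finite A"
  shows "(\<Sum>a\<in>A. f a) = (\<Sum>v\<in>f ` A. (v::'k))"
  using assms(2)
proof (induction rule: finite_induct)
  case (insert a A)
  show ?case
  proof (cases "f a \<in> f ` A")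
    case True
    then have "(\<Sum>v\<in>f ` A. v) = f a + (\<Sum>v\<in>f ` A - {f a}. v)" using insert(1) by (simp add: sum.remove)
    then have "f a + (\<Sum>v\<in>f ` A. v) = (\<Sum>v\<in>f ` A. v)" by (simp add: idem flip: add.assoc)
    then show ?thesis using insert True by (simp add: insert_absorb)
  qed (use insert in simp)
qed simp

lemma outcome_val:
  assumes idem: "\<And>x::'k::comm_semiring_1. x + x = x"
  shows "outcome P = (\<Sum>v\<in>{v. val P v}. (v::'k))" and "finite {v. val P v}"
proof -
  have fin: "finite (runs P)" by (simp add: runs_def finite_cseq)
  \<comment> \<open>The term chosen by \<open>SOME\<close> is reached by some sequence homotopic to
    \<open>ls\<close>; its state will be seen not to depend on the choice.\<close>
  have end_runs: "\<exists>Q ls'. endt P C = Q \<and> ls' \<in> cseq P \<and> hom ls ls' \<and> execs P ls' Q \<and> final Q"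
    if ls: "ls \<in> cseq P" and C: "C = {ls'. ls' \<in> cseq P \<and> hom ls ls'}" for ls C
  proof -
    obtain Q where Q: "execs P ls Q" "final Q" using ls by (auto simp: cseq_def)
    have "ls \<in> C" using ls C hom.refl by auto
    then have "\<exists>Q. \<exists>ls\<in>C. execs P ls Q \<and> final Q" using Q by blast
    then have "\<exists>ls\<in>C. execs P ls (endt P C) \<and> final (endt P C)" unfolding endt_def by (rule someI_ex)
    then show ?thesis using C by auto
  qed
  have eq: "(\<lambda>C. st (endt P C)) ` runs P = {v. val P v}"
  proof (intro set_eqI iffI)
    fix v assume "v \<in> (\<lambda>C. st (endt P C)) ` runs P"
    then show "v \<in> {v. val P v}" using end_runs by (fastforce simp: runs_def val_execs)
  next
    fix v assume "v \<in> {v. val P v}"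
    then obtain ls Q where Q: "execs P ls Q" "final Q" "v = st Q" by (auto simp: val_execs)
    let ?C = "{ls'. ls' \<in> cseq P \<and> hom ls ls'}"
    have ls: "ls \<in> cseq P" using Q by (auto simp: cseq_def)
    then obtain Q' ls' where *: "endt P ?C = Q'" "hom ls ls'" "execs P ls' Q'" using end_runs by blast
    \<comment> \<open>Homotopic sequences fire the same positions, so the chosen final term has the
      same state as \<open>Q\<close>.\<close>
    then have "fired_positions ls = fired_positions ls'" using hom_set[OF *(2)] by (simp add: fired_positions_def)
    then have "st Q' = v" using execs_st_fired[OF Q(1), of "{}"] execs_st_fired[OF *(3), of "{}"] Q by (simp add: st_st_fired)
    then show "v \<in> (\<lambda>C. st (endt P C)) ` runs P" using ls * unfolding runs_def by blast
  qed
  show "finite {v. val P v}" using fin eq by (metis finite_imageI)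
  show "outcome P = (\<Sum>v\<in>{v. val P v}. v)"
    unfolding outcome_def using sum_idem_image[OF idem fin] eq by metis
qed

text \<open>Final terms of state 0 drop out of the sum, so failed runs may differ freely.\<close>

lemma outcome_cong:
  assumes idem: "\<And>x::'k::comm_semiring_1. x + x = x"
    and "\<And>v::'k. v \<noteq> 0 \<Longrightarrow> val P v \<longleftrightarrow> val Q v"
  shows "outcome P = outcome Q"
proof -
  have "outcome R = (\<Sum>v\<in>{v. val R v \<and> v \<noteq> 0}. v)" for R :: "'k tm"
    unfolding outcome_val(1)[OF idem]
    by (rule sum.mono_neutral_right) (use outcome_val(2)[OF idem] in auto)
  moreover have "{v. val P v \<and> v \<noteq> 0} = {v. val Q v \<and> v \<noteq> 0}" using assms(2) by blast
  ultimately show ?thesis by simp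
qed

lemma final_Nu_cls: "lc P \<Longrightarrow> final (Nu (cls 0 x P)) \<longleftrightarrow> final P"
  by (auto simp: final_tau tau_Nu_cls)

text \<open>Lets the restriction that a communication leaves behind be dropped: it hides visible
  actions but no internal ones.\<close>

lemma val_Nu_cls: "lc P \<Longrightarrow> val (Nu (cls 0 x P)) v \<longleftrightarrow> val P v"
proof (induction "num_acts P" arbitrary: P rule: less_induct)
  case less
  have "val (Nu (cls 0 x P)) v \<longleftrightarrow> (final P \<and> v = st P) \<or> (\<exists>P'. tau P P' \<and> val (Nu (cls 0 x P')) v)"
    by (subst val_iff) (auto simp: final_Nu_cls tau_Nu_cls less.prems)
  also have "\<dots> \<longleftrightarrow> (final P \<and> v = st P) \<or> (\<exists>P'. tau P P' \<and> val P' v)"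
    using less.hyps tau_num_acts tau_lc less.prems by blast
  also have "\<dots> \<longleftrightarrow> val P v" by (subst (2) val_iff) auto
  finally show ?case .
qed

text \<open>The object of the \<open>n\<close>-th visible action is prescribed to be \<open>f n\<close>, so labels need not mention objects.\<close>
inductive run :: "(nat \<Rightarrow> nat) \<Rightarrow> nat \<Rightarrow> 'k tm \<Rightarrow> (pol \<times> nat) list \<Rightarrow> 'k tm \<Rightarrow> bool" for f where
  nil: "run f n P [] P"
| tau: "tau P P' \<Longrightarrow> run f n P' s Q \<Longrightarrow> run f n P s Q"
| vis: "vis P e u (f n) P' \<Longrightarrow> run f (Suc n) P' s Q \<Longrightarrow> run f n P ((e, u) # s) Q"

definition inits :: "'k tm \<Rightarrow> (pol \<times> nat) set" where
  "inits P = {(e, u). \<exists>x Q. vis P e u x Q}"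

lemma inits_iff: "x \<notin> fv P \<Longrightarrow> (e, u) \<in> inits P \<longleftrightarrow> (\<exists>Q. vis P e u x Q)"
  unfolding inits_def using vis_fresh by blast

lemma final_Par: "final (Par P R) \<longleftrightarrow> final P \<and> final R \<and> (\<forall>e u. (e, u) \<in> inits P \<longrightarrow> (negp e, u) \<notin> inits R)"
proof -
  obtain x where x: "x \<notin> fv P \<union> fv R" using ex_fresh[of "fv P \<union> fv R"] by auto
  then have x: "x \<notin> fv P" "x \<notin> fv R" by auto
  show ?thesis unfolding final_tau tau_Par[OF x] inits_iff[OF x(1)] inits_iff[OF x(2)] by blast
qed

definition dual :: "(pol \<times> nat) list \<Rightarrow> (pol \<times> nat) list" where
  "dual s = map (\<lambda>(e, u). (negp e, u)) s"

text \<open>Only the objects from \<open>n\<close> on must be fresh; those below \<open>n\<close>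
  may occur as results of earlier actions.\<close>

definition good :: "(nat \<Rightarrow> nat) \<Rightarrow> nat \<Rightarrow> 'k tm \<Rightarrow> bool" where
  "good f n P \<longleftrightarrow> inj f \<and> f ` {n..} \<inter> fv P = {}"

lemma good_tau: "good f n P \<Longrightarrow> tau P P' \<Longrightarrow> good f n P'"
  using tau_fv by (fastforce simp: good_def)
lemma good_vis: "good f n P \<Longrightarrow> vis P e u (f n) P' \<Longrightarrow> good f (Suc n) P'"
  using vis_fv[of P e u "f n" P'] by (fastforce simp: good_def inj_eq)
lemma good_fresh: "good f n P \<Longrightarrow> f n \<notin> fv P" by (auto simp: good_def)

definition joint :: "(nat \<Rightarrow> nat) \<Rightarrow> nat \<Rightarrow> 'k::comm_semiring_1 tm \<Rightarrow> 'k tm \<Rightarrow> 'k \<Rightarrow> bool" where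
  "joint f n P R v \<longleftrightarrow> (\<exists>s P' R'. run f n P s P' \<and> run f n R (dual s) R' \<and> final (Par P' R') \<and> v = st P' * st R')"

text \<open>The interleaving of the two runs is forgotten in \<open>joint\<close>, yet it satisfies
  the same one-step equation as \<open>val\<close> on a parallel composition, because internal steps
  of either side may be taken in any order.\<close>

lemma joint_iff: "joint f n P R v \<longleftrightarrow> (final (Par P R) \<and> v = st P * st R)
   \<or> (\<exists>P'. tau P P' \<and> joint f n P' R v) \<or> (\<exists>R'. tau R R' \<and> joint f n P R' v)
   \<or> (\<exists>e u P' R'. vis P e u (f n) P' \<and> vis R (negp e) u (f n) R' \<and> joint f (Suc n) P' R' v)" (is "?l = ?r")
proof
  assume ?l
  then obtain s P' R' where *: "run f n P s P'" "run f n R (dual s) R'" "final (Par P' R')" "v = st P' * st R'"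
    by (auto simp: joint_def)
  from *(1) show ?r
  proof (cases rule: run.cases)
    case P: nil
    from *(2) show ?thesis
    proof (cases rule: run.cases)
      case nil then show ?thesis using P * by simp
    next
      case (tau R'')
      then show ?thesis using * unfolding joint_def by blast
    next
      case (vis e' u' R'' s'')
      then show ?thesis using P by (simp add: dual_def)
    qed
  next
    case (tau P'')
    then show ?thesis using * unfolding joint_def by blast
  next
    case P: (vis e u P'' s')
    from *(2) show ?thesis
    proof (cases rule: run.cases)
      case nil then show ?thesis using P by (simp add: dual_def)
    next
      case (tau R'')
      then show ?thesis using * unfolding joint_def by blast
    next
      case (vis e' u' R'' s'')
      with P * have "joint f (Suc n) P'' R'' v" "vis R (negp e) u (f n) R''"
        unfolding joint_def dual_def by auto
      then show ?thesis using P by blast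
    qed
  qed
next
  assume ?r
  then consider "final (Par P R)" "v = st P * st R" | P' where "tau P P'" "joint f n P' R v" | R' where "tau R R'" "joint f n P R' v"
    | e u P' R' where "vis P e u (f n) P'" "vis R (negp e) u (f n) R'" "joint f (Suc n) P' R' v" by blast
  then show ?l
  proof cases
    case 1
    then show ?thesis unfolding joint_def by (metis run.nil dual_def list.map(1))
  next
    case 2
    then show ?thesis unfolding joint_def by (blast intro: run.tau)
  next
    case 3
    then show ?thesis unfolding joint_def by (blast intro: run.tau)
  next
    case 4
    then obtain s P'' R'' where "run f (Suc n) P' s P''" "run f (Suc n) R' (dual s) R''" "final (Par P'' R'')" "v = st P'' * st R''"
      by (auto simp: joint_def)
    then have "run f n P ((e, u) # s) P''" "run f n R (dual ((e,u) # s)) R''"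
      using 4 by (auto simp: dual_def intro: run.vis)
    then show ?thesis unfolding joint_def using \<open>final (Par P'' R'')\<close> \<open>v = st P'' * st R''\<close> by blast
  qed
qed

lemma val_joint: "good f n P \<Longrightarrow> good f n R \<Longrightarrow> lc P \<Longrightarrow> lc R \<Longrightarrow> val (Par P R) v \<longleftrightarrow> joint f n P R v"
proof (induction "num_acts P + num_acts R" arbitrary: n P R rule: less_induct)
  case less
  note g = less.prems
  have 1: "val (Par P' R) v \<longleftrightarrow> joint f n P' R v" if "tau P P'" for P'
    using that g by (intro less.hyps) (auto dest: tau_num_acts tau_lc good_tau)
  have 2: "val (Par P R') v \<longleftrightarrow> joint f n P R' v" if "tau R R'" for R'
    using that g by (intro less.hyps) (auto dest: tau_num_acts tau_lc good_tau)
  \<comment> \<open>Both sides share the object \<open>f n\<close>; once \<open>val_Nu_cls\<close>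
    removes its restriction, the pair has again the form treated by the induction.\<close>
  have 3: "val (Nu (cls 0 (f n) (Par P' R'))) v \<longleftrightarrow> joint f (Suc n) P' R' v"
    if "vis P e u (f n) P'" "vis R (negp e) u (f n) R'" for e u P' R'
  proof -
    have l: "lc P'" "lc R'" using that g by (auto dest: vis_lc)
    have "val (Par P' R') v \<longleftrightarrow> joint f (Suc n) P' R' v"
      using that g l vis_num_acts[OF that(1)] vis_num_acts[OF that(2)] by (intro less.hyps) (auto dest: good_vis)
    then show ?thesis using l by (subst val_Nu_cls) auto
  qed
  have "val (Par P R) v \<longleftrightarrow> (final (Par P R) \<and> v = st P * st R) \<or> (\<exists>P'. tau P P' \<and> val (Par P' R) v)
    \<or> (\<exists>R'. tau R R' \<and> val (Par P R') v)
    \<or> (\<exists>e u P' R'. vis P e u (f n) P' \<and> vis R (negp e) u (f n) R' \<and> val (Nu (cls 0 (f n) (Par P' R'))) v)"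
    (is "_ \<longleftrightarrow> _ \<or> ?A \<or> ?B \<or> ?C")
  proof -
    have "(\<exists>Q. (\<exists>P'. Q = Par P' R \<and> tau P P') \<and> val Q v) \<longleftrightarrow> ?A"
      "(\<exists>Q. (\<exists>R'. Q = Par P R' \<and> tau R R') \<and> val Q v) \<longleftrightarrow> ?B" by blast+
    moreover have "(\<exists>Q. (\<exists>e u P' R'. vis P e u (f n) P' \<and> vis R (negp e) u (f n) R' \<and>
       Q = Nu (cls 0 (f n) (Par P' R'))) \<and> val Q v) \<longleftrightarrow> ?C" by blast
    ultimately show ?thesis
      by (simp only: val_iff[of "Par P R"] tau_Par[OF good_fresh[OF g(1)] good_fresh[OF g(2)]] st.simps
          conj_disj_distribR ex_disj_distrib)
  qed
  also have "\<dots> \<longleftrightarrow> joint f n P R v"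
    by (subst joint_iff) (use 1 2 3 in blast)
  finally show ?case .
qed

text \<open>Decorated traces: offered actions are recorded at the final term only, since by
  \<open>final_Par\<close> this is where they decide whether the composition is blocked.\<close>

definition test_triples :: "(nat \<Rightarrow> nat) \<Rightarrow> 'k::comm_semiring_1 tm \<Rightarrow> ((pol \<times> nat) list \<times> (pol \<times> nat) set \<times> 'k) set" where
  "test_triples f P = {(s, inits Q, st Q) | s Q. run f 0 P s Q \<and> final Q}"

lemma val_test_triples: "good f 0 P \<Longrightarrow> good f 0 R \<Longrightarrow> lc P \<Longrightarrow> lc R \<Longrightarrow>
  val (Par P R) v \<longleftrightarrow> (\<exists>(s, N, k) \<in> test_triples f P. \<exists>R'. run f 0 R (dual s) R' \<and> final R' \<and>
     (\<forall>e u. (e, u) \<in> N \<longrightarrow> (negp e, u) \<notin> inits R') \<and> v = k * st R')"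
  unfolding val_joint joint_def test_triples_def final_Par by blast

text \<open>Triples of state 0 yield the value 0 in every context, so agreement on the others is
  enough.\<close>

lemma val_test_triples_mono:
  assumes "good f 0 P" "good f 0 Q" "good f 0 R" "lc P" "lc Q" "lc R" "v \<noteq> 0" "val (Par P R) v"
    and "\<And>s N k. k \<noteq> 0 \<Longrightarrow> (s, N, k) \<in> test_triples f P \<Longrightarrow> (s, N, k) \<in> test_triples f Q"
  shows "val (Par Q R) v"
proof -
  obtain s N k R' where *: "(s, N, k) \<in> test_triples f P" "run f 0 R (dual s) R'" "final R'"
    "\<forall>e u. (e, u) \<in> N \<longrightarrow> (negp e, u) \<notin> inits R'" "v = k * st R'"
    using assms(8) unfolding val_test_triples[OF assms(1,3,4,6)] by blast
  then have "k \<noteq> 0" using assms(7) by auto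
  then have "(s, N, k) \<in> test_triples f Q" using assms(9) * by blast
  then show ?thesis unfolding val_test_triples[OF assms(2,3,5,6)] using * by blast
qed

text \<open>Agreement is asked for every supply \<open>f\<close> because the objects must also avoid
  the names of the test \<open>R\<close>.\<close>

lemma obs_eq_test_triples:
  fixes P Q :: "'k::comm_semiring_1 tm"
  assumes idem: "\<And>x::'k. x + x = x" and "lc P" "lc Q"
    and test_triples: "\<And>f s N k. good f 0 P \<Longrightarrow> good f 0 Q \<Longrightarrow> k \<noteq> 0 \<Longrightarrow> (s, N, k) \<in> test_triples f P \<longleftrightarrow> (s, N, k) \<in> test_triples f Q"
  shows "obs_eq P Q"
  unfolding obs_eq_def
proof (intro allI impI)
  fix R :: "'k tm" assume R: "lc R"
  \<comment> \<open>\<open>m\<close> lies above all free names of the three terms, so the names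
    \<open>m + i\<close> serve as fresh objects for all of them.\<close>
  define m where "m = Suc (Max (insert 0 (fv P \<union> fv Q \<union> fv R)))"
  define f where "f i = m + i" for i
  have "x < m" if "x \<in> fv P \<union> fv Q \<union> fv R" for x
    unfolding m_def using that by (intro le_imp_less_Suc Max_ge) auto
  then have g: "good f 0 P" "good f 0 Q" "good f 0 R"
    unfolding good_def f_def by (fastforce simp: inj_def)+
  show "outcome (Par P R) = outcome (Par Q R)"
  proof (rule outcome_cong[OF idem])
    fix v :: 'k assume v: "v \<noteq> 0"
    show "val (Par P R) v = val (Par Q R) v"
      using val_test_triples_mono[OF g(1,2,3) assms(2,3) R v] val_test_triples_mono[OF g(2,1,3) assms(3,2) R v] test_triples[OF g(1,2)] by blast
  qed
qed

section \<open>Independence of the choice of objects\<close>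

lemma ren_inv: "bij p \<Longrightarrow> ren (inv p) (ren p P) = P"
  unfolding ren_ren by (rule ren_ident) (simp add: bij_is_inj)

lemma final_ren: "bij p \<Longrightarrow> final (ren p P) \<longleftrightarrow> final P"
  unfolding final_tau using tau_ren[of P _ p] tau_ren[of "ren p P" _ "inv p"]
  by (metis bij_imp_bij_inv bij_is_inj ren_inv)

lemma inits_ren: assumes "bij p" shows "inits (ren p P) = apsnd p ` inits P"
proof -
  have 1: "apsnd p ` inits P \<subseteq> inits (ren p P)" if "bij p" for p P
    using vis_ren[of P _ _ _ _ p] that by (fastforce simp: inits_def bij_is_inj)
  have "inits (ren p P) = apsnd p ` (apsnd (inv p) ` inits (ren p P))"
  proof -
    have "apsnd p (apsnd (inv p) x) = x" for x :: "pol \<times> nat"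
      using assms by (cases x) (simp add: bij_is_surj surj_f_inv_f)
    then show ?thesis by (simp add: image_image)
  qed
  also have "\<dots> \<subseteq> apsnd p ` inits P"
    using 1[OF bij_imp_bij_inv[OF assms], of "ren p P"] by (simp add: ren_inv assms image_mono)
  finally show ?thesis using 1[OF assms] by auto
qed

lemma run_ren: "run f n P s Q \<Longrightarrow> bij p \<Longrightarrow> run (p \<circ> f) n (ren p P) (map (apsnd p) s) (ren p Q)"
proof (induction rule: run.induct)
  case (tau P P' n s Q)
  then show ?case by (auto intro: run.tau tau_ren bij_is_inj)
next
  case (vis P e u n P' s Q)
  then show ?case using vis_ren[OF vis(1), of p] by (auto intro!: run.vis bij_is_inj)
qed (simp add: run.nil)

text \<open>A run with \<open>length s\<close> visible actions consults only that many objects, so a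
  renaming that is right on finitely many of them is enough.\<close>

lemma run_cong: "run f n P s Q \<Longrightarrow> (\<And>i. n \<le> i \<Longrightarrow> i < n + length s \<Longrightarrow> g i = f i) \<Longrightarrow> run g n P s Q"
proof (induction rule: run.induct)
  case (tau P P' n s Q)
  then show ?case by (auto intro: run.tau)
next
  case (vis P e u n P' s Q)
  have "g n = f n" by (rule vis.prems) auto
  moreover have "run g (Suc n) P' s Q" by (rule vis.IH) (rule vis.prems, auto)
  ultimately show ?case using vis.hyps by (auto intro!: run.vis)
qed (simp add: run.nil)

lemma run_fv: "run f n P s Q \<Longrightarrow> fv Q \<subseteq> fv P \<union> f ` {n..<n + length s} \<and>
  (\<forall>i < length s. snd (s ! i) \<in> fv P \<union> f ` {n..<n + i})"
proof (induction rule: run.induct)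
  case (tau P P' n s Q)
  then show ?case using tau_fv[OF tau(1)] by blast
next
  case (vis P e u n P' s Q)
  note v = vis_fv[OF vis(1)]
  have "f ` {Suc n..<Suc n + k} \<subseteq> f ` {n..<n + Suc k}" for k by auto
  moreover have "f n \<in> f ` {n..<n + Suc k}" for k by auto
  ultimately have *: "insert (f n) (fv P) \<union> f ` {Suc n..<Suc n + k} \<subseteq> fv P \<union> f ` {n..<n + Suc k}" for k by blast
  have "fv Q \<subseteq> fv P \<union> f ` {n..<n + length ((e, u) # s)}"
  proof -
    have "fv Q \<subseteq> insert (f n) (fv P) \<union> f ` {Suc n..<Suc n + length s}" using vis(3) v by blast
    from subset_trans[OF this *[of "length s"]] show ?thesis by simp
  qed
  moreover have "snd (((e, u) # s) ! i) \<in> fv P \<union> f ` {n..<n + i}" if "i < length ((e, u) # s)" for i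
  proof (cases i)
    case 0 then show ?thesis using v by simp
  next
    case (Suc j)
    then have "snd (s ! j) \<in> fv P' \<union> f ` {Suc n..<Suc n + j}" using vis(3) that by simp
    then show ?thesis using v *[of j] Suc by auto
  qed
  ultimately show ?case by blast
qed simp

lemma run_num_acts: "run f n P s Q \<Longrightarrow> length s \<le> num_acts P"
  by (induction rule: run.induct) (auto dest!: tau_num_acts vis_num_acts)

lemma run_st_fired: "run f n P s Q \<Longrightarrow> \<exists>S'. st_fired S Q = st_fired S' P"
proof (induction arbitrary: S rule: run.induct)
  case (tau P P' n s Q)
  then show ?case unfolding tau_def using st_fired_step by metis
next
  case (vis P e u n P' s Q)
  then show ?case unfolding vis_def using st_fired_step by metis
qed auto

lemma run_st: assumes "run f n P s Q" shows "st Q \<in> (\<lambda>S. st_fired S P) ` Pow (act_positions P)"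
proof -
  obtain S where "st Q = st_fired S P" using run_st_fired[OF assms, of "{}"] by (auto simp: st_st_fired)
  then have "st Q = st_fired (S \<inter> act_positions P) P" by (simp add: st_fired_act_positions)
  then show ?thesis by blast
qed

lemma run_lc: "run f n P s Q \<Longrightarrow> lc P \<Longrightarrow> lc Q"
  by (induction rule: run.induct) (auto dest: tau_lc vis_lc)

section \<open>Sequences that refer to objects by index\<close>

type_synonym asub = "nat + nat"

text \<open>\<open>asub\<close> has the shape of the sources of trace events, so an abstract
  sequence can be read directly as a trace.\<close>

definition inst :: "(nat \<Rightarrow> nat) \<Rightarrow> asub \<Rightarrow> nat" where
  "inst f = case_sum (\<lambda>u. u) f"

lemma inst_simps[simp]: "inst f (Inl u) = u" "inst f (Inr i) = f i" by (simp_all add: inst_def)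

text \<open>Sequences whose subjects are names of \<open>A\<close> (\<open>Inl\<close>) or objects of earlier actions (\<open>Inr\<close>).\<close>
definition ok_trace :: "nat set \<Rightarrow> (pol \<times> asub) list \<Rightarrow> (pol \<times> asub) set \<Rightarrow> bool" where
  "ok_trace A s N \<longleftrightarrow> (\<forall>i < length s. snd (s ! i) \<in> Inl ` A \<union> Inr ` {..<i}) \<and>
     snd ` N \<subseteq> Inl ` A \<union> Inr ` {..<length s}"

definition avoids :: "(nat \<Rightarrow> nat) \<Rightarrow> nat set \<Rightarrow> bool" where
  "avoids f A \<longleftrightarrow> inj f \<and> range f \<inter> A = {}"

lemma good_avoids: "good f 0 P \<longleftrightarrow> avoids f (fv P)"
  by (simp add: good_def avoids_def atLeast_def)

lemma avoids_subset: "avoids f A \<Longrightarrow> A' \<subseteq> A \<Longrightarrow> avoids f A'" by (auto simp: avoids_def)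

lemma inst_inj: "avoids f A \<Longrightarrow> inj_on (inst f) (Inl ` A \<union> range Inr)"
proof (rule inj_onI)
  fix a b assume *: "avoids f A" "a \<in> Inl ` A \<union> range Inr" "b \<in> Inl ` A \<union> range Inr" "inst f a = inst f b"
  then have "f i \<notin> A" "f i = f j \<Longrightarrow> i = j" for i j by (auto simp: avoids_def inj_eq)
  then show "a = b" using *(2-4) by (cases a; cases b) force+
qed

lemma inits_fv: "(e, u) \<in> inits P \<Longrightarrow> u \<in> fv P" using vis_fv by (fastforce simp: inits_def)

text \<open>By \<open>run_fv\<close>, the subject of the \<open>i\<close>-th action is a free name
  of \<open>P\<close> or one of the first \<open>i\<close> objects, so it can be replaced by a
  reference.\<close>

lemma test_triples_abs:
  assumes "(s, N, k) \<in> test_triples f P" "fv P \<subseteq> A" "avoids f A"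
  obtains s' N' where "ok_trace A s' N'" "s = map (apsnd (inst f)) s'" "N = apsnd (inst f) ` N'"
proof -
  obtain Q where Q: "run f 0 P s Q" "N = inits Q" using assms(1) by (auto simp: test_triples_def)
  \<comment> \<open>\<open>inv f\<close> is meaningful only on the range of \<open>f\<close>, which
    is disjoint from \<open>A\<close>; hence the test for \<open>A\<close>.\<close>
  define ab where "ab u = (if u \<in> A then Inl u else Inr (inv f u))" for u
  have ab_f: "ab (f i) = Inr i" for i using assms(3) by (auto simp: ab_def avoids_def)
  have ab: "ab u \<in> Inl ` A \<union> Inr ` {..<i} \<and> inst f (ab u) = u" if u: "u \<in> fv P \<union> f ` {0..<0 + i}" for u i
  proof (cases "u \<in> A")
    case True then show ?thesis by (simp add: ab_def)
  next
    case False
    then obtain j where "j < i" "u = f j" using u assms(2) by auto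
    then show ?thesis using ab_f by simp
  qed
  note fv = run_fv[OF Q(1)]
  have N: "snd x \<in> fv P \<union> f ` {0..<0 + length s}" if "x \<in> N" for x
    using that fv Q(2) inits_fv by (cases x) auto
  show thesis
  proof (rule that[of "map (apsnd ab) s" "apsnd ab ` N"])
    show "ok_trace A (map (apsnd ab) s) (apsnd ab ` N)"
      unfolding ok_trace_def using ab fv N by (fastforce simp: image_iff)
    show "s = map (apsnd (inst f)) (map (apsnd ab) s)"
    proof (rule nth_equalityI)
      fix i assume i: "i < length s"
      then have "inst f (ab (snd (s ! i))) = snd (s ! i)" using ab fv by blast
      then show "s ! i = map (apsnd (inst f)) (map (apsnd ab) s) ! i" using i by (cases "s ! i") simp
    qed simp
    have "apsnd (inst f) (apsnd ab x) = x" if "x \<in> N" for x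
      using ab N[OF that] by (cases x) auto
    then show "N = apsnd (inst f) ` apsnd ab ` N" by (simp add: image_image)
  qed
qed

text \<open>For finite \<open>n\<close> only: the complements of the ranges of \<open>f\<close> and
  \<open>g\<close> may differ in size, and then no permutation maps the whole of one supply to the
  other.\<close>

lemma ex_bij_extension:
  assumes "avoids f A" "avoids g A"
  shows "\<exists>p. bij p \<and> (\<forall>i < n. p (f i) = g i) \<and> (\<forall>u\<in>A. p u = (u::nat))"
proof (induction n)
  case 0
  then show ?case by (metis bij_id id_apply less_nat_zero_code)
next
  case (Suc n)
  then obtain p where p: "bij p" "\<forall>i < n. p (f i) = g i" "\<forall>u\<in>A. p u = u" by blast
  \<comment> \<open>\<open>p (f n)\<close> and \<open>g n\<close> differ from all earlier targets
    and from the names in \<open>A\<close>, so the swap disturbs nothing already arranged.\<close>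
  let ?q = "transpose (p (f n)) (g n) \<circ> p"
  have "?q (f i) = g i" if "i < Suc n" for i
  proof (cases "i = n")
    case False
    then have "p (f i) = g i" "i < n" using p that by auto
    moreover have "p (f i) \<noteq> p (f n)" using p(1) assms(1) False by (auto simp: avoids_def inj_eq bij_is_inj)
    moreover have "g i \<noteq> g n" using assms(2) False by (auto simp: avoids_def inj_eq)
    ultimately show ?thesis by simp
  qed simp
  moreover have "?q u = u" if "u \<in> A" for u
  proof -
    have "u \<noteq> f n" "u \<noteq> g n" using that assms by (auto simp: avoids_def)
    then have "p u \<noteq> p (f n)" using p(1) by (auto simp: inj_eq bij_is_inj)
    then show ?thesis using p(3) that \<open>u \<noteq> g n\<close> by simp
  qed
  moreover have "bij ?q" using p(1) by (simp add: bij_comp)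
  ultimately show ?case by blast
qed

text \<open>A permutation that fixes \<open>A\<close> fixes \<open>P\<close> and carries a run with
  objects from \<open>f\<close> to one with objects from \<open>g\<close>.\<close>

lemma test_triples_indep:
  assumes "avoids f A" "avoids g A" "fv P \<subseteq> A" "ok_trace A s N"
    and "(map (apsnd (inst f)) s, apsnd (inst f) ` N, k) \<in> test_triples f P"
  shows "(map (apsnd (inst g)) s, apsnd (inst g) ` N, k) \<in> test_triples g P"
proof -
  obtain Q where Q: "run f 0 P (map (apsnd (inst f)) s) Q" "apsnd (inst f) ` N = inits Q" "k = st Q" "final Q"
    using assms(5) by (auto simp: test_triples_def)
  obtain p where p: "bij p" "\<And>i. i < length s \<Longrightarrow> p (f i) = g i" "\<And>u. u \<in> A \<Longrightarrow> p u = u"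
    using ex_bij_extension[OF assms(1,2), of "length s"] by blast
  have P: "ren p P = P" by (rule ren_ident) (use assms(3) p(3) in auto)
  have pi: "p (inst f z) = inst g z" if "z \<in> Inl ` A \<union> Inr ` {..<length s}" for z
    using that p(2,3) by auto
  have s: "map (apsnd p) (map (apsnd (inst f)) s) = map (apsnd (inst g)) s"
  proof (rule nth_equalityI)
    fix i assume "i < length (map (apsnd p) (map (apsnd (inst f)) s))"
    then have i: "i < length s" by simp
    then have "snd (s ! i) \<in> Inl ` A \<union> Inr ` {..<i}" using assms(4) by (auto simp: ok_trace_def)
    then have "snd (s ! i) \<in> Inl ` A \<union> Inr ` {..<length s}" using i by auto
    then show "map (apsnd p) (map (apsnd (inst f)) s) ! i = map (apsnd (inst g)) s ! i"
      using pi i by (cases "s ! i") simp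
  qed simp
  have "apsnd p (apsnd (inst f) z) = apsnd (inst g) z" if "z \<in> N" for z
  proof -
    have "snd z \<in> Inl ` A \<union> Inr ` {..<length s}" using that assms(4) unfolding ok_trace_def by blast
    then show ?thesis using pi by (cases z) simp
  qed
  then have N: "inits (ren p Q) = apsnd (inst g) ` N"
    unfolding inits_ren[OF p(1)] Q(2)[symmetric] image_image by (rule image_cong[OF HOL.refl])
  have "run (p \<circ> f) 0 P (map (apsnd (inst g)) s) (ren p Q)"
    using run_ren[OF Q(1) p(1)] unfolding P s .
  then have "run g 0 P (map (apsnd (inst g)) s) (ren p Q)" by (rule run_cong) (use p(2) in auto)
  moreover have "final (ren p Q)" using Q(4) by (simp add: final_ren p(1))
  ultimately show ?thesis unfolding test_triples_def N[symmetric] using Q(3) by auto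
qed

lemma finite_pol: "finite (X :: pol set)"
proof -
  have "UNIV = {Pos, Neg}" using pol.exhaust by auto
  then show ?thesis by (metis finite.emptyI finite_insert finite_subset subset_UNIV)
qed

text \<open>Gives the finite list of summands: lengths are bounded by the number of prefixes,
  subjects lie in a finite set, and states come from subsets of
  \<open>act_positions P\<close>.\<close>

lemma finite_test_triples:
  assumes "avoids f A" "finite A"
  shows "finite {(s, N, k). ok_trace A s N \<and> (map (apsnd (inst f)) s, apsnd (inst f) ` N, k) \<in> test_triples f P}"
proof (rule finite_subset)
  let ?Z = "(UNIV :: pol set) \<times> (Inl ` A \<union> Inr ` {..<num_acts P})"
  have Z: "finite ?Z" using assms(2) by (simp add: finite_pol)
  show "finite ({s. set s \<subseteq> ?Z \<and> length s \<le> num_acts P} \<times> Pow ?Z \<times> (\<lambda>S. st_fired S P) ` Pow (act_positions P))"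
    by (rule finite_cartesian_product, rule finite_lists_length_le[OF Z], rule finite_cartesian_product,
        rule finite_Pow_iff[THEN iffD2, OF Z], simp)
  show "{(s, N, k). ok_trace A s N \<and> (map (apsnd (inst f)) s, apsnd (inst f) ` N, k) \<in> test_triples f P}
    \<subseteq> {s. set s \<subseteq> ?Z \<and> length s \<le> num_acts P} \<times> Pow ?Z \<times> (\<lambda>S. st_fired S P) ` Pow (act_positions P)"
  proof (clarify, intro conjI SigmaI CollectI)
    fix s N k assume ok: "ok_trace A s N" and t: "(map (apsnd (inst f)) s, apsnd (inst f) ` N, k) \<in> test_triples f P"
    then obtain Q where Q: "run f 0 P (map (apsnd (inst f)) s) Q" "k = st Q" by (auto simp: test_triples_def)
    show l: "length s \<le> num_acts P" using run_num_acts[OF Q(1)] by simp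
    show "k \<in> (\<lambda>S. st_fired S P) ` Pow (act_positions P)" using run_st[OF Q(1)] Q(2) by simp
    have Zi: "z \<in> ?Z" if "snd z \<in> Inl ` A \<union> Inr ` {..<i}" "i \<le> num_acts P" for z :: "pol \<times> asub" and i
      using that by (cases z) auto
    show "set s \<subseteq> ?Z"
    proof
      fix z assume "z \<in> set s"
      then obtain i where "i < length s" "z = s ! i" by (auto simp: in_set_conv_nth)
      then show "z \<in> ?Z" using ok l by (intro Zi[of z i]) (auto simp: ok_trace_def)
    qed
    show "N \<in> Pow ?Z" using ok l unfolding ok_trace_def by (auto intro!: Zi[of _ "length s"] simp del: mem_Sigma_iff)
  qed
qed

section \<open>Contexts that do not interfere\<close>

text \<open>\<open>k\<close> is the state of the idle part of the context, and \<open>A\<close>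
  contains its free names, which the rules forbid as objects.\<close>

definition inert_ctx :: "('k::comm_semiring_1 tm \<Rightarrow> 'k tm) \<Rightarrow> nat set \<Rightarrow> 'k \<Rightarrow> bool" where
  "inert_ctx C A k \<longleftrightarrow> finite A \<and>
     (\<forall>P. lc P \<longrightarrow> st (C P) = k * st P \<and> (\<forall>Q. tau (C P) Q \<longleftrightarrow> (\<exists>P'. Q = C P' \<and> tau P P')) \<and>
       (\<forall>e u x Q. x \<notin> A \<longrightarrow> (vis (C P) e u x Q \<longleftrightarrow> (\<exists>P'. Q = C P' \<and> vis P e u x P'))))"

lemma tau_ctx: "inert_ctx C A k \<Longrightarrow> lc P \<Longrightarrow> tau (C P) Q \<longleftrightarrow> (\<exists>P'. Q = C P' \<and> tau P P')"
  by (simp add: inert_ctx_def)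
lemma vis_ctx: "inert_ctx C A k \<Longrightarrow> lc P \<Longrightarrow> x \<notin> A \<Longrightarrow> vis (C P) e u x Q \<longleftrightarrow> (\<exists>P'. Q = C P' \<and> vis P e u x P')"
  by (simp add: inert_ctx_def)

lemma run_ctx:
  assumes "inert_ctx C A k" "lc P" "range f \<inter> A = {}"
  shows "run f n (C P) s Q \<longleftrightarrow> (\<exists>P'. Q = C P' \<and> run f n P s P')"
proof -
  have fA: "f i \<notin> A" for i using assms(3) by auto
  show ?thesis
  proof
    assume "run f n (C P) s Q"
    then show "\<exists>P'. Q = C P' \<and> run f n P s P'" using assms(2)
    proof (induction n "C P" s Q arbitrary: P rule: run.induct)
      case (nil n)
      then show ?case using run.nil by blast
    next
      case (tau P1 n s Q)
      then obtain P' where P': "P1 = C P'" "tau P P'" using tau_ctx[OF assms(1)] by metis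
      then obtain Q' where "Q = C Q'" "run f n P' s Q'" using tau.hyps(3)[of P'] tau_lc tau.prems by blast
      then show ?case using P' by (blast intro: run.tau)
    next
      case (vis e u n P1 s Q)
      then obtain P' where P': "P1 = C P'" "vis P e u (f n) P'" using vis_ctx[OF assms(1) vis.prems fA] by metis
      then obtain Q' where "Q = C Q'" "run f (Suc n) P' s Q'" using vis.hyps(3)[of P'] vis_lc vis.prems by blast
      then show ?case using P' by (blast intro: run.vis)
    qed
  next
    assume "\<exists>P'. Q = C P' \<and> run f n P s P'"
    then obtain P' where P': "Q = C P'" "run f n P s P'" by blast
    from P'(2) assms(2) show "run f n (C P) s Q" unfolding P'(1)
    proof (induction rule: run.induct)
      case (nil n P) then show ?case by (simp add: run.nil)
    next
      case (tau P P' n s Q)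
      then have "tau (C P) (C P')" using tau_ctx[OF assms(1)] by blast
      then show ?case using tau tau_lc by (metis run.tau)
    next
      case (vis P e u n P' s Q)
      then have "vis (C P) e u (f n) (C P')" using vis_ctx[OF assms(1) vis.prems fA] by blast
      then show ?case using vis vis_lc by (metis run.vis)
    qed
  qed
qed

lemma inits_ctx: assumes "inert_ctx C A k" "lc P" shows "inits (C P) = inits P"
proof -
  obtain x where "x \<notin> A \<union> fv P \<union> fv (C P)" using ex_fresh[of "A \<union> fv P \<union> fv (C P)"] assms(1) by (auto simp: inert_ctx_def)
  then have x: "x \<notin> A" "x \<notin> fv P" "x \<notin> fv (C P)" by auto
  have "(\<exists>Q. vis (C P) e u x Q) \<longleftrightarrow> (\<exists>Q. vis P e u x Q)" for e u
    using vis_ctx[OF assms x(1)] by blast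
  then show ?thesis using inits_iff[OF x(2)] inits_iff[OF x(3)] by auto
qed

lemma final_ctx: assumes "inert_ctx C A k" "lc P" shows "final (C P) = final P"
  unfolding final_tau tau_ctx[OF assms] by blast

lemma test_triples_ctx: assumes "inert_ctx C A k" "lc P" "range f \<inter> A = {}"
  shows "test_triples f (C P) = (\<lambda>(s, N, c). (s, N, k * c)) ` test_triples f P"
proof -
  have "(s, inits Q, st Q) = (s, inits P', k * st P') \<and> (final Q \<longleftrightarrow> final P')"
    if "Q = C P'" "run f 0 P s P'" for s Q P'
  proof -
    have "lc P'" using run_lc that(2) assms(2) by blast
    then show ?thesis using that(1) inits_ctx[OF assms(1)] final_ctx[OF assms(1)] assms(1)
      by (simp add: inert_ctx_def)
  qed
  then have *: "(s, inits Q, st Q) = (s, inits P', k * st P')" "final Q \<longleftrightarrow> final P'"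
    if "Q = C P'" "run f 0 P s P'" for s Q P' using that by blast+
  show ?thesis
  proof (intro equalityI subsetI)
    fix t assume "t \<in> test_triples f (C P)"
    then obtain s Q P' where Q: "t = (s, inits Q, st Q)" "final Q" "Q = C P'" "run f 0 P s P'"
      unfolding test_triples_def run_ctx[OF assms] by blast
    then have "t = (s, inits P', k * st P')" "(s, inits P', st P') \<in> test_triples f P"
      using *[OF Q(3,4)] unfolding test_triples_def by auto
    then show "t \<in> (\<lambda>(s, N, c). (s, N, k * c)) ` test_triples f P" by force
  next
    fix t assume "t \<in> (\<lambda>(s, N, c). (s, N, k * c)) ` test_triples f P"
    then obtain s P' where P': "t = (s, inits P', k * st P')" "run f 0 P s P'" "final P'" by (auto simp: test_triples_def)
    then have "t = (s, inits (C P'), st (C P'))" "final (C P')" using *[OF HOL.refl P'(2)] by auto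
    then show "t \<in> test_triples f (C P)" unfolding test_triples_def run_ctx[OF assms] using P'(2) by blast
  qed
qed

lemma inert_ctx_scal: "inert_ctx (scal k) {} k"
proof -
  have "tau (Par (Cst k) P) Q \<longleftrightarrow> (\<exists>P'. Q = Par (Cst k) P' \<and> tau P P')" for P Q
  proof -
    obtain x where "x \<notin> fv P" using ex_fresh[of "fv P"] by auto
    then show ?thesis by (subst tau_Par[of x]) auto
  qed
  then show ?thesis by (auto simp: inert_ctx_def scal_def vis_Par)
qed

text \<open>The two terms that \<open>msum2\<close> reduces to; the summand that was not chosen stays blocked.\<close>
definition chosenL :: "'k::comm_semiring_1 tm \<Rightarrow> 'k tm \<Rightarrow> 'k tm" where
  "chosenL Q P = Nu (Nu (Par (Par (Dia P) (Act Pos (B 1) Q)) (Dia (Cst 1))))"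
definition chosenR :: "'k::comm_semiring_1 tm \<Rightarrow> 'k tm \<Rightarrow> 'k tm" where
  "chosenR Q P = Nu (Nu (Par (Par (Act Pos (B 1) Q) (Dia P)) (Dia (Cst 1))))"

text \<open>The inner restriction comes from a communication whose object does not occur, so
  \<open>w\<close> is closed at index 1.\<close>

lemma tau_Nu_Nu_cls: "tau (Nu (Nu (cls (Suc 0) w P))) Q \<longleftrightarrow> (\<exists>P'. Q = Nu (Nu (cls (Suc 0) w P')) \<and> tau P P')" if "lc P"
  using tau_Nu_cls[of "Nu P" w Q] that by (simp add: tau_Nu_lc) (metis cls.simps(6))
lemma vis_Nu_Nu_cls: "vis (Nu (Nu (cls (Suc 0) w P))) e u x Q \<longleftrightarrow> u \<noteq> w \<and> (\<exists>P'. Q = Nu (Nu (cls (Suc 0) w P')) \<and> vis P e u x P')"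
  if "lc P" "w \<noteq> x"
  using vis_Nu_cls[of "Nu P" w x e u Q] that by (simp add: vis_Nu_lc) (metis cls.simps(6))

text \<open>The rejected summand waits on a restricted name whose only co-action has been consumed,
  so it stays idle; being guarded, it has state 1.\<close>

lemma inert_ctx_chosenL: assumes Q: "lc Q" shows "inert_ctx (chosenL Q) (fv Q) 1"
proof -
  have 1: "chosenL Q P = Nu (Nu (cls (Suc 0) w (Par (Par (Dia P) (Act Pos (F w) Q)) (Dia (Cst 1)))))"
    if "w \<notin> fv P" "w \<notin> fv Q" for w P using that by (simp add: chosenL_def)
  have tau: "tau (chosenL Q P) X \<longleftrightarrow> (\<exists>P'. X = chosenL Q P' \<and> tau P P')" if "lc P" for P X
  proof -
    obtain w where "w \<notin> fv P \<union> fv Q" using ex_fresh[of "fv P \<union> fv Q"] by auto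
    then have w: "w \<notin> fv P" "w \<notin> fv Q" by auto
    obtain x where "x \<notin> insert w (fv P \<union> fv Q)" using ex_fresh[of "insert w (fv P \<union> fv Q)"] by auto
    then have x: "x \<notin> fv P" "x \<notin> fv Q" "x \<noteq> w" by auto
    have "vis P e w x P' \<Longrightarrow> False" for e P' using vis_fv[of P e w x P'] w by auto
    then have *: "tau (Par (Par (Dia P) (Act Pos (F w) Q)) (Dia (Cst 1))) Y \<longleftrightarrow>
       (\<exists>P'. Y = Par (Par (Dia P') (Act Pos (F w) Q)) (Dia (Cst 1)) \<and> tau P P')" for Y
      using x w by (subst tau_Par[of x], simp, simp, subst tau_Par[of x]) (auto simp: tau_Dia vis_Dia vis_Act)
    have l: "lc (Par (Par (Dia P) (Act Pos (F w) Q)) (Dia (Cst 1)))" using that Q by simp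
    have "tau P P' \<Longrightarrow> chosenL Q P' = Nu (Nu (cls (Suc 0) w (Par (Par (Dia P') (Act Pos (F w) Q)) (Dia (Cst 1)))))" for P'
      using tau_fv w by (intro 1) blast+
    then show ?thesis unfolding 1[OF w] tau_Nu_Nu_cls[OF l] * by metis
  qed
  have vis: "vis (chosenL Q P) e u x X \<longleftrightarrow> (\<exists>P'. X = chosenL Q P' \<and> vis P e u x P')" if "lc P" "x \<notin> fv Q" for P e u x X
  proof -
    obtain w where "w \<notin> insert x (fv P \<union> fv Q)" using ex_fresh[of "insert x (fv P \<union> fv Q)"] by auto
    then have w: "w \<notin> fv P" "w \<notin> fv Q" "w \<noteq> x" by auto
    have wx: "vis P e u x P' \<Longrightarrow> w \<notin> fv P' \<and> u \<noteq> w" for P' using vis_fv[of P e u x P'] w by auto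
    have *: "u \<noteq> w \<Longrightarrow> vis (Par (Par (Dia P) (Act Pos (F w) Q)) (Dia (Cst 1))) e u x Y \<longleftrightarrow>
       (\<exists>P'. Y = Par (Par (Dia P') (Act Pos (F w) Q)) (Dia (Cst 1)) \<and> vis P e u x P')" for Y
      using that(2) w by (auto simp: vis_Dia vis_Act vis_Par)
    have l: "lc (Par (Par (Dia P) (Act Pos (F w) Q)) (Dia (Cst 1)))" using that Q by simp
    have "vis P e u x P' \<Longrightarrow> chosenL Q P' = Nu (Nu (cls (Suc 0) w (Par (Par (Dia P') (Act Pos (F w) Q)) (Dia (Cst 1)))))" for P'
      using wx w by (intro 1) blast+
    then show ?thesis unfolding 1[OF w(1,2)] vis_Nu_Nu_cls[OF l w(3)] using * wx by metis
  qed
  show ?thesis unfolding inert_ctx_def using tau vis by (simp add: chosenL_def)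
qed

lemma inert_ctx_chosenR: assumes Q: "lc Q" shows "inert_ctx (chosenR Q) (fv Q) 1"
proof -
  have 1: "chosenR Q P = Nu (Nu (cls (Suc 0) w (Par (Par (Act Pos (F w) Q) (Dia P)) (Dia (Cst 1)))))"
    if "w \<notin> fv P" "w \<notin> fv Q" for w P using that by (simp add: chosenR_def)
  have tau: "tau (chosenR Q P) X \<longleftrightarrow> (\<exists>P'. X = chosenR Q P' \<and> tau P P')" if "lc P" for P X
  proof -
    obtain w where "w \<notin> fv P \<union> fv Q" using ex_fresh[of "fv P \<union> fv Q"] by auto
    then have w: "w \<notin> fv P" "w \<notin> fv Q" by auto
    obtain x where "x \<notin> insert w (fv P \<union> fv Q)" using ex_fresh[of "insert w (fv P \<union> fv Q)"] by auto
    then have x: "x \<notin> fv P" "x \<notin> fv Q" "x \<noteq> w" by auto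
    have "vis P e w x P' \<Longrightarrow> False" for e P' using vis_fv[of P e w x P'] w by auto
    then have *: "tau (Par (Par (Act Pos (F w) Q) (Dia P)) (Dia (Cst 1))) Y \<longleftrightarrow>
       (\<exists>P'. Y = Par (Par (Act Pos (F w) Q) (Dia P')) (Dia (Cst 1)) \<and> tau P P')" for Y
      using x w by (subst tau_Par[of x], simp, simp, subst tau_Par[of x]) (auto simp: tau_Dia vis_Dia vis_Act)
    have l: "lc (Par (Par (Act Pos (F w) Q) (Dia P)) (Dia (Cst 1)))" using that Q by simp
    have "tau P P' \<Longrightarrow> chosenR Q P' = Nu (Nu (cls (Suc 0) w (Par (Par (Act Pos (F w) Q) (Dia P')) (Dia (Cst 1)))))" for P'
      using tau_fv w by (intro 1) blast+
    then show ?thesis unfolding 1[OF w] tau_Nu_Nu_cls[OF l] * by metis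
  qed
  have vis: "vis (chosenR Q P) e u x X \<longleftrightarrow> (\<exists>P'. X = chosenR Q P' \<and> vis P e u x P')" if "lc P" "x \<notin> fv Q" for P e u x X
  proof -
    obtain w where "w \<notin> insert x (fv P \<union> fv Q)" using ex_fresh[of "insert x (fv P \<union> fv Q)"] by auto
    then have w: "w \<notin> fv P" "w \<notin> fv Q" "w \<noteq> x" by auto
    have wx: "vis P e u x P' \<Longrightarrow> w \<notin> fv P' \<and> u \<noteq> w" for P' using vis_fv[of P e u x P'] w by auto
    have *: "u \<noteq> w \<Longrightarrow> vis (Par (Par (Act Pos (F w) Q) (Dia P)) (Dia (Cst 1))) e u x Y \<longleftrightarrow>
       (\<exists>P'. Y = Par (Par (Act Pos (F w) Q) (Dia P')) (Dia (Cst 1)) \<and> vis P e u x P')" for Y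
      using that(2) w by (auto simp: vis_Dia vis_Act vis_Par)
    have l: "lc (Par (Par (Act Pos (F w) Q) (Dia P)) (Dia (Cst 1)))" using that Q by simp
    have "vis P e u x P' \<Longrightarrow> chosenR Q P' = Nu (Nu (cls (Suc 0) w (Par (Par (Act Pos (F w) Q) (Dia P')) (Dia (Cst 1)))))" for P'
      using wx w by (intro 1) blast+
    then show ?thesis unfolding 1[OF w(1,2)] vis_Nu_Nu_cls[OF l w(3)] using * wx by metis
  qed
  show ?thesis unfolding inert_ctx_def using tau vis by (simp add: chosenR_def)
qed

lemma fresh_nm: "finite A \<Longrightarrow> fresh_nm A \<notin> A"
  unfolding fresh_nm_def using ex_fresh[of A] by (metis LeastI)

section \<open>Triples of sums\<close>

lemma msum2_eq: "msum2 P Q = Nu (Par (Par (Act Pos (B 0) P) (Act Pos (B 0) Q)) (Act Neg (B 0) (Cst 1)))"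
  using fresh_nm[of "fv P \<union> fv Q"] by (simp add: msum2_def Let_def)

lemma fv_msum2[simp]: "fv (msum2 P Q) = fv P \<union> fv Q" by (simp add: msum2_eq)
lemma lc_msum2[simp]: "lc P \<Longrightarrow> lc Q \<Longrightarrow> lc (msum2 P Q)" by (simp add: msum2_eq)

text \<open>All outer prefixes carry the restricted name, so nothing is offered and the two
  communications are the only steps; in particular the sum is not final before the choice.\<close>

lemma msum2_steps: assumes "lc P" "lc Q"
  shows "tau (msum2 P Q) X \<longleftrightarrow> X = chosenL Q P \<or> X = chosenR P Q" and "\<not> vis (msum2 P Q) e u x X"
proof -
  obtain w where "w \<notin> insert x (fv P \<union> fv Q)" using ex_fresh[of "insert x (fv P \<union> fv Q)"] by auto
  then have w: "w \<notin> fv P" "w \<notin> fv Q" "w \<noteq> x" by auto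
  have 1: "msum2 P Q = Nu (cls 0 w (Par (Par (Act Pos (F w) P) (Act Pos (F w) Q)) (Act Neg (F w) (Cst 1))))"
    using w by (simp add: msum2_eq)
  show "\<not> vis (msum2 P Q) e u x X"
    using w assms by (subst 1, subst vis_Nu_cls) (auto simp: vis_Par vis_Act)
  obtain y where "y \<notin> insert w (fv P \<union> fv Q)" using ex_fresh[of "insert w (fv P \<union> fv Q)"] by auto
  then have y: "y \<notin> fv P" "y \<notin> fv Q" "y \<noteq> w" by auto
  have "tau (Par (Par (Act Pos (F w) P) (Act Pos (F w) Q)) (Act Neg (F w) (Cst 1))) Y \<longleftrightarrow>
     Y = Nu (Par (Par (Dia P) (Act Pos (F w) Q)) (Dia (Cst 1))) \<or> Y = Nu (Par (Par (Act Pos (F w) P) (Dia Q)) (Dia (Cst 1)))" for Y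
    using y w assms by (subst tau_Par[of y], simp, simp, subst tau_Par[of y]) (auto simp: vis_Act vis_Par conj_disj_distribR ex_disj_distrib)
  moreover have "chosenL Q P = Nu (cls 0 w (Nu (Par (Par (Dia P) (Act Pos (F w) Q)) (Dia (Cst 1)))))"
    "chosenR P Q = Nu (cls 0 w (Nu (Par (Par (Act Pos (F w) P) (Dia Q)) (Dia (Cst 1)))))"
    using w by (simp_all add: chosenL_def chosenR_def)
  moreover have "lc (Par (Par (Act Pos (F w) P) (Act Pos (F w) Q)) (Act Neg (F w) (Cst 1)))"
    using assms by simp
  ultimately show "tau (msum2 P Q) X \<longleftrightarrow> X = chosenL Q P \<or> X = chosenR P Q"
    unfolding 1 by (simp only: tau_Nu_cls) blast
qed

lemma test_triples_tau_step: assumes "tau P Q" shows "test_triples f Q \<subseteq> test_triples f P"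
  unfolding test_triples_def using run.tau[OF assms] by blast

lemma test_triples_msum2: assumes "lc P" "lc Q" "good f 0 P" "good f 0 Q"
  shows "test_triples f (msum2 P Q) = test_triples f P \<union> test_triples f Q"
proof -
  have r: "range f \<inter> fv P = {}" "range f \<inter> fv Q = {}" using assms(3,4) by (auto simp: good_def)
  have "test_triples f (msum2 P Q) = test_triples f (chosenL Q P) \<union> test_triples f (chosenR P Q)"
  proof (intro equalityI subsetI)
    fix t assume "t \<in> test_triples f (msum2 P Q)"
    then obtain s X where X: "t = (s, inits X, st X)" "run f 0 (msum2 P Q) s X" "final X" by (auto simp: test_triples_def)
    from X(2) show "t \<in> test_triples f (chosenL Q P) \<union> test_triples f (chosenR P Q)"
    proof (cases rule: run.cases)
      case nil
      then show ?thesis using X msum2_steps[OF assms(1,2)] by (auto simp: final_tau)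
    next
      case (tau Y)
      then show ?thesis using X msum2_steps[OF assms(1,2)] by (auto simp: test_triples_def)
    next
      case (vis e u Y s')
      then show ?thesis using msum2_steps[OF assms(1,2)] by auto
    qed
  next
    fix t assume "t \<in> test_triples f (chosenL Q P) \<union> test_triples f (chosenR P Q)"
    then show "t \<in> test_triples f (msum2 P Q)"
      using test_triples_tau_step msum2_steps(1)[OF assms(1,2)] by blast
  qed
  also have "test_triples f (chosenL Q P) = test_triples f P" using test_triples_ctx[OF inert_ctx_chosenL[OF assms(2)] assms(1) r(2)] by simp
  also have "test_triples f (chosenR P Q) = test_triples f Q" using test_triples_ctx[OF inert_ctx_chosenR[OF assms(1)] assms(2) r(1)] by simp
  finally show ?thesis .
qed

lemma lc_msum: "(\<And>P. P \<in> set Ps \<Longrightarrow> lc P) \<Longrightarrow> lc (msum Ps)"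
  by (induction Ps rule: msum.induct) auto
lemma test_triples_Cst: "(s, N, k) \<in> test_triples f (Cst c) \<Longrightarrow> k = c"
  by (auto simp: test_triples_def elim: run.cases)

text \<open>Asking for a nonzero \<open>k\<close> accommodates the empty sum, which has a triple of
  state 0.\<close>

lemma test_triples_msum:
  "(\<And>P. P \<in> set Ps \<Longrightarrow> lc P) \<Longrightarrow> good f 0 (msum Ps) \<Longrightarrow> k \<noteq> 0 \<Longrightarrow>
    (s, N, k) \<in> test_triples f (msum Ps) \<longleftrightarrow> (\<exists>P\<in>set Ps. (s, N, k) \<in> test_triples f P)"
proof (induction Ps rule: msum.induct)
  case 1
  then show ?case using test_triples_Cst by fastforce
next
  case (3 P P2 Ps)
  let ?M = "msum (P2 # Ps)"
  have g: "good f 0 P" "good f 0 ?M" using 3(3) by (auto simp: good_def)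
  have "test_triples f (msum (P # P2 # Ps)) = test_triples f P \<union> test_triples f ?M"
    using test_triples_msum2[OF _ _ g] lc_msum[of "P2 # Ps"] 3(2) by simp
  then show ?case using 3(1) 3(2,4) g by auto
qed simp

section \<open>Linear actions\<close>

text \<open>\<open>lin\<close> in de Bruijn form, then the same term after the action was performed, and after the
  success signal on the restricted name was consumed. In the first two the signal may still be
  consumed by the branch with state 0.\<close>
definition lin_act :: "pol \<Rightarrow> nat \<Rightarrow> 'k::comm_semiring_1 tm \<Rightarrow> 'k tm" where
  "lin_act e u G = Nu (Par (Act e (F u) (Par G (Act Pos (B 1) (Cst 1))))
                      (Par (Act Pos (B 0) (Cst 0)) (Act Neg (B 0) (Cst 1))))"
definition lin_fired :: "'k::comm_semiring_1 tm \<Rightarrow> 'k tm" where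
  "lin_fired P = Nu (Par (Dia (Par P (Act Pos (B 0) (Cst 1)))) (Par (Act Pos (B 0) (Cst 0)) (Act Neg (B 0) (Cst 1))))"
definition lin_done :: "'k::comm_semiring_1 tm \<Rightarrow> 'k tm" where
  "lin_done P = Nu (Nu (Par (Dia (Par P (Dia (Cst 1)))) (Par (Act Pos (B 1) (Cst 0)) (Dia (Cst 1)))))"

lemma lin_eq: "lin e u x P = lin_act e u (cls 0 x P)"
  using fresh_nm[of "insert u (insert x (fv P))"] by (auto simp: lin_def lin_act_def Let_def)
lemma lin0_eq: "lin0 e u P = lin_act e u P"
  using fresh_nm[of "insert u (fv P)"] by (simp add: lin0_def lin_eq)

lemma fv_lin_act[simp]: "fv (lin_act e u G) = insert u (fv G)" by (auto simp: lin_act_def)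
lemma lc_lin_act[simp]: "wfd (Suc 0) G \<Longrightarrow> lc (lin_act e u G)" by (auto simp: lin_act_def intro: wfd_mono)
lemma st_lin_act[simp]: "st (lin_act e u G) = 1" by (simp add: lin_act_def)
lemma lc_on[simp]: "lc P \<Longrightarrow> lc (lin_fired P)" "lc P \<Longrightarrow> lc (lin_done P)" by (auto simp: lin_fired_def lin_done_def)
lemma fv_on[simp]: "fv (lin_fired P) = fv P" "fv (lin_done P) = fv P" by (auto simp: lin_fired_def lin_done_def)
lemma st_on[simp]: "st (lin_fired P) = st P" "st (lin_done P) = st P" by (auto simp: lin_fired_def lin_done_def)

text \<open>The pair can always communicate with itself, ending in state 0. Its negative end can be
  taken away safely only by the success signal of the performed action.\<close>

abbreviation watch :: "nat \<Rightarrow> 'k::comm_semiring_1 tm" where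
  "watch w \<equiv> Par (Act Pos (F w) (Cst 0)) (Act Neg (F w) (Cst 1))"

lemma tau_watch: "tau (watch w) X \<Longrightarrow> st X = 0"
proof -
  assume *: "tau (watch w) X"
  obtain y where "y \<noteq> w" using ex_fresh[of "{w}"] by auto
  with * show ?thesis by (subst (asm) tau_Par[of y]) (auto simp: vis_Act)
qed
lemma watch_tau: "\<exists>X. tau (watch w :: 'k::comm_semiring_1 tm) X"
proof -
  obtain y where y: "y \<noteq> w" using ex_fresh[of "{w}"] by auto
  have v: "vis (Act Pos (F w) (Cst 0)) Pos w y (Dia (Cst 0 :: 'k tm))"
    "vis (Act Neg (F w) (Cst 1)) (negp Pos) w y (Dia (Cst 1 :: 'k tm))" using y by (auto simp: vis_Act)
  have "y \<notin> fv (Act Pos (F w) (Cst 0 :: 'k tm))" "y \<notin> fv (Act Neg (F w) (Cst 1 :: 'k tm))" using y by auto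
  from tau_Par[OF this] show ?thesis using v by metis
qed

lemma lin_act_named: "w \<notin> fv G \<Longrightarrow> w \<noteq> u \<Longrightarrow> lin_act e u G = Nu (cls 0 w (Par (Act e (F u) (Par G (Act Pos (F w) (Cst 1)))) (watch w)))"
  by (simp add: lin_act_def)
lemma lin_fired_named: "w \<notin> fv P \<Longrightarrow> lin_fired P = Nu (cls 0 w (Par (Dia (Par P (Act Pos (F w) (Cst 1)))) (watch w)))"
  by (simp add: lin_fired_def)
lemma lin_done_named: "w \<notin> fv P \<Longrightarrow> lin_done P = Nu (Nu (cls (Suc 0) w (Par (Dia (Par P (Dia (Cst 1)))) (Par (Act Pos (F w) (Cst 0)) (Dia (Cst 1))))))"
  by (simp add: lin_done_def)

lemma vis_lin_act:
  assumes "wfd (Suc 0) G"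
  shows "vis (lin_act e u G) e' u' x Q \<longleftrightarrow> e' = e \<and> u' = u \<and> x \<noteq> u \<and> x \<notin> fv G \<and> Q = lin_fired (opn 0 x G)"
proof -
  obtain w where "w \<notin> insert x (insert u (fv G))" using ex_fresh[of "insert x (insert u (fv G))"] by auto
  then have w: "w \<notin> fv G" "w \<noteq> u" "w \<noteq> x" by auto
  have l: "lc (Par (Act e (F u) (Par G (Act Pos (F w) (Cst 1)))) (watch w))" using assms by simp
  have "w \<notin> fv (opn 0 x G)" using fv_opn[of 0 x G] w by auto
  then have o: "lin_fired (opn 0 x G) = Nu (cls 0 w (Par (Dia (Par (opn 0 x G) (Act Pos (F w) (Cst 1)))) (watch w)))"
    by (rule lin_fired_named)
  have "vis (Par (Act e (F u) (Par G (Act Pos (F w) (Cst 1)))) (watch w)) e' u' x Y \<longleftrightarrow>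
    e' = e \<and> u' = u \<and> x \<noteq> u \<and> x \<notin> fv G \<and> Y = Par (Dia (Par (opn 0 x G) (Act Pos (F w) (Cst 1)))) (watch w)" if "u' \<noteq> w" for Y
    using w that by (auto simp: vis_Par vis_Act)
  then show ?thesis unfolding lin_act_named[OF w(1,2)] vis_Nu_cls[OF l w(3)] o using w by metis
qed

text \<open>A pending action is never final, but its own internal steps are fatal: only its visible
  action leads on to a nonzero state.\<close>

lemma tau_lin_act:
  fixes G :: "'a::comm_semiring_1 tm"
  assumes "wfd (Suc 0) G"
  shows "tau (lin_act e u G) Q \<Longrightarrow> st Q = 0" and "\<exists>Q. tau (lin_act e u G) Q"
proof -
  obtain w where "w \<notin> insert u (fv G)" using ex_fresh[of "insert u (fv G)"] by auto
  then have w: "w \<notin> fv G" "w \<noteq> u" by auto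
  obtain y where "y \<notin> insert w (insert u (fv G))" using ex_fresh[of "insert w (insert u (fv G))"] by auto
  then have y: "y \<notin> fv G" "y \<noteq> u" "y \<noteq> w" by auto
  let ?A = "Act e (F u) (Par G (Act Pos (F w) (Cst 1)))"
  have l: "lc (Par ?A (watch w))" using assms by simp
  have f: "y \<notin> fv ?A" "y \<notin> fv (watch w)" using y by auto
  show "st Q = 0" if t: "tau (lin_act e u G) Q"
  proof -
    obtain Y where Y: "Q = Nu (cls 0 w Y)" "tau (Par ?A (watch w)) Y"
      using t unfolding lin_act_named[OF w] tau_Nu_cls[OF l] by blast
    from Y(2) have "\<exists>X. Y = Par ?A X \<and> tau (watch w) X"
      unfolding tau_Par[OF f] using w by (auto simp: vis_Act vis_Par)
    then show ?thesis using Y(1) by (auto dest: tau_watch)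
  qed
  show "\<exists>Q. tau (lin_act e u G) Q"
  proof -
    obtain X where "tau (watch w :: 'a tm) X" using watch_tau by blast
    then have "tau (Par ?A (watch w)) (Par ?A X)" unfolding tau_Par[OF f] by blast
    then show ?thesis unfolding lin_act_named[OF w] tau_Nu_cls[OF l] by blast
  qed
qed

lemma vis_lin_fired:
  assumes "lc P"
  shows "vis (lin_fired P) e u x Q \<longleftrightarrow> (\<exists>P'. Q = lin_fired P' \<and> vis P e u x P')"
proof -
  obtain w where "w \<notin> insert x (fv P)" using ex_fresh[of "insert x (fv P)"] by auto
  then have w: "w \<notin> fv P" "w \<noteq> x" by auto
  let ?M = "\<lambda>P. Par (Dia (Par P (Act Pos (F w) (Cst 1)))) (watch w)"
  have l: "lc (?M P)" using assms by simp
  have wx: "w \<notin> fv P' \<and> u \<noteq> w" if "vis P e u x P'" for P' using vis_fv[OF that] w by auto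
  have "u \<noteq> w \<Longrightarrow> vis (?M P) e u x Y \<longleftrightarrow> (\<exists>P'. Y = ?M P' \<and> vis P e u x P')" for Y
    using w by (auto simp: vis_Par vis_Act vis_Dia)
  then show ?thesis unfolding lin_fired_named[OF w(1)] vis_Nu_cls[OF l w(2)] using wx lin_fired_named by metis
qed

text \<open>The step comes from the watch alone, from the success signal, or from the body. By the
  second part the success signal is always available, so a performed action can be made safe at any
  time.\<close>

lemma tau_lin_fired:
  assumes "lc P"
  shows "tau (lin_fired P) Q \<Longrightarrow> st Q = 0 \<or> Q = lin_done P \<or> (\<exists>P'. Q = lin_fired P' \<and> tau P P')" and "tau (lin_fired P) (lin_done P)"
proof -
  obtain w where w: "w \<notin> fv P" using ex_fresh[of "fv P"] by auto
  obtain y where "y \<notin> insert w (fv P)" using ex_fresh[of "insert w (fv P)"] by auto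
  then have y: "y \<notin> fv P" "y \<noteq> w" by auto
  let ?A = "\<lambda>P. Dia (Par P (Act Pos (F w) (Cst 1)))"
  let ?A' = "Dia (Par P (Dia (Cst 1)))" and ?W = "Par (Act Pos (F w) (Cst 0)) (Dia (Cst 1))"
  have l: "lc (Par (?A P) (watch w))" using assms by simp
  have f: "y \<notin> fv (?A P)" "y \<notin> fv (watch w)" "y \<notin> fv P" "y \<notin> fv (Act Pos (F w) (Cst 1))" using y by auto
  have nw: "\<not> vis P e w x P'" for e x P' using vis_fv[of P e w x P'] w by auto
  have tA: "tau (?A P) X \<longleftrightarrow> (\<exists>P'. X = ?A P' \<and> tau P P')" for X
    unfolding tau_Dia tau_Par[OF f(3,4)] using nw by (auto simp: vis_Act)
  have lin_done: "lin_done P = Nu (cls 0 w (Nu (cls 0 y (Par ?A' ?W))))" using w y by (simp add: lin_done_def)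
  have lin_fired: "lin_fired P' = Nu (cls 0 w (Par (?A P') (watch w)))" if "tau P P'" for P'
    by (rule lin_fired_named) (use tau_fv[OF that] w in auto)
  show "st Q = 0 \<or> Q = lin_done P \<or> (\<exists>P'. Q = lin_fired P' \<and> tau P P')" if t: "tau (lin_fired P) Q"
  proof -
    obtain Y where Y: "Q = Nu (cls 0 w Y)" "tau (Par (?A P) (watch w)) Y"
      using t unfolding lin_fired_named[OF w] tau_Nu_cls[OF l] by blast
    from Y(2) consider P' where "Y = Par (?A P') (watch w)" "tau P P'" | X where "Y = Par (?A P) X" "tau (watch w) X"
      | "Y = Nu (cls 0 y (Par ?A' ?W))"
      unfolding tau_Par[OF f(1,2)] tA using nw by (auto simp: vis_Act vis_Par vis_Dia)
    then show ?thesis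
    proof cases
      case 1 then show ?thesis using Y(1) lin_fired by metis
    next
      case 2 then show ?thesis using Y by (auto dest: tau_watch)
    next
      case 3 then show ?thesis using Y(1) lin_done by metis
    qed
  qed
  have "vis (?A P) Pos w y ?A'" "vis (watch w) (negp Pos) w y ?W"
    using y by (auto simp: vis_Dia vis_Par vis_Act)
  then show "tau (lin_fired P) (lin_done P)"
    unfolding lin_fired_named[OF w] tau_Nu_cls[OF l] lin_done tau_Par[OF f(1,2)] by metis
qed

text \<open>The positive end with state 0 is left without a partner; as a guarded term it counts as
  1.\<close>

lemma inert_ctx_lin_done: "inert_ctx lin_done {} (1::'k::comm_semiring_1)"
proof -
  have tau: "tau (lin_done P) X \<longleftrightarrow> (\<exists>P'. X = lin_done P' \<and> tau P P')" if P: "lc P" for P X :: "'k::comm_semiring_1 tm"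
  proof -
    obtain w where w: "w \<notin> fv P" using ex_fresh[of "fv P"] by auto
    obtain x where "x \<notin> insert w (fv P)" using ex_fresh[of "insert w (fv P)"] by auto
    then have x: "x \<notin> fv P" "x \<noteq> w" by auto
    let ?M = "\<lambda>P. Par (Dia (Par P (Dia (Cst 1)))) (Par (Act Pos (F w) (Cst 0)) (Dia (Cst 1 :: 'k tm)))"
    have l: "lc (?M P)" using P by simp
    have "\<not> vis P e w x P'" for e P' using vis_fv[of P e w x P'] w by auto
    then have *: "tau (?M P) Y \<longleftrightarrow> (\<exists>P'. Y = ?M P' \<and> tau P P')" for Y
      using x w tau_Par[of x "Act Pos (F w) (Cst 0)" "Dia (Cst 1)"] tau_Par[of x P "Dia (Cst 1)"]
      by (subst tau_Par[of x]) (auto simp: tau_Dia vis_Dia vis_Act vis_Par)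
    have "tau P P' \<Longrightarrow> lin_done P' = Nu (Nu (cls (Suc 0) w (?M P')))" for P'
      using tau_fv w by (intro lin_done_named) blast
    then show ?thesis unfolding lin_done_named[OF w] tau_Nu_Nu_cls[OF l] * by metis
  qed
  have vis: "vis (lin_done P) e u x X \<longleftrightarrow> (\<exists>P'. X = lin_done P' \<and> vis P e u x P')" if P: "lc P" for P X :: "'k::comm_semiring_1 tm" and e u x
  proof -
    obtain w where "w \<notin> insert x (fv P)" using ex_fresh[of "insert x (fv P)"] by auto
    then have w: "w \<notin> fv P" "w \<noteq> x" by auto
    let ?M = "\<lambda>P. Par (Dia (Par P (Dia (Cst 1)))) (Par (Act Pos (F w) (Cst 0)) (Dia (Cst 1 :: 'k tm)))"
    have l: "lc (?M P)" using P by simp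
    have wx: "w \<notin> fv P' \<and> u \<noteq> w" if "vis P e u x P'" for P' using vis_fv[OF that] w by auto
    have "u \<noteq> w \<Longrightarrow> vis (?M P) e u x Y \<longleftrightarrow> (\<exists>P'. Y = ?M P' \<and> vis P e u x P')" for Y
      using w by (auto simp: vis_Dia vis_Act vis_Par)
    then show ?thesis unfolding lin_done_named[OF w(1)] vis_Nu_Nu_cls[OF l w(2)] using wx lin_done_named by metis
  qed
  show ?thesis unfolding inert_ctx_def using tau vis by simp
qed

text \<open>\<open>Lin e u G\<close> is a pending linear action with body \<open>G\<close>, \<open>Blk e u\<close> is the prefix of an element of \<open>N\<close>.\<close>
datatype 'k item = Lin pol nat "'k tm" | Blk pol nat

text \<open>The active prefixes of a term, up to the residues left by linear actions that were performed.\<close>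
inductive exposes :: "'k::comm_semiring_1 tm \<Rightarrow> 'k item multiset \<Rightarrow> bool" where
  one: "exposes (Cst 1) {#}"
| sep: "exposes P M \<Longrightarrow> exposes Q N \<Longrightarrow> exposes (Sep P Q) (M + N)"
| blk: "exposes (Act e (F u) (Cst 0)) {#Blk e u#}"
| lin: "wfd (Suc 0) G \<Longrightarrow> exposes (lin_act e u G) {#Lin e u G#}"
| lin_fired: "exposes P M \<Longrightarrow> exposes (lin_fired P) M"
| lin_done: "exposes P M \<Longrightarrow> exposes (lin_done P) M"

lemma exposes_lc: "exposes P M \<Longrightarrow> lc P" by (induction rule: exposes.induct) auto
lemma exposes_st: "exposes P M \<Longrightarrow> st P = 1" by (induction rule: exposes.induct) auto

text \<open>Performing an element of \<open>N\<close> uncovers its continuation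
  \<open>Cst 0\<close>. For a linear action the items of the opened body are left as a parameter
  \<open>M'\<close>, since the multiset stores the body as a term.\<close>

lemma exposes_vis: "exposes P M \<Longrightarrow> vis P e u x P' \<Longrightarrow> (Blk e u \<in># M \<and> st P' = 0) \<or>
   (\<exists>G M0. M = add_mset (Lin e u G) M0 \<and> (\<forall>M'. exposes (opn 0 x G) M' \<longrightarrow> exposes P' (M0 + M')))"
proof (induction arbitrary: P' rule: exposes.induct)
  case (sep P M Q N)
  from sep.prems consider P1 where "P' = Sep P1 Q" "vis P e u x P1" | Q1 where "P' = Sep P Q1" "vis Q e u x Q1"
    by (auto simp: vis_Sep)
  then show ?case
  proof cases
    case 1
    show ?thesis using sep.IH(1)[OF 1(2)]
    proof (elim disjE exE conjE)
      fix G M0 assume *: "M = add_mset (Lin e u G) M0" "\<forall>M'. exposes (opn 0 x G) M' \<longrightarrow> exposes P1 (M0 + M')"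
      have "exposes P' (M0 + N + M')" if "exposes (opn 0 x G) M'" for M'
        using exposes.sep[of P1 "M0 + M'" Q N] * that sep.hyps 1 by (simp add: ac_simps)
      then show ?thesis using * by (metis union_mset_add_mset_left)
    qed (use 1 in auto)
  next
    case 2
    show ?thesis using sep.IH(2)[OF 2(2)]
    proof (elim disjE exE conjE)
      fix G M0 assume *: "N = add_mset (Lin e u G) M0" "\<forall>M'. exposes (opn 0 x G) M' \<longrightarrow> exposes Q1 (M0 + M')"
      have "exposes P' (M + M0 + M')" if "exposes (opn 0 x G) M'" for M'
        using exposes.sep[of P M Q1 "M0 + M'"] * that sep.hyps 2 by (simp add: ac_simps)
      then show ?thesis using * by (metis union_mset_add_mset_right)
    qed (use 2 in auto)
  qed
next
  case (blk e' u')
  then show ?case by (auto simp: vis_Act)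
next
  case (lin G e' u')
  then show ?case using exposes.lin_fired by (auto simp: vis_lin_act)
next
  case (lin_fired P M)
  then obtain P1 where P1: "P' = lin_fired P1" "vis P e u x P1" using vis_lin_fired exposes_lc by blast
  show ?case using lin_fired.IH[OF P1(2)] P1(1) exposes.lin_fired by fastforce
next
  case (lin_done P M)
  then obtain P1 where P1: "P' = lin_done P1" "vis P e u x P1" using vis_ctx[OF inert_ctx_lin_done] exposes_lc by blast
  show ?case using lin_done.IH[OF P1(2)] P1(1) exposes.lin_done by fastforce
qed auto

lemma exposes_Lin: "exposes P M \<Longrightarrow> M = add_mset (Lin e u G) M0 \<Longrightarrow> x \<notin> fv P \<Longrightarrow>
   \<exists>P'. vis P e u x P' \<and> (\<forall>M'. exposes (opn 0 x G) M' \<longrightarrow> exposes P' (M0 + M'))"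
proof (induction arbitrary: M0 rule: exposes.induct)
  case (sep P M Q N)
  then have "Lin e u G \<in># M \<or> Lin e u G \<in># N" by (metis union_iff union_single_eq_member)
  then show ?case
  proof
    assume "Lin e u G \<in># M"
    then obtain M1 where M1: "M = add_mset (Lin e u G) M1" by (metis mset_add)
    then have M0: "M0 = M1 + N" using sep.prems by simp
    obtain P1 where P1: "vis P e u x P1" "\<forall>M'. exposes (opn 0 x G) M' \<longrightarrow> exposes P1 (M1 + M')"
      using sep.IH(1)[OF M1] sep.prems by auto
    have "exposes (Sep P1 Q) (M0 + M')" if "exposes (opn 0 x G) M'" for M'
      using exposes.sep[of P1 "M1 + M'" Q N] P1 that sep.hyps M0 by (simp add: ac_simps)
    then show ?thesis using P1(1) sep.prems by (auto simp: vis_Sep)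
  next
    assume "Lin e u G \<in># N"
    then obtain M1 where M1: "N = add_mset (Lin e u G) M1" by (metis mset_add)
    then have M0: "M0 = M + M1" using sep.prems by simp
    obtain P1 where P1: "vis Q e u x P1" "\<forall>M'. exposes (opn 0 x G) M' \<longrightarrow> exposes P1 (M1 + M')"
      using sep.IH(2)[OF M1] sep.prems by auto
    have "exposes (Sep P P1) (M0 + M')" if "exposes (opn 0 x G) M'" for M'
      using exposes.sep[of P M P1 "M1 + M'"] P1 that sep.hyps M0 by (simp add: ac_simps)
    then show ?thesis using P1(1) sep.prems by (auto simp: vis_Sep)
  qed
next
  case (lin G' e' u')
  then show ?case using exposes.lin_fired by (auto simp: vis_lin_act)
next
  case (lin_fired P M)
  then obtain P1 where "vis P e u x P1" "\<forall>M'. exposes (opn 0 x G) M' \<longrightarrow> exposes P1 (M0 + M')" by fastforce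
  then show ?case using vis_lin_fired[OF exposes_lc[OF lin_fired.hyps]] exposes.lin_fired by blast
next
  case (lin_done P M)
  then obtain P1 where "vis P e u x P1" "\<forall>M'. exposes (opn 0 x G) M' \<longrightarrow> exposes P1 (M0 + M')" by fastforce
  then show ?case using vis_ctx[OF inert_ctx_lin_done exposes_lc[OF lin_done.hyps]] exposes.lin_done by blast
qed auto

lemma exposes_Blk: "exposes P M \<Longrightarrow> Blk e u \<in># M \<Longrightarrow> x \<notin> fv P \<Longrightarrow> \<exists>P'. vis P e u x P'"
proof (induction rule: exposes.induct)
  case (sep P M Q N)
  then show ?case by (auto simp: vis_Sep)
next
  case (lin_fired P M)
  then show ?case using vis_lin_fired[OF exposes_lc[OF lin_fired.hyps]] by auto
next
  case (lin_done P M)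
  then show ?case using vis_ctx[OF inert_ctx_lin_done exposes_lc[OF lin_done.hyps]] by auto
qed (auto simp: vis_Act)

text \<open>Under \<open>Sep\<close> nothing communicates across, so internal steps only complete or
  spoil the linear actions themselves.\<close>

lemma exposes_tau: "exposes P M \<Longrightarrow> tau P P' \<Longrightarrow> st P' = 0 \<or> exposes P' M"
proof (induction arbitrary: P' rule: exposes.induct)
  case (sep P M Q N)
  then show ?case by (auto simp: tau_Sep intro: exposes.sep) (metis exposes.sep mult_zero_left mult_zero_right)+
next
  case (lin G e u)
  then show ?case using tau_lin_act by blast
next
  case (lin_fired P M)
  have l: "lc P" using exposes_lc lin_fired.hyps by blast
  from tau_lin_fired(1)[OF l lin_fired.prems] show ?case
  proof (elim disjE exE conjE)
    fix P1 assume "P' = lin_fired P1" "tau P P1"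
    then show ?thesis using lin_fired.IH[of P1] exposes.lin_fired[of P1 M] by auto
  qed (use exposes.lin_done[OF lin_fired.hyps] in auto)
next
  case (lin_done P M)
  then show ?case using tau_ctx[OF inert_ctx_lin_done exposes_lc[OF lin_done.hyps]] exposes.lin_done by fastforce
qed auto

lemma exposes_Lin_tau: "exposes P M \<Longrightarrow> Lin e u G \<in># M \<Longrightarrow> \<exists>P'. tau P P'"
proof (induction rule: exposes.induct)
  case (sep P M Q N)
  then show ?case by (auto simp: tau_Sep)
next
  case (lin G' e' u')
  then show ?case using tau_lin_act(2) by blast
next
  case (lin_fired P M)
  then show ?case using tau_lin_fired(2) exposes_lc by blast
next
  case (lin_done P M)
  then show ?case using tau_ctx[OF inert_ctx_lin_done exposes_lc[OF lin_done.hyps]] by blast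
qed auto

text \<open>With nothing pending, the remaining internal steps belong to actions already performed,
  and there the success signal can be preferred to the fatal branch.\<close>

lemma exposes_progress: "exposes P M \<Longrightarrow> (\<And>e u G. Lin e u G \<notin># M) \<Longrightarrow> tau P P' \<Longrightarrow> \<exists>P''. tau P P'' \<and> exposes P'' M"
proof (induction arbitrary: P' rule: exposes.induct)
  case (sep P M Q N)
  from sep.prems(2) consider P1 where "tau P P1" | Q1 where "tau Q Q1" by (auto simp: tau_Sep)
  then show ?case
  proof cases
    case 1
    then obtain P2 where "tau P P2" "exposes P2 M" using sep.IH(1) sep.prems(1) by fastforce
    then show ?thesis unfolding tau_Sep using sep.hyps exposes.sep by blast
  next
    case 2
    then obtain P2 where "tau Q P2" "exposes P2 N" using sep.IH(2) sep.prems(1) by fastforce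
    then show ?thesis unfolding tau_Sep using sep.hyps exposes.sep by blast
  qed
next
  case (lin G e u)
  then show ?case by auto
next
  case (lin_fired P M)
  then show ?case using tau_lin_fired(2)[OF exposes_lc] exposes.lin_done by blast
next
  case (lin_done P M)
  then obtain P1 where "tau P P1" using tau_ctx[OF inert_ctx_lin_done exposes_lc[OF lin_done.hyps]] by blast
  then obtain P2 where "tau P P2" "exposes P2 M" using lin_done.IH lin_done.prems(1) by blast
  then show ?case using tau_ctx[OF inert_ctx_lin_done exposes_lc[OF lin_done.hyps]] exposes.lin_done by blast
qed auto

text \<open>Two communicating groups of threads, with restricted names \<open>H\<close>.\<close>
inductive net :: "'k::comm_semiring_1 tm \<Rightarrow> nat set \<Rightarrow> 'k item multiset \<Rightarrow> 'k item multiset \<Rightarrow> bool" where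
  par: "exposes P M \<Longrightarrow> exposes Q N \<Longrightarrow> net (Par P Q) {} M N"
| nu: "net P H M N \<Longrightarrow> net (Nu (cls 0 v P)) (insert v H) M N"

lemma net_lc: "net P H M N \<Longrightarrow> lc P"
  by (induction rule: net.induct) (auto dest: exposes_lc simp: wfd_cls_lc)
lemma net_st: "net P H M N \<Longrightarrow> st P = 1"
  by (induction rule: net.induct) (simp_all add: exposes_st)

text \<open>\<open>Z\<close> stands for the names that must stay public: the object of an internal
  communication becomes restricted and enters \<open>H\<close>, so it is taken outside
  \<open>Z\<close>.\<close>

lemma net_tau:
  assumes "infinite (- Z)"
  shows "net P H M N \<Longrightarrow> tau P P' \<Longrightarrow> st P' = 0 \<or> net P' H M N \<or>
   (\<exists>x e u G1 G2 M0 N0. x \<notin> Z \<and> M = add_mset (Lin e u G1) M0 \<and> N = add_mset (Lin (negp e) u G2) N0 \<and>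
     (\<forall>M' N'. exposes (opn 0 x G1) M' \<longrightarrow> exposes (opn 0 x G2) N' \<longrightarrow> net P' (insert x H) (M0 + M') (N0 + N')))"
proof (induction arbitrary: P' rule: net.induct)
  case (par P M Q N)
  obtain x where "x \<in> - Z - (fv P \<union> fv Q)" using assms by (metis Diff_infinite_finite finite_UnI finite_fv ex_in_conv finite.emptyI)
  then have x: "x \<notin> Z" "x \<notin> fv P" "x \<notin> fv Q" by auto
  from par.prems consider P1 where "P' = Par P1 Q" "tau P P1" | Q1 where "P' = Par P Q1" "tau Q Q1"
    | e u P1 Q1 where "vis P e u x P1" "vis Q (negp e) u x Q1" "P' = Nu (cls 0 x (Par P1 Q1))"
    unfolding tau_Par[OF x(2,3)] by blast
  then show ?case
  proof cases
    case 1
    then show ?thesis using exposes_tau[OF par(1) 1(2)] par(2) net.par by auto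
  next
    case 2
    then show ?thesis using exposes_tau[OF par(2) 2(2)] par(1) net.par by auto
  next
    case 3
    show ?thesis
    proof (cases "st P1 = 0 \<or> st Q1 = 0")
      case True then show ?thesis using 3 by auto
    next
      case False
      obtain G1 M0 where 1: "M = add_mset (Lin e u G1) M0" "\<forall>M'. exposes (opn 0 x G1) M' \<longrightarrow> exposes P1 (M0 + M')"
        using exposes_vis[OF par(1) 3(1)] False by blast
      obtain G2 N0 where 2: "N = add_mset (Lin (negp e) u G2) N0" "\<forall>M'. exposes (opn 0 x G2) M' \<longrightarrow> exposes Q1 (N0 + M')"
        using exposes_vis[OF par(2) 3(2)] False by blast
      have "net P' {x} (M0 + M') (N0 + N')" if "exposes (opn 0 x G1) M'" "exposes (opn 0 x G2) N'" for M' N'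
        unfolding 3(3) using 1 2 that net.nu[OF net.par] by blast
      then show ?thesis using x 1(1) 2(1) by blast
    qed
  qed
next
  case (nu P H M N v)
  then obtain P1 where P1: "P' = Nu (cls 0 v P1)" "tau P P1" using tau_Nu_cls[OF net_lc] by blast
  from nu.IH[OF P1(2)] show ?case
  proof (elim disjE exE conjE)
    fix x e u G1 G2 M0 N0
    assume *: "x \<notin> Z" "M = add_mset (Lin e u G1) M0" "N = add_mset (Lin (negp e) u G2) N0"
     "\<forall>M' N'. exposes (opn 0 x G1) M' \<longrightarrow> exposes (opn 0 x G2) N' \<longrightarrow> net P1 (insert x H) (M0 + M') (N0 + N')"
    have "net P' (insert x (insert v H)) (M0 + M') (N0 + N')" if "exposes (opn 0 x G1) M'" "exposes (opn 0 x G2) N'" for M' N'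
      using *(4) that net.nu[of P1 "insert x H" _ _ v] P1(1) by (metis insert_commute)
    then show ?thesis using *(1-3) by blast
  qed (use P1 net.nu in auto)
qed

lemma net_sync:
  assumes "infinite (- Z)"
  shows "net P H M N \<Longrightarrow> M = add_mset (Lin e u G1) M0 \<Longrightarrow> N = add_mset (Lin (negp e) u G2) N0 \<Longrightarrow>
   \<exists>x P'. x \<notin> Z \<and> tau P P' \<and>
     (\<forall>M' N'. exposes (opn 0 x G1) M' \<longrightarrow> exposes (opn 0 x G2) N' \<longrightarrow> net P' (insert x H) (M0 + M') (N0 + N'))"
proof (induction rule: net.induct)
  case (par P M Q N)
  obtain x where "x \<in> - Z - (fv P \<union> fv Q)" using assms by (metis Diff_infinite_finite finite_UnI finite_fv ex_in_conv finite.emptyI)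
  then have x: "x \<notin> Z" "x \<notin> fv P" "x \<notin> fv Q" by auto
  obtain P1 where P1: "vis P e u x P1" "\<forall>M'. exposes (opn 0 x G1) M' \<longrightarrow> exposes P1 (M0 + M')"
    using exposes_Lin[OF par(1) par(3) x(2)] by blast
  obtain Q1 where Q1: "vis Q (negp e) u x Q1" "\<forall>M'. exposes (opn 0 x G2) M' \<longrightarrow> exposes Q1 (N0 + M')"
    using exposes_Lin[OF par(2) par(4) x(3)] by blast
  have "tau (Par P Q) (Nu (cls 0 x (Par P1 Q1)))" unfolding tau_Par[OF x(2,3)] using P1 Q1 by blast
  then show ?case using x(1) P1(2) Q1(2) net.nu[OF net.par] by blast
next
  case (nu P H M N v)
  then obtain x P1 where *: "x \<notin> Z" "tau P P1"
    "\<forall>M' N'. exposes (opn 0 x G1) M' \<longrightarrow> exposes (opn 0 x G2) N' \<longrightarrow> net P1 (insert x H) (M0 + M') (N0 + N')" by blast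
  have "tau (Nu (cls 0 v P)) (Nu (cls 0 v P1))" using tau_Nu_cls[OF net_lc[OF nu(1)]] * by blast
  moreover have "net (Nu (cls 0 v P1)) (insert x (insert v H)) (M0 + M') (N0 + N')" if "exposes (opn 0 x G1) M'" "exposes (opn 0 x G2) N'" for M' N'
    using *(3) that net.nu[of P1 "insert x H" _ _ v] by (metis insert_commute)
  ultimately show ?case using *(1) by blast
qed

text \<open>An action of the second group is left as an open alternative: in the application its
  subjects are restricted, which contradicts \<open>u \<notin> H\<close>.\<close>

lemma net_vis: "net P H M N \<Longrightarrow> vis P e u x P' \<Longrightarrow> x \<notin> H \<Longrightarrow> u \<notin> H \<and>
   (Blk e u \<in># M + N \<and> st P' = 0 \<or> (\<exists>G. Lin e u G \<in># N) \<or>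
   (\<exists>G M0. M = add_mset (Lin e u G) M0 \<and> (\<forall>M'. exposes (opn 0 x G) M' \<longrightarrow> net P' H (M0 + M') N)))"
proof (induction arbitrary: P' rule: net.induct)
  case (par P M Q N)
  from par.prems consider P1 where "P' = Par P1 Q" "vis P e u x P1" | Q1 where "P' = Par P Q1" "vis Q e u x Q1"
    unfolding vis_Par by blast
  then show ?case
  proof cases
    case 1
    then show ?thesis using exposes_vis[OF par(1) 1(2)] par(2) net.par by fastforce
  next
    case 2
    then show ?thesis using exposes_vis[OF par(2) 2(2)] by fastforce
  qed
next
  case (nu P H M N v)
  then have vx: "v \<noteq> x" "x \<notin> H" by auto
  from nu.prems obtain P1 where P1: "u \<noteq> v" "P' = Nu (cls 0 v P1)" "vis P e u x P1"
    using vis_Nu_cls[OF net_lc[OF nu(1)] vx(1)] by blast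
  have "u \<notin> H" using nu.IH[OF P1(3) vx(2)] by blast
  moreover have "Blk e u \<in># M + N \<and> st P1 = 0 \<or> (\<exists>G. Lin e u G \<in># N) \<or>
   (\<exists>G M0. M = add_mset (Lin e u G) M0 \<and> (\<forall>M'. exposes (opn 0 x G) M' \<longrightarrow> net P1 H (M0 + M') N))"
    using nu.IH[OF P1(3) vx(2)] by blast
  moreover have "st P' = st P1" using P1(2) by simp
  moreover have "net P1 H M1 N \<Longrightarrow> net P' (insert v H) M1 N" for M1 using P1(2) net.nu by blast
  ultimately show ?case using P1(1) by (metis insert_iff)
qed

lemma net_Lin: "net P H M N \<Longrightarrow> M = add_mset (Lin e u G) M0 \<Longrightarrow> u \<notin> H \<Longrightarrow> x \<notin> H \<Longrightarrow> x \<notin> fv P \<Longrightarrow>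
   \<exists>P'. vis P e u x P' \<and> (\<forall>M'. exposes (opn 0 x G) M' \<longrightarrow> net P' H (M0 + M') N)"
proof (induction rule: net.induct)
  case (par P M Q N)
  then obtain P1 where P1: "vis P e u x P1" "\<forall>M'. exposes (opn 0 x G) M' \<longrightarrow> exposes P1 (M0 + M')"
    using exposes_Lin[OF par(1,3)] by auto
  then have "vis (Par P Q) e u x (Par P1 Q)" using par.prems by (auto simp: vis_Par)
  then show ?case using P1 par(2) net.par by blast
next
  case (nu P H M N v)
  then obtain P1 where P1: "vis P e u x P1" "\<forall>M'. exposes (opn 0 x G) M' \<longrightarrow> net P1 H (M0 + M') N" by auto
  then have "vis (Nu (cls 0 v P)) e u x (Nu (cls 0 v P1))"
    using nu.prems by (subst vis_Nu_cls[OF net_lc[OF nu(1)]]) auto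
  then show ?case using P1(2) net.nu by blast
qed

lemma net_Blk: "net P H M N \<Longrightarrow> Blk e u \<in># M \<Longrightarrow> u \<notin> H \<Longrightarrow> x \<notin> H \<Longrightarrow> x \<notin> fv P \<Longrightarrow> \<exists>P'. vis P e u x P'"
proof (induction rule: net.induct)
  case (par P M Q N)
  then show ?case using exposes_Blk[OF par(1), of e u x] by (auto simp: vis_Par)
next
  case (nu P H M N v)
  then obtain P1 where P1: "vis P e u x P1" by auto
  then show ?case using nu.prems by (subst vis_Nu_cls[OF net_lc[OF nu(1)]]) auto
qed

lemma net_Lin_tau: "net P H M N \<Longrightarrow> Lin e u G \<in># M + N \<Longrightarrow> \<exists>P'. tau P P'"
proof (induction rule: net.induct)
  case (par P M Q N)
  obtain x where "x \<notin> fv P \<union> fv Q" using ex_fresh[of "fv P \<union> fv Q"] by auto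
  then have x: "x \<notin> fv P" "x \<notin> fv Q" by auto
  show ?case unfolding tau_Par[OF x] using par exposes_Lin_tau by (metis union_iff)
next
  case (nu P H M N v)
  then show ?case by (simp add: tau_Nu_cls[OF net_lc[OF nu(1)]])
qed

text \<open>An empty second group offers nothing, so no communication between the groups competes
  with the completion of performed actions.\<close>

lemma net_progress: "net P H M N \<Longrightarrow> N = {#} \<Longrightarrow> (\<And>e u G. Lin e u G \<notin># M) \<Longrightarrow> tau P P' \<Longrightarrow> \<exists>P''. tau P P'' \<and> net P'' H M N"
proof (induction arbitrary: P' rule: net.induct)
  case (par P M Q N)
  obtain x where "x \<notin> fv P \<union> fv Q" using ex_fresh[of "fv P \<union> fv Q"] by auto
  then have x: "x \<notin> fv P" "x \<notin> fv Q" by auto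
  have nQ: "\<not> vis Q e u x Q1" for e u Q1 using exposes_vis[OF par(2)] par(3) by fastforce
  from par.prems consider P1 where "tau P P1" | Q1 where "tau Q Q1"
    unfolding tau_Par[OF x] using nQ by blast
  then show ?case
  proof cases
    case 1
    then obtain P2 where "tau P P2" "exposes P2 M" using exposes_progress[OF par(1) par.prems(2)] by blast
    then show ?thesis unfolding tau_Par[OF x] using par(2) net.par by blast
  next
    case 2
    then obtain Q2 where "tau Q Q2" "exposes Q2 N" using exposes_progress[OF par(2)] par.prems(1) by auto
    then show ?thesis unfolding tau_Par[OF x] using par(1) net.par by blast
  qed
next
  case (nu P H M N v)
  note t = tau_Nu_cls[OF net_lc[OF nu(1)]]
  obtain P1 where "tau P P1" using nu.prems t by blast
  then obtain P2 where "tau P P2" "net P2 H M N" using nu.IH nu.prems by blast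
  then show ?case using t net.nu by blast
qed

section \<open>Implementations of totally ordered traces\<close>

text \<open>The whole order of the sequence is kept, including order that causality does not impose;
  this makes one totally ordered trace per triple sufficient.\<close>

definition seq_trace :: "(pol \<times> asub) list \<Rightarrow> (pol \<times> asub) set \<Rightarrow> trc" where
  "seq_trace s N = \<lparr>tev = {..<length s}, tpol = (\<lambda>i. fst (s ! i)), tsrc = (\<lambda>i. snd (s ! i)),
     tord = {(a, b). a \<le> b \<and> b < length s}, tneg = N\<rparr>"

lemma seq_trace_sel[simp]: "tev (seq_trace s N) = {..<length s}" "tpol (seq_trace s N) i = fst (s ! i)"
  "tsrc (seq_trace s N) i = snd (s ! i)" "tord (seq_trace s N) = {(a, b). a \<le> b \<and> b < length s}" "tneg (seq_trace s N) = N"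
  by (simp_all add: seq_trace_def)
lemma tlt_seq_trace[simp]: "tlt (seq_trace s N) a b \<longleftrightarrow> a < b \<and> b < length s" by (auto simp: tlt_def)

lemma lc_prod_sep: "(\<And>P. P \<in> set Ps \<Longrightarrow> lc P) \<Longrightarrow> lc (prod_sep Ps)"
  by (induction Ps rule: prod_sep.induct) auto
lemma fv_prod_sep: "fv (prod_sep Ps) = (\<Union>P\<in>set Ps. fv P)"
  by (induction Ps rule: prod_sep.induct) auto

lemma exposes_prod_sep_list: "(\<And>x. x \<in> set xs \<Longrightarrow> exposes (g x) (m x)) \<Longrightarrow> exposes (prod_sep (map g xs)) (\<Sum>x\<leftarrow>xs. m x)"
proof (induction "map g xs" arbitrary: xs rule: prod_sep.induct)
  case 1
  then show ?case by (simp add: exposes.one)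
next
  case (2 P)
  then obtain x where "xs = [x]" by auto
  then show ?case using 2 by simp
next
  case (3 P P2 Ps)
  then obtain x x2 xs' where xs: "xs = x # x2 # xs'" by (auto simp: Cons_eq_map_conv)
  have "exposes (prod_sep (map g (x2 # xs'))) (\<Sum>x\<leftarrow>x2 # xs'. m x)" using 3 xs by (intro 3(1)) auto
  then show ?case using exposes.sep[of "g x" "m x"] 3(3) xs by auto
qed

lemma exposes_prod_sep: "distinct xs \<Longrightarrow> (\<And>x. x \<in> set xs \<Longrightarrow> exposes (g x) (m x)) \<Longrightarrow> exposes (prod_sep (map g xs)) (\<Sum>x\<in>set xs. m x)"
  using exposes_prod_sep_list[of xs g m] by (simp add: sum_list_distinct_conv_sum_set)

lemma fv_nus: "fv (nus xs P) = fv P - set xs"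
  by (induction xs) (auto simp: nus_def)
lemma net_nus: "net P {} M N \<Longrightarrow> net (nus xs P) (set xs) M N"
  by (induction xs) (auto simp: nus_def intro: net.nu)

text \<open>For changing one summand: the common rest \<open>R\<close> puts both sums in the form
  that the lemmas on \<open>net\<close> expect.\<close>

lemma sum_update:
  fixes g h :: "'a \<Rightarrow> 'b multiset"
  assumes "finite I" "i \<in> I" "\<And>x. x \<in> I \<Longrightarrow> x \<noteq> i \<Longrightarrow> g x = h x"
  obtains R where "sum g I = g i + R" "sum h I = h i + R"
proof -
  have "sum g (I - {i}) = sum h (I - {i})" by (rule sum.cong) (use assms in auto)
  then show thesis using that[of "sum g (I - {i})"] assms(1,2) by (simp add: sum.remove)
qed

locale total_trace =
  fixes s :: "(pol \<times> asub) list" and N :: "(pol \<times> asub) set" and A :: "nat set"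
  assumes ok: "ok_trace A s N" and finite_A: "finite A"
begin

abbreviation "n \<equiv> length s"
abbreviation "T \<equiv> seq_trace s N"
abbreviation "x \<equiv> xn T"
abbreviation "y \<equiv> yn T"
abbreviation "z \<equiv> zn T"

lemma src_less: "i < n \<Longrightarrow> snd (s ! i) = Inr a \<Longrightarrow> a < i" using ok by (force simp: ok_trace_def)
lemma src_less_n: "i < n \<Longrightarrow> snd (s ! i) = Inr a \<Longrightarrow> a < n" using src_less by fastforce
lemma N_less: "(e, Inr a) \<in> N \<Longrightarrow> a < n" using ok by (force simp: ok_trace_def)

lemma finite_N: "finite N"
proof (rule finite_subset)
  show "N \<subseteq> UNIV \<times> (Inl ` A \<union> Inr ` {..<n})" using ok by (auto simp: ok_trace_def)
qed (use finite_A finite_pol in auto)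

lemma wf_trace_seq_trace: "wf_trace T" and linear_order_seq_trace: "linear_order_on (tev T) (tord T)"
  using src_less src_less_n N_less finite_N
  by (auto simp: wf_trace_def linear_order_on_def partial_order_on_def preorder_on_def refl_on_def
      trans_def antisym_def total_on_def)

lemma fnT_subset: "fnT T \<subseteq> A" using ok by (force simp: ok_trace_def fnT_def)
lemma finite_fnT: "finite (fnT T)" using fnT_subset finite_A finite_subset by blast

lemma fnT_base: "u \<in> fnT T \<Longrightarrow> u < base T"
  unfolding base_def using finite_fnT by (intro le_imp_less_Suc Max_ge) auto

text \<open>The offsets 0, 1, 2 modulo 3 separate the three families, and \<open>prod_encode\<close>
  is injective within the first two.\<close>

lemma names[simp]: "x a b = x a' b' \<longleftrightarrow> a = a' \<and> b = b'" "y a b = y a' b' \<longleftrightarrow> a = a' \<and> b = b'"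
  "z a = z a' \<longleftrightarrow> a = a'" "x a b \<noteq> y a' b'" "y a b \<noteq> x a' b'" "x a b \<noteq> z c" "z c \<noteq> x a b" "y a b \<noteq> z c" "z c \<noteq> y a b"
  by (auto simp: xn_def yn_def zn_def prod_encode_eq) presburger+

lemma names_fnT: "x a b \<notin> fnT T" "y a b \<notin> fnT T" "z a \<notin> fnT T"
  using fnT_base by (fastforce simp: xn_def yn_def zn_def)+

text \<open>\<open>A\<close> may be larger than the set of names of the trace, whereas the free
  names of the implementation are bounded by the latter.\<close>

lemma ok_trace_fnT: "ok_trace (fnT T) s N" 
proof -
  have "snd (s ! i) \<in> Inl ` fnT T \<union> Inr ` {..<i}" if "i < n" for i
  proof (cases "snd (s ! i)")
    case (Inl u)
    then have "u \<in> fnT T" using that by (auto simp: fnT_def)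
    then show ?thesis using Inl by simp
  next
    case (Inr a)
    then show ?thesis using src_less[OF that] by simp
  qed
  moreover have "snd w \<in> Inl ` fnT T \<union> Inr ` {..<n}" if "w \<in> N" for w
  proof (cases w; cases "snd w")
    fix e v u assume "w = (e, v)" "snd w = Inl u"
    then have "u \<in> fnT T" using that by (auto simp: fnT_def)
    then show ?thesis using \<open>snd w = Inl u\<close> by simp
  next
    fix e v a assume "w = (e, v)" "snd w = Inr a"
    then show ?thesis using N_less[of e a] that by simp
  qed
  ultimately show ?thesis by (auto simp: ok_trace_def)
qed

text \<open>The implementation's own names \<open>z a\<close> will serve as the supply of objects,
  so that opening a closed body at \<open>z a\<close> returns the body itself.\<close>

lemma avoids_z: "avoids z (fnT T)"
  using names_fnT by (auto simp: avoids_def inj_def)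

lemma subj_inst: "subj T a = inst z (snd (s ! a))"
  by (auto simp: subj_def split: sum.split)
lemma subj_cases: "a < n \<Longrightarrow> subj T a \<in> fnT T \<union> range z"
  by (cases "snd (s ! a)") (auto simp: subj_inst fnT_def)
lemma subj_names[simp]: "b < n \<Longrightarrow> subj T b \<noteq> x a c" "b < n \<Longrightarrow> subj T b \<noteq> y a c"
  "b < n \<Longrightarrow> x a c \<noteq> subj T b" "b < n \<Longrightarrow> y a c \<noteq> subj T b"
  using subj_cases[of b] names_fnT names(6,8) by (metis UnE imageE)+

abbreviation kids :: "nat \<Rightarrow> nat set" where "kids a \<equiv> {c. c < n \<and> snd (s ! c) = Inr a}"

definition body :: "nat \<Rightarrow> 'k::comm_semiring_1 tm" where
  "body a = Sep (prod_sep (map (\<lambda>c. lin_act Neg (y a c) (Cst 1)) (sorted_list_of_set {c. a < c \<and> c < n})))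
          (Sep (prod_sep (map (implA T n) (sorted_list_of_set (kids a))))
               (prod_sep (map (\<lambda>e. Act e (F (z a)) (Cst 0)) (filter (\<lambda>e. (e, Inr a) \<in> N) [Pos, Neg]))))"

text \<open>The thread of event \<open>a\<close> once the signals of the events below \<open>j\<close> were received.\<close>
definition stage :: "nat \<Rightarrow> nat \<Rightarrow> 'k::comm_semiring_1 tm" where
  "stage a j = foldr (\<lambda>b Q. lin_act Pos (x b a) Q) [j..<a] (lin_act (fst (s ! a)) (subj T a) (cls 0 (z a) (body a)))"

lemma sets: "{c \<in> tev T. tlt T a c} = {c. a < c \<and> c < n}" "a < n \<Longrightarrow> {b \<in> tev T. tlt T b a} = {0..<a}"
  "{c \<in> tev T. tsrc T c = Inr a} = kids a" by auto

lemma implA_Suc: "a < n \<Longrightarrow> implA T (Suc m) a = foldr (\<lambda>b Q. lin_act Pos (x b a) Q) [0..<a]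
   (lin_act (fst (s ! a)) (subj T a) (cls 0 (z a)
    (Sep (prod_sep (map (\<lambda>c. lin_act Neg (y a c) (Cst 1)) (sorted_list_of_set {c. a < c \<and> c < n})))
          (Sep (prod_sep (map (implA T m) (sorted_list_of_set (kids a))))
               (prod_sep (map (\<lambda>e. Act e (F (z a)) (Cst 0)) (filter (\<lambda>e. (e, Inr a) \<in> N) [Pos, Neg])))))))"
  unfolding implA.simps sets by (simp add: sets ext[OF lin0_eq] lin_eq del: filter.simps)

lemma fin_kids[simp]: "finite (kids a)" "finite {c. a < c \<and> c < n}" by auto

text \<open>A child has a larger index than its parent, so the nesting that starts at
  \<open>a\<close> has at most \<open>n - a\<close> levels.\<close>

lemma implA_fuel: "a < n \<Longrightarrow> n - a \<le> m \<Longrightarrow> n - a \<le> m' \<Longrightarrow> (implA T m a :: 'k::comm_semiring_1 tm) = implA T m' a"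
proof (induction m arbitrary: a m')
  case 0
  then show ?case by simp
next
  case (Suc m)
  then obtain m'' where m': "m' = Suc m''" by (cases m') auto
  have "map (implA T m :: nat \<Rightarrow> 'k tm) (sorted_list_of_set (kids a)) = map (implA T m'') (sorted_list_of_set (kids a))"
  proof (rule map_cong[OF HOL.refl])
    fix c assume "c \<in> set (sorted_list_of_set (kids a))"
    then have "c < n" "a < c" using src_less by auto
    then show "(implA T m c :: 'k tm) = implA T m'' c" using Suc m' by (intro Suc.IH) auto
  qed
  then show ?case using Suc.prems(1) by (simp only: m' implA_Suc)
qed

lemma implA_stage: assumes "a < n" shows "(implA T n a :: 'k::comm_semiring_1 tm) = stage a 0"
proof -
  obtain m where m: "n = Suc m" using assms by (cases n) auto
  have eq: "map (implA T m :: nat \<Rightarrow> 'k tm) (sorted_list_of_set (kids a)) = map (implA T n) (sorted_list_of_set (kids a))"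
  proof (rule map_cong[OF HOL.refl])
    fix c assume "c \<in> set (sorted_list_of_set (kids a))"
    then have "c < n" "a < c" using src_less by auto
    then show "(implA T m c :: 'k tm) = implA T n c" using m by (intro implA_fuel) auto
  qed
  have "(implA T n a :: 'k tm) = implA T (Suc m) a" using m by simp
  then show ?thesis unfolding stage_def body_def eq[symmetric] implA_Suc[OF assms] .
qed

lemma stage_less: "j < a \<Longrightarrow> stage a j = lin_act Pos (x j a) (stage a (Suc j))"
  by (simp add: stage_def upt_conv_Cons)
lemma stage_self: "stage a a = lin_act (fst (s ! a)) (subj T a) (cls 0 (z a) (body a))"
  by (simp add: stage_def)

lemma lc_foldr_lin_act: "lc P \<Longrightarrow> lc (foldr (\<lambda>b Q. lin_act Pos (g b) Q) xs P)"
  by (induction xs) auto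

lemma lc_implA: "a < n \<Longrightarrow> lc (implA T m a :: 'k::comm_semiring_1 tm)"
proof (induction m arbitrary: a)
  case (Suc m)
  have 1: "lc (prod_sep (map (implA T m :: nat \<Rightarrow> 'k tm) (sorted_list_of_set (kids a))))"
    by (rule lc_prod_sep) (use Suc in auto)
  have 2: "lc (prod_sep (map (\<lambda>c. lin_act Neg (y a c) (Cst 1 :: 'k tm)) (sorted_list_of_set {c. a < c \<and> c < n})))"
    by (rule lc_prod_sep) auto
  have 3: "lc (prod_sep (map (\<lambda>e. Act e (F (z a)) (Cst 0 :: 'k tm)) (filter (\<lambda>e. (e, Inr a) \<in> N) [Pos, Neg])))"
    by (rule lc_prod_sep) auto
  show ?case unfolding implA_Suc[OF Suc.prems]
    by (intro lc_foldr_lin_act lc_lin_act wfd_cls_lc) (use 1 2 3 in \<open>simp only: lc_simps\<close>)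
qed simp

lemma lc_body: "lc (body a)"
  unfolding body_def lc_simps by (intro conjI lc_prod_sep) (auto intro: lc_implA)
lemma lc_stage: "lc (stage a j)"
  unfolding stage_def by (intro lc_foldr_lin_act lc_lin_act wfd_cls_lc lc_body)

definition next_item :: "nat \<Rightarrow> nat \<Rightarrow> 'k::comm_semiring_1 item" where
  "next_item a j = (if j < a then Lin Pos (x j a) (stage a (Suc j)) else Lin (fst (s ! a)) (subj T a) (cls 0 (z a) (body a)))"

lemma exposes_stage: "j \<le> a \<Longrightarrow> exposes (stage a j) {#next_item a j#}"
  by (cases "j < a") (auto simp: next_item_def stage_less stage_self lc_stage lc_body intro!: exposes.lin wfd_cls_lc)

definition pending :: "nat \<Rightarrow> (nat \<times> nat) set \<Rightarrow> 'k::comm_semiring_1 item multiset" where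
  "pending a Y = (\<Sum>c\<in>{c. a < c \<and> c < n}. if (a, c) \<in> Y then {#} else {#Lin Neg (y a c) (Cst 1)#})"
definition blocks :: "nat \<Rightarrow> 'k::comm_semiring_1 item multiset" where
  "blocks a = (\<Sum>e\<in>{e. (e, Inr a) \<in> N}. {#Blk e (z a)#})"

lemma exposes_body: "exposes (body a) (pending a {} + ((\<Sum>c\<in>kids a. {#next_item c 0#}) + blocks a))"
proof -
  have s: "set (filter (\<lambda>e. (e, Inr a) \<in> N) [Pos, Neg]) = {e. (e, Inr a) \<in> N}"
  proof (rule set_eqI)
    fix e show "e \<in> set (filter (\<lambda>e. (e, Inr a) \<in> N) [Pos, Neg]) \<longleftrightarrow> e \<in> {e. (e, Inr a) \<in> N}"
      by (cases e) auto
  qed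
  have 1: "exposes (prod_sep (map (\<lambda>c. lin_act Neg (y a c) (Cst 1)) (sorted_list_of_set {c. a < c \<and> c < n}))) (pending a {})"
    using exposes_prod_sep[of "sorted_list_of_set {c. a < c \<and> c < n}" "\<lambda>c. lin_act Neg (y a c) (Cst 1)" "\<lambda>c. {#Lin Neg (y a c) (Cst 1)#}"]
    by (simp add: pending_def exposes.lin)
  have 2: "exposes (prod_sep (map (implA T n) (sorted_list_of_set (kids a)))) (\<Sum>c\<in>kids a. {#next_item c 0#})"
    using exposes_prod_sep[of "sorted_list_of_set (kids a)" "implA T n" "\<lambda>c. {#next_item c 0#}"]
    by (simp add: implA_stage exposes_stage)
  have 3: "exposes (prod_sep (map (\<lambda>e. Act e (F (z a)) (Cst 0)) (filter (\<lambda>e. (e, Inr a) \<in> N) [Pos, Neg]))) (blocks a)"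
    using exposes_prod_sep[of "filter (\<lambda>e. (e, Inr a) \<in> N) [Pos, Neg]" "\<lambda>e. Act e (F (z a)) (Cst 0)" "\<lambda>e. {#Blk e (z a)#}"]
    unfolding s blocks_def by (auto simp: exposes.blk)
  show ?thesis unfolding body_def by (intro exposes.sep 1 2 3)
qed

definition sync_names :: "nat set" where "sync_names = {x a b |a b. a < n \<and> b < n} \<union> {y a b |a b. a < n \<and> b < n}"

lemma fv_foldr_lin_act: "fv (foldr (\<lambda>b Q. lin_act Pos (g b) Q) xs P) = g ` set xs \<union> fv P"
  by (induction xs) auto

text \<open>An event whose source is another event mentions the object of its parent through
  \<open>subj T a\<close>; the parent closes this name, so it does not escape from the threads at
  top level.\<close>

lemma fv_implA: "a < n \<Longrightarrow> fv (implA T m a :: 'k::comm_semiring_1 tm) \<subseteq> insert (subj T a) (fnT T \<union> sync_names)"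
proof (induction m arbitrary: a)
  case (Suc m)
  have 0: "(\<lambda>b. x b a) ` set [0..<a] \<subseteq> sync_names" using Suc.prems by (auto simp: sync_names_def)
  have 1: "fv (prod_sep (map (\<lambda>c. lin_act Neg (y a c) (Cst 1 :: 'k tm)) (sorted_list_of_set {c. a < c \<and> c < n}))) \<subseteq> sync_names"
    using Suc.prems by (auto simp: fv_prod_sep sync_names_def)
  have 2: "fv (prod_sep (map (implA T m :: nat \<Rightarrow> 'k tm) (sorted_list_of_set (kids a)))) \<subseteq> insert (z a) (fnT T \<union> sync_names)"
  proof -
    have "fv (implA T m c :: 'k tm) \<subseteq> insert (z a) (fnT T \<union> sync_names)" if "c \<in> kids a" for c
      using Suc.IH[of c] that by (simp add: subj_inst)
    then show ?thesis unfolding fv_prod_sep by auto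
  qed
  have 3: "fv (prod_sep (map (\<lambda>e. Act e (F (z a)) (Cst 0 :: 'k tm)) (filter (\<lambda>e. (e, Inr a) \<in> N) [Pos, Neg]))) \<subseteq> {z a}"
    unfolding fv_prod_sep by auto
  show ?case unfolding implA_Suc[OF Suc.prems] fv_foldr_lin_act fv_lin_act fv_cls fv.simps(5) using 0 1 2 3 by blast
qed simp

text \<open>A state of the implementation: \<open>f b\<close> is the number of signals received by the thread of event \<open>b\<close>
  (\<open>Suc b\<close> if the event itself was performed), and \<open>Y\<close> is the set of pairs \<open>(a, c)\<close> such that the
  forwarder from \<open>a\<close> to \<open>c\<close> received its input.\<close>
definition threads :: "(nat \<Rightarrow> nat) \<Rightarrow> (nat \<times> nat) set \<Rightarrow> 'k::comm_semiring_1 item multiset" where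
  "threads f Y = (\<Sum>b<n. if (\<forall>a. snd (s ! b) = Inr a \<longrightarrow> a < f a) \<and> f b \<le> b then {#next_item b (f b)#} else {#}) +
     (\<Sum>a<n. if a < f a then pending a Y + blocks a else {#})"
definition forwarders :: "(nat \<Rightarrow> nat) \<Rightarrow> (nat \<times> nat) set \<Rightarrow> 'k::comm_semiring_1 item multiset" where
  "forwarders f Y = (\<Sum>(a, c)\<in>{(a, c). a < c \<and> c < n}. if (a, c) \<notin> Y then {#Lin Pos (y a c) (lin_act Neg (x a c) (Cst 1))#}
     else if f c \<le> a then {#Lin Neg (x a c) (Cst 1)#} else {#})"

definition blocks0 :: "'k::comm_semiring_1 tm" where
  "blocks0 = prod_sep (map (\<lambda>(e, u). Act e (F u) (Cst 0))
                    (map (\<lambda>u. (Pos, u)) (sorted_list_of_set {u. (Pos, Inl u) \<in> N})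
                     @ map (\<lambda>u. (Neg, u)) (sorted_list_of_set {u. (Neg, Inl u) \<in> N})))"
definition core :: "'k::comm_semiring_1 tm" where
  "core = nus (concat (map (\<lambda>(a, b). [x a b, y a b]) (List.product [0..<n] [0..<n])))
            (Par (prod_sep (map (implA T n) (filter (\<lambda>a. \<exists>u. snd (s ! a) = Inl u) [0..<n])))
                 (prod_sep (map (\<lambda>(a, b). lin_act Pos (y a b) (lin_act Neg (x a b) (Cst 1)))
                                (filter (\<lambda>(a, b). a < b \<and> b < n) (List.product [0..<n] [0..<n])))))"

lemma impl_eq: "impl T = Sep core blocks0"
  by (simp add: impl_def core_def blocks0_def lin0_eq Let_def lessThan_atLeast0)

lemma net_core: "net (core :: 'k::comm_semiring_1 tm) sync_names (threads (\<lambda>_. 0) {}) (forwarders (\<lambda>_. 0) {})"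
proof -
  have H: "set (concat (map (\<lambda>(a, b). [x a b, y a b]) (List.product [0..<n] [0..<n]))) = sync_names"
    by (auto simp: sync_names_def)
  have 1: "exposes (prod_sep (map (implA T n) (filter (\<lambda>a. \<exists>u. snd (s ! a) = Inl u) [0..<n])) :: 'k tm) (threads (\<lambda>_. 0) {})"
  proof -
    \<comment> \<open>While no event has been performed, a thread is exposed exactly when its source
      is a name.\<close>
    have "(threads (\<lambda>_. 0) {} :: 'k item multiset) = (\<Sum>b<n. if \<exists>u. snd (s ! b) = Inl u then {#next_item b 0#} else {#})"
      unfolding threads_def by (auto intro!: sum.cong) (metis sum.exhaust)
    also have "\<dots> = (\<Sum>b\<in>{b. b < n \<and> (\<exists>u. snd (s ! b) = Inl u)}. {#next_item b 0#})"
      by (auto simp: lessThan_def sum.If_cases Collect_conj_eq)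
    finally show ?thesis
      using exposes_prod_sep[of "filter (\<lambda>a. \<exists>u. snd (s ! a) = Inl u) [0..<n]" "implA T n" "\<lambda>c. {#next_item c 0#}"]
      by (simp add: implA_stage exposes_stage)
  qed
  have 2: "exposes (prod_sep (map (\<lambda>(a, b). lin_act Pos (y a b) (lin_act Neg (x a b) (Cst 1)))
                                (filter (\<lambda>(a, b). a < b \<and> b < n) (List.product [0..<n] [0..<n])))) (forwarders (\<lambda>_. 0) {})"
  proof -
    have "set (filter (\<lambda>(a, b). a < b \<and> b < n) (List.product [0..<n] [0..<n])) = {(a, c). a < c \<and> c < n}" by auto
    then show ?thesis unfolding forwarders_def
      using exposes_prod_sep[of "filter (\<lambda>(a, b). a < b \<and> b < n) (List.product [0..<n] [0..<n])"
         "\<lambda>(a, b). lin_act Pos (y a b) (lin_act Neg (x a b) (Cst 1))" "\<lambda>(a, b). {#Lin Pos (y a b) (lin_act Neg (x a b) (Cst 1))#}"]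
      by (auto simp: exposes.lin distinct_product case_prod_unfold)
  qed
  show ?thesis unfolding core_def H[symmetric] by (rule net_nus[OF net.par[OF 1 2]])
qed

lemma finite_Inl: "finite {u. (e, Inl u) \<in> N}"
  by (rule finite_subset[of _ "projl ` snd ` N"]) (use finite_N in \<open>force+\<close>)

lemma blocks0_list: "set (map (\<lambda>u. (Pos, u)) (sorted_list_of_set {u. (Pos, Inl u) \<in> N})
                     @ map (\<lambda>u. (Neg, u)) (sorted_list_of_set {u. (Neg, Inl u) \<in> N})) = {(e, u). (e, Inl u) \<in> N}"
proof -
  have "(e, u) \<in> Pair Pos ` {u. (Pos, Inl u) \<in> N} \<union> Pair Neg ` {u. (Neg, Inl u) \<in> N} \<longleftrightarrow> (e, Inl u) \<in> N" for e u
    by (cases e) auto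
  then show ?thesis using finite_Inl by auto
qed

lemma exposes_blocks0: "\<exists>M0. exposes (blocks0 :: 'k::comm_semiring_1 tm) M0 \<and> set_mset M0 = {Blk e u |e u. (e, Inl u) \<in> N}"
proof (intro exI conjI)
  let ?l = "map (\<lambda>u. (Pos, u)) (sorted_list_of_set {u. (Pos, Inl u) \<in> N})
                     @ map (\<lambda>u. (Neg, u)) (sorted_list_of_set {u. (Neg, Inl u) \<in> N})"
  let ?M = "(\<Sum>w\<leftarrow>?l. {#Blk (fst w) (snd w)#}) :: 'k item multiset"
  show "exposes (blocks0 :: 'k tm) ?M"
    unfolding blocks0_def by (rule exposes_prod_sep_list) (auto simp: exposes.blk)
  have "set_mset ((\<Sum>w\<leftarrow>l. {#Blk (fst w) (snd w)#}) :: 'k item multiset) = (\<lambda>w. Blk (fst w) (snd w)) ` set l" for l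
    by (induction l) auto
  from this[of ?l] show "set_mset ?M = {Blk e u |e u. (e, Inl u) \<in> N}" unfolding blocks0_list by force
qed

lemma lc_impl: "lc (impl T)"
  using net_lc[OF net_core] exposes_blocks0 exposes_lc by (auto simp: impl_eq)

lemma fv_impl: "fv (impl T) \<subseteq> fnT T"
proof -
  have "set (concat (map (\<lambda>(a, b). [x a b, y a b]) (List.product [0..<n] [0..<n]))) = sync_names"
    by (auto simp: sync_names_def)
  moreover have "fv (prod_sep (map (\<lambda>(a, b). lin_act Pos (y a b) (lin_act Neg (x a b) (Cst 1)))
       (filter (\<lambda>(a, b). a < b \<and> b < n) (List.product [0..<n] [0..<n])))) \<subseteq> sync_names"
    by (auto simp: fv_prod_sep sync_names_def) (metis less_trans)
  moreover have "fv (prod_sep (map (implA T n) (filter (\<lambda>a. \<exists>u. snd (s ! a) = Inl u) [0..<n]))) \<subseteq> fnT T \<union> sync_names"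
  proof -
    have "subj T a \<in> fnT T" if "a < n" "snd (s ! a) = Inl u" for a u using that by (auto simp: subj_inst fnT_def)
    then have "fv (implA T n a) \<subseteq> fnT T \<union> sync_names" if "a < n" "snd (s ! a) = Inl u" for a u
      using fv_implA[OF that(1)] that by blast
    then show ?thesis unfolding fv_prod_sep by auto
  qed
  moreover have "fv blocks0 \<subseteq> fnT T"
    unfolding blocks0_def fv_prod_sep set_map blocks0_list by (auto simp: fnT_def)
  ultimately show ?thesis unfolding impl_eq core_def fv.simps(5) fv_nus fv.simps(4) by blast
qed

section \<open>Counters of the implementation and their updates\<close>

abbreviation exposed :: "(nat \<Rightarrow> nat) \<Rightarrow> nat \<Rightarrow> bool" where
  "exposed f b \<equiv> \<forall>a. snd (s ! b) = Inr a \<longrightarrow> a < f a"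

text \<open>Causality of signals: a received signal was forwarded, a forwarded one was sent by a
  performed event, and a thread not yet exposed has received nothing.\<close>

definition state_ok :: "(nat \<Rightarrow> nat) \<Rightarrow> (nat \<times> nat) set \<Rightarrow> bool" where
  "state_ok f Y \<longleftrightarrow> (\<forall>a c. a < c \<longrightarrow> c < n \<longrightarrow> a < f c \<longrightarrow> (a, c) \<in> Y) \<and>
     (\<forall>a c. (a, c) \<in> Y \<longrightarrow> a < c \<and> c < n \<and> a < f a) \<and>
     (\<forall>b<n. \<not> exposed f b \<longrightarrow> f b = 0) \<and> (\<forall>b. f b \<le> Suc b)"

lemma state_okD:
  assumes "state_ok f Y"
  shows "a < c \<Longrightarrow> c < n \<Longrightarrow> a < f c \<Longrightarrow> (a, c) \<in> Y" and "(a, c) \<in> Y \<Longrightarrow> a < c \<and> c < n \<and> a < f a"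
    and "b < n \<Longrightarrow> \<not> exposed f b \<Longrightarrow> f b = 0" and "f b \<le> Suc b"
  using assms unfolding state_ok_def by blast+

lemma fv_shift: "V' \<subseteq> insert (z k) V \<Longrightarrow> V \<inter> z ` {k..} = {} \<Longrightarrow> V' \<inter> z ` {Suc k..} = {}"
  by force

lemma set_pending: "set_mset (pending a Y) = {Lin Neg (y a c) (Cst 1) |c. a < c \<and> c < n \<and> (a, c) \<notin> Y}"
  unfolding pending_def by (auto simp: set_mset_sum split: if_splits)
lemma set_blocks: "set_mset (blocks a) = {Blk e (z a) |e. (e, Inr a) \<in> N}"
  unfolding blocks_def by (auto simp: set_mset_sum finite_pol)

lemma threads_mem: "i \<in># threads f Y \<longleftrightarrow> (\<exists>b<n. exposed f b \<and> f b \<le> b \<and> i = next_item b (f b)) \<or>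
   (\<exists>a c. a < c \<and> c < n \<and> a < f a \<and> (a, c) \<notin> Y \<and> i = Lin Neg (y a c) (Cst 1)) \<or>
   (\<exists>a e. a < f a \<and> (e, Inr a) \<in> N \<and> i = Blk e (z a))"
proof -
  have "i \<in># threads f Y \<longleftrightarrow> (\<exists>b<n. exposed f b \<and> f b \<le> b \<and> i = next_item b (f b)) \<or>
    (\<exists>a<n. a < f a \<and> (i \<in> set_mset (pending a Y) \<or> i \<in> set_mset (blocks a)))"
    unfolding threads_def by (auto simp: set_mset_sum split: if_splits)
  also have "(\<exists>a<n. a < f a \<and> (i \<in> set_mset (pending a Y) \<or> i \<in> set_mset (blocks a))) \<longleftrightarrow>
   (\<exists>a c. a < c \<and> c < n \<and> a < f a \<and> (a, c) \<notin> Y \<and> i = Lin Neg (y a c) (Cst 1)) \<or>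
   (\<exists>a e. a < f a \<and> (e, Inr a) \<in> N \<and> i = Blk e (z a))"
    unfolding set_pending set_blocks using N_less by (auto intro: less_trans)
  finally show ?thesis .
qed

lemma fin_pairs: "finite {(a, c). a < c \<and> c < n}"
  by (rule finite_subset[of _ "{..<n} \<times> {..<n}"]) auto

lemma forwarders_mem: "i \<in># forwarders f Y \<longleftrightarrow> (\<exists>a c. a < c \<and> c < n \<and> (if (a, c) \<notin> Y then i = Lin Pos (y a c) (lin_act Neg (x a c) (Cst 1))
     else f c \<le> a \<and> i = Lin Neg (x a c) (Cst 1)))"
  unfolding forwarders_def by (auto simp: set_mset_sum fin_pairs split: if_splits)

text \<open>The synchronisation on \<open>y a c\<close>: the forwarder takes the signal from
  \<open>a\<close> and starts offering it to \<open>c\<close>.\<close>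

lemma upd_y:
  assumes "state_ok f Y" "a < c" "c < n" "a < f a" "(a, c) \<notin> Y"
  shows "threads f Y = add_mset (Lin Neg (y a c) (Cst 1)) (threads f (insert (a, c) Y) :: 'k::comm_semiring_1 item multiset)"
    and "\<exists>R. forwarders f Y = add_mset (Lin Pos (y a c) (lin_act Neg (x a c) (Cst 1))) R \<and>
        (forwarders f (insert (a, c) Y) :: 'k item multiset) = add_mset (Lin Neg (x a c) (Cst 1)) R"
    and "state_ok f (insert (a, c) Y)"
proof -
  \<comment> \<open>Event \<open>c\<close> cannot have received this signal, otherwise
    \<open>(a, c)\<close> would be in \<open>Y\<close>; so the forwarder still has to deliver
    it.\<close>
  have fc: "f c \<le> a" using state_okD(1)[OF assms(1-3)] assms(5) by (meson not_less)
  let ?Y = "insert (a, c) Y"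
  have o: "pending a Y = add_mset (Lin Neg (y a c) (Cst 1)) (pending a ?Y :: 'k item multiset)"
  proof -
    let ?h = "\<lambda>Y d. if (a, d) \<in> Y then {#} else {#Lin Neg (y a d) (Cst 1 :: 'k tm)#}"
    obtain R where "pending a Y = ?h Y c + R" "pending a ?Y = ?h ?Y c + R"
      unfolding pending_def by (rule sum_update[of "{d. a < d \<and> d < n}" c "?h Y" "?h ?Y"]) (use assms in auto)
    then show ?thesis using assms(5) by simp
  qed
  have o2: "pending b Y = pending b ?Y" if "b \<noteq> a" for b
    unfolding pending_def using that by (auto intro!: sum.cong)
  obtain R where "(\<Sum>b<n. if b < f b then pending b Y + blocks b else {#}) = (if a < f a then pending a Y + blocks a else {#}) + R"
    "(\<Sum>b<n. if b < f b then pending b ?Y + blocks b else {#}) = (if a < f a then pending a ?Y + blocks a else ({#} :: 'k item multiset)) + R"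
    by (rule sum_update[of "{..<n}" a "\<lambda>b. if b < f b then pending b Y + blocks b else {#}" "\<lambda>b. if b < f b then pending b ?Y + blocks b else {#}"])
       (use assms o2 in auto)
  then show "threads f Y = add_mset (Lin Neg (y a c) (Cst 1)) (threads f ?Y :: 'k item multiset)"
    unfolding threads_def using assms(4) o by simp
  let ?g = "\<lambda>Y. \<lambda>(a, c). if (a, c) \<notin> Y then {#Lin Pos (y a c) (lin_act Neg (x a c) (Cst 1 :: 'k tm))#}
     else if f c \<le> a then {#Lin Neg (x a c) (Cst 1)#} else {#}"
  have g: "?g Y (a, c) = {#Lin Pos (y a c) (lin_act Neg (x a c) (Cst 1))#}" "?g ?Y (a, c) = {#Lin Neg (x a c) (Cst 1)#}"
    using assms(5) fc by simp_all
  have gg: "?g Y p = ?g ?Y p" if "p \<noteq> (a, c)" for p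
  proof (cases p)
    case (Pair b d)
    then have "(b, d) \<in> Y \<longleftrightarrow> (b, d) \<in> ?Y" using that by auto
    then show ?thesis unfolding Pair by (simp del: insert_iff)
  qed
  have ac: "(a, c) \<in> {(a, c). a < c \<and> c < n}" using assms by simp
  obtain R where R: "forwarders f Y = ?g Y (a, c) + R" "forwarders f ?Y = ?g ?Y (a, c) + R"
    unfolding forwarders_def by (rule sum_update[OF fin_pairs ac, of "?g Y" "?g ?Y"]) (rule gg, assumption, blast)
  show "\<exists>R. forwarders f Y = add_mset (Lin Pos (y a c) (lin_act Neg (x a c) (Cst 1))) R \<and>
        (forwarders f ?Y :: 'k item multiset) = add_mset (Lin Neg (x a c) (Cst 1)) R"
    using R unfolding g by auto
  show "state_ok f ?Y"
    unfolding state_ok_def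
  proof (intro conjI allI impI)
    fix b d assume "(b, d) \<in> ?Y"
    then consider "b = a" "d = c" | "(b, d) \<in> Y" by blast
    then have "b < d \<and> d < n \<and> b < f b" by cases (use assms state_okD(2)[OF assms(1)] in simp_all)
    then show "b < d" "d < n" "b < f b" by simp_all
  qed (use state_okD(1,3,4)[OF assms(1)] in simp_all)
qed

text \<open>The synchronisation on \<open>x a c\<close>. As \<open>a < c\<close>, reaching
  \<open>Suc a\<close> never counts as performing \<open>c\<close>, so no other thread becomes
  exposed.\<close>

lemma upd_x:
  assumes "state_ok f Y" "a < c" "c < n" "(a, c) \<in> Y" "f c = a" "exposed f c"
  shows "\<exists>R. threads f Y = add_mset (next_item c a) R \<and> (threads (f(c := Suc a)) Y :: 'k::comm_semiring_1 item multiset) = add_mset (next_item c (Suc a)) R"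
    and "forwarders f Y = add_mset (Lin Neg (x a c) (Cst 1)) (forwarders (f(c := Suc a)) Y :: 'k item multiset)"
    and "state_ok (f(c := Suc a)) Y" and "b < (f(c := Suc a)) b \<longleftrightarrow> b < f b"
proof -
  let ?f = "f(c := Suc a)"
  have e: "b < ?f b \<longleftrightarrow> b < f b" for b using assms by auto
  then show "b < ?f b \<longleftrightarrow> b < f b" .
  let ?t = "\<lambda>f b. if exposed f b \<and> f b \<le> b then {#next_item b (f b) :: 'k item#} else {#}"
  obtain R where R: "(\<Sum>b<n. ?t f b) = ?t f c + R" "(\<Sum>b<n. ?t ?f b) = ?t ?f c + R"
    by (rule sum_update[of "{..<n}" c "?t f" "?t ?f"]) (use assms in \<open>auto simp: e simp del: fun_upd_apply simp: fun_upd_other\<close>)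
  have t: "?t f c = {#next_item c a#}" "?t ?f c = {#next_item c (Suc a)#}" using assms e by auto
  show "\<exists>R. threads f Y = add_mset (next_item c a) R \<and> (threads ?f Y :: 'k item multiset) = add_mset (next_item c (Suc a)) R"
  proof -
    let ?O = "(\<Sum>b<n. if b < f b then pending b Y + blocks b else {#}) :: 'k item multiset"
    have "threads f Y = add_mset (next_item c a) (R + ?O)" unfolding threads_def R(1) t(1) by simp
    moreover have "threads ?f Y = add_mset (next_item c (Suc a)) (R + ?O)"
      unfolding threads_def R(2) t(2) by (simp only: e) simp
    ultimately show ?thesis by blast
  qed
  let ?g = "\<lambda>f. \<lambda>(a, c). if (a, c) \<notin> Y then {#Lin Pos (y a c) (lin_act Neg (x a c) (Cst 1 :: 'k tm))#}
     else if f c \<le> a then {#Lin Neg (x a c) (Cst 1)#} else {#}"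
  have g: "?g f (a, c) = {#Lin Neg (x a c) (Cst 1)#}" "?g ?f (a, c) = {#}" using assms by simp_all
  have gg: "?g f p = ?g ?f p" if "p \<noteq> (a, c)" for p
  proof (cases p)
    case (Pair b d)
    then have "f d \<le> b \<longleftrightarrow> ?f d \<le> b" using that assms(5) by (cases "d = c") auto
    then show ?thesis unfolding Pair by (simp del: fun_upd_apply)
  qed
  have ac: "(a, c) \<in> {(a, c). a < c \<and> c < n}" using assms by simp
  obtain R where R: "forwarders f Y = ?g f (a, c) + R" "forwarders ?f Y = ?g ?f (a, c) + R"
    unfolding forwarders_def by (rule sum_update[OF fin_pairs ac, of "?g f" "?g ?f"]) (rule gg, assumption, blast)
  show "forwarders f Y = add_mset (Lin Neg (x a c) (Cst 1)) (forwarders ?f Y :: 'k item multiset)" unfolding R g by simp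
  have "(a', c') \<in> Y" if "a' < c'" "c' < n" "a' < ?f c'" for a' c'
    using that assms(2-5) state_okD(1)[OF assms(1), of a' c'] by (cases "c' = c"; cases "a' = a") auto
  moreover have "a' < c' \<and> c' < n \<and> a' < ?f a'" if "(a', c') \<in> Y" for a' c'
    using state_okD(2)[OF assms(1) that] unfolding e by blast
  moreover have "?f b = 0" if "b < n" "\<not> exposed ?f b" for b
  proof -
    have "\<not> exposed f b" using that(2) e by blast
    then have "b \<noteq> c" "f b = 0" using assms(6) state_okD(3)[OF assms(1) that(1)] by blast+
    then show ?thesis by simp
  qed
  moreover have "?f b \<le> Suc b" for b using assms(2,5) state_okD(4)[OF assms(1), of b] by auto
  ultimately show "state_ok ?f Y" unfolding state_ok_def by blast
qed

text \<open>The visible action of event \<open>b\<close>: the counter \<open>Suc b\<close> marks it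
  as performed, which releases its signals, its children and its part of \<open>N\<close>.\<close>

lemma upd_act:
  assumes "state_ok f Y" "b < n" "f b = b" "exposed f b"
  shows "\<exists>R. threads f Y = add_mset (next_item b b) R \<and>
      (threads (f(b := Suc b)) Y :: 'k::comm_semiring_1 item multiset) = R + (pending b {} + ((\<Sum>c\<in>kids b. {#next_item c 0#}) + blocks b))"
    and "forwarders (f(b := Suc b)) Y = (forwarders f Y :: 'k item multiset)" and "state_ok (f(b := Suc b)) Y"
proof -
  let ?f = "f(b := Suc b)"
  have e: "a < ?f a \<longleftrightarrow> a < f a \<or> a = b" for a using assms by auto
  have Yb: "(b, c) \<notin> Y" for c using state_okD(2)[OF assms(1), of b c] assms(3) by auto
  \<comment> \<open>Until now the children of \<open>b\<close> were hidden, so their counters are 0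
    and they will appear with their first item.\<close>
  have kb: "c \<noteq> b \<and> f c = 0 \<and> \<not> exposed f c" if "c \<in> kids b" for c
  proof -
    have "\<not> exposed f c" using that assms(3) by auto
    moreover have "f c = 0" using calculation that state_okD(3)[OF assms(1), of c] by blast
    ultimately show ?thesis using assms(4) by blast
  qed
  let ?t = "\<lambda>f c. if exposed f c \<and> f c \<le> c then {#next_item c (f c) :: 'k item#} else {#}"
  \<comment> \<open>The sum loses the item of \<open>b\<close> and gains those of its children at
    once. Correction terms on both sides turn this into a pointwise equation without
    subtraction.\<close>
  have pw: "?t ?f c + (if c = b then {#next_item b b#} else {#}) = ?t f c + (if c \<in> kids b then {#next_item c 0#} else {#})" if "c < n" for c
  proof (cases "c = b")
    case True
    have "b \<notin> kids b" using kb by blast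
    then show ?thesis using True assms by simp
  next
    case False
    show ?thesis
    proof (cases "c \<in> kids b")
      case True
      then have "exposed ?f c" by simp
      then show ?thesis using True kb[OF True] False by simp
    next
      case F: False
      then have "exposed ?f c \<longleftrightarrow> exposed f c" using that e by blast
      moreover have "snd (s ! c) \<noteq> Inr b" using F that by simp
      ultimately show ?thesis using F False by auto
    qed
  qed
  have "(\<Sum>c<n. ?t ?f c) + {#next_item b b#} = (\<Sum>c<n. ?t ?f c + (if c = b then {#next_item b b#} else {#}))"
    using assms(2) by (simp add: sum.distrib)
  also have "\<dots> = (\<Sum>c<n. ?t f c + (if c \<in> kids b then {#next_item c 0#} else {#}))"
    by (rule sum.cong[OF HOL.refl]) (rule pw, simp)
  also have "\<dots> = (\<Sum>c<n. ?t f c) + (\<Sum>c\<in>kids b. {#next_item c 0#})"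
  proof -
    have "{..<n} \<inter> kids b = kids b" by auto
    then show ?thesis by (simp only: sum.distrib sum.inter_restrict[symmetric] finite_lessThan)
  qed
  finally have S: "(\<Sum>c<n. ?t ?f c) + {#next_item b b#} = (\<Sum>c<n. ?t f c) + (\<Sum>c\<in>kids b. {#next_item c 0#})" .
  obtain R0 where R0: "(\<Sum>c<n. ?t f c) = add_mset (next_item b b) R0"
    using sum.remove[of "{..<n}" b "?t f"] assms by auto
  then have S': "(\<Sum>c<n. ?t ?f c) = R0 + (\<Sum>c\<in>kids b. {#next_item c 0#})" using S by simp
  have oY: "pending b Y = pending b {}" unfolding pending_def using Yb by simp
  let ?o = "\<lambda>f a. if a < f a then pending a Y + blocks a else ({#} :: 'k item multiset)"
  obtain R1 where R1: "(\<Sum>a<n. ?o ?f a) = ?o ?f b + R1" "(\<Sum>a<n. ?o f a) = ?o f b + R1"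
    by (rule sum_update[of "{..<n}" b "?o ?f" "?o f"]) (use assms e in auto)
  have O: "(\<Sum>a<n. ?o ?f a) = pending b {} + blocks b + (\<Sum>a<n. ?o f a)"
    unfolding R1 using assms(3) oY by simp
  have "threads f Y = add_mset (next_item b b) (R0 + (\<Sum>a<n. ?o f a))" unfolding threads_def R0 by simp
  moreover have "threads ?f Y = (R0 + (\<Sum>a<n. ?o f a)) + (pending b {} + ((\<Sum>c\<in>kids b. {#next_item c 0#}) + blocks b))"
    unfolding threads_def S' O by (simp add: ac_simps)
  ultimately show "\<exists>R. threads f Y = add_mset (next_item b b) R \<and>
      (threads ?f Y :: 'k item multiset) = R + (pending b {} + ((\<Sum>c\<in>kids b. {#next_item c 0#}) + blocks b))" by blast
  show "forwarders ?f Y = (forwarders f Y :: 'k item multiset)" unfolding forwarders_def using assms(3) by (auto intro!: sum.cong)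
  have "(a', c') \<in> Y" if "a' < c'" "c' < n" "a' < ?f c'" for a' c'
    using that assms(3) state_okD(1)[OF assms(1), of a' c'] by (cases "c' = b") auto
  moreover have "a' < c' \<and> c' < n \<and> a' < ?f a'" if "(a', c') \<in> Y" for a' c'
    using state_okD(2)[OF assms(1) that] unfolding e by blast
  moreover have "?f c = 0" if "c < n" "\<not> exposed ?f c" for c
  proof -
    have "\<not> exposed f c" using that(2) e by blast
    then have "c \<noteq> b" "f c = 0" using assms(4) state_okD(3)[OF assms(1) that(1)] by blast+
    then show ?thesis by simp
  qed
  moreover have "?f c \<le> Suc c" for c using state_okD(4)[OF assms(1), of c] by auto
  ultimately show "state_ok ?f Y" unfolding state_ok_def by blast
qed

section \<open>Steps of the network of threads and forwarders\<close>

abbreviation "public_names \<equiv> fnT T \<union> range z"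

text \<open>Supplies the objects of internal communications, which \<open>net_tau\<close> and
  \<open>net_sync\<close> keep away from the visible names.\<close>

lemma infinite_private_names: "infinite (- public_names)"
proof -
  have "range (\<lambda>a. x a 0) \<subseteq> - public_names" using names_fnT by auto
  moreover have "infinite (range (\<lambda>a. x a 0))" using finite_imageD[of "\<lambda>a. x a 0" UNIV] by (auto simp: inj_def)
  ultimately show ?thesis using finite_subset by blast
qed

text \<open>\<open>k\<close> counts the visible actions so far. \<open>H\<close> is existential
  because it grows with each communication; containing \<open>sync_names\<close> hides the signals,
  avoiding \<open>public_names\<close> keeps the events visible.\<close>

definition net_state :: "nat \<Rightarrow> 'k::comm_semiring_1 tm \<Rightarrow> (nat \<Rightarrow> nat) \<Rightarrow> (nat \<times> nat) set \<Rightarrow> bool" where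
  "net_state k Q f Y \<longleftrightarrow> (\<exists>H. net Q H (threads f Y) (forwarders f Y) \<and> sync_names \<subseteq> H \<and> H \<inter> public_names = {}) \<and> state_ok f Y \<and> (\<forall>a<n. a < f a \<longleftrightarrow> a < k) \<and> k \<le> n"

lemma sync_names_less: "a < c \<Longrightarrow> c < n \<Longrightarrow> x a c \<in> sync_names \<and> y a c \<in> sync_names" by (force simp: sync_names_def)

lemma net_state_step_y:
  fixes Q Q' :: "'a::comm_semiring_1 tm"
  assumes "net_state k Q f Y" "a < c" "c < n" "a < f a" "(a, c) \<notin> Y" "net Q H (threads f Y) (forwarders f Y)" "sync_names \<subseteq> H" "H \<inter> public_names = {}" "w \<notin> public_names"
    "threads f Y = add_mset (Lin Neg (y a c) (Cst 1)) M0" "forwarders f Y = add_mset (Lin Pos (y a c) (lin_act Neg (x a c) (Cst 1))) N0"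
    "\<forall>M' N'. exposes (opn 0 w (Cst 1)) M' \<longrightarrow> exposes (opn 0 w (lin_act Neg (x a c) (Cst 1))) N' \<longrightarrow> net Q' (insert w H) (M0 + M') (N0 + N')"
  shows "net_state k Q' f (insert (a, c) Y)"
proof -
  have m: "state_ok f Y" using assms(1) by (simp add: net_state_def)
  note u = upd_y(1,2)[where ?'k = 'a, OF m assms(2-5)] upd_y(3)[OF m assms(2-5)]
  have "net Q' (insert w H) (M0 + {#}) (N0 + {#Lin Neg (x a c) (Cst 1)#})"
    using assms(12)[rule_format, of "{#}" "{#Lin Neg (x a c) (Cst 1)#}"] exposes.one exposes.lin[of "Cst 1" Neg "x a c"] by simp
  moreover have "M0 = threads f (insert (a, c) Y)" using u(1) assms(10) by simp
  moreover have "add_mset (Lin Neg (x a c) (Cst 1)) N0 = forwarders f (insert (a, c) Y)" using u(2) assms(11) by auto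
  ultimately have "net Q' (insert w H) (threads f (insert (a, c) Y)) (forwarders f (insert (a, c) Y))" by simp
  then show ?thesis using assms(1,7-9) u(3) unfolding net_state_def by blast
qed

lemma net_state_step_x:
  fixes Q Q' :: "'a::comm_semiring_1 tm"
  assumes "net_state k Q f Y" "a < c" "c < n" "(a, c) \<in> Y" "f c = a" "exposed f c" "sync_names \<subseteq> H" "H \<inter> public_names = {}" "w \<notin> public_names"
    "threads f Y = add_mset (Lin Pos (x a c) (stage c (Suc a))) M0" "forwarders f Y = add_mset (Lin Neg (x a c) (Cst 1)) N0"
    "\<forall>M' N'. exposes (opn 0 w (stage c (Suc a))) M' \<longrightarrow> exposes (opn 0 w (Cst 1)) N' \<longrightarrow> net Q' (insert w H) (M0 + M') (N0 + N')"
  shows "net_state k Q' (f(c := Suc a)) Y"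
proof -
  have m: "state_ok f Y" using assms(1) by (simp add: net_state_def)
  note u = upd_x(1,2)[where ?'k = 'a, OF m assms(2-6)] upd_x(3,4)[OF m assms(2-6)]
  have "net Q' (insert w H) (M0 + {#next_item c (Suc a)#}) (N0 + {#})"
    using assms(12)[rule_format, of "{#next_item c (Suc a)#}" "{#}"] exposes.one exposes_stage[of "Suc a" c] assms(2) by (simp add: lc_stage)
  moreover have "add_mset (next_item c (Suc a)) M0 = threads (f(c := Suc a)) Y"
    using u(1) assms(2,10) by (auto simp: next_item_def)
  moreover have "N0 = forwarders (f(c := Suc a)) Y" using u(2) assms(11) by simp
  ultimately have "net Q' (insert w H) (threads (f(c := Suc a)) Y) (forwarders (f(c := Suc a)) Y)" by simp
  then show ?thesis using assms(1,7-9) u(3,4) unfolding net_state_def by blast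
qed

lemma net_state_step_act:
  fixes Q Q' :: "'a::comm_semiring_1 tm"
  assumes "net_state k Q f Y" "k < n" "f k = k" "exposed f k" "net Q H (threads f Y) (forwarders f Y)" "sync_names \<subseteq> H" "H \<inter> public_names = {}"
    "threads f Y = add_mset (Lin (fst (s ! k)) (subj T k) (cls 0 (z k) (body k))) M0"
    "\<forall>M'. exposes (opn 0 (z k) (cls 0 (z k) (body k))) M' \<longrightarrow> net Q' H (M0 + M') (forwarders f Y)"
  shows "net_state (Suc k) Q' (f(k := Suc k)) Y"
proof -
  have m: "state_ok f Y" using assms(1) by (simp add: net_state_def)
  note u = upd_act(1,2)[where ?'k = 'a, OF m assms(2-4)] upd_act(3)[OF m assms(2-4)]
  \<comment> \<open>The object of the action is \<open>z k\<close> itself, so opening undoes the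
    closing made by \<open>lin\<close>.\<close>
  have o: "opn 0 (z k) (cls 0 (z k) (body k)) = (body k :: 'a tm)" by (rule opn_cls) (use lc_body in \<open>simp add: lc_def\<close>)
  have "net Q' H (M0 + (pending k {} + ((\<Sum>c\<in>kids k. {#next_item c 0#}) + blocks k))) (forwarders f Y)"
    using assms(9)[unfolded o] exposes_body[where ?'a = 'a, of k] by blast
  moreover have "M0 + (pending k {} + ((\<Sum>c\<in>kids k. {#next_item c 0#}) + blocks k)) = threads (f(k := Suc k)) Y"
    using u(1) assms(8) by (auto simp: next_item_def)
  ultimately have "net Q' H (threads (f(k := Suc k)) Y) (forwarders (f(k := Suc k)) Y)" using u(2) by simp
  moreover have "a < (f(k := Suc k)) a \<longleftrightarrow> a < Suc k" if "a < n" for a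
    using assms(1) that unfolding net_state_def by (auto simp: less_Suc_eq)
  ultimately show ?thesis using assms(2,6,7) u(3) unfolding net_state_def by (metis Suc_leI)
qed

lemma net_state_tau:
  assumes "net_state k Q f Y" "tau Q Q'"
  shows "st Q' = 0 \<or> (\<exists>f Y. net_state k Q' f Y)"
proof -
  obtain H where H: "net Q H (threads f Y) (forwarders f Y)" "sync_names \<subseteq> H" "H \<inter> public_names = {}" and m: "state_ok f Y"
    using assms(1) by (auto simp: net_state_def)
  from net_tau[OF infinite_private_names H(1) assms(2)] show ?thesis
  proof (elim disjE exE conjE)
    assume "net Q' H (threads f Y) (forwarders f Y)"
    then show ?thesis using assms(1) H unfolding net_state_def by blast
  next
    fix w e u G1 G2 M0 N0
    assume w: "w \<notin> public_names" and 1: "threads f Y = add_mset (Lin e u G1) M0" and 2: "forwarders f Y = add_mset (Lin (negp e) u G2) N0"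
      and exposes: "\<forall>M' N'. exposes (opn 0 w G1) M' \<longrightarrow> exposes (opn 0 w G2) N' \<longrightarrow> net Q' (insert w H) (M0 + M') (N0 + N')"
    have "Lin (negp e) u G2 \<in># forwarders f Y" using 2 by simp
    \<comment> \<open>The item of the forwarder determines the channel, and the channel determines
      the thread that takes part.\<close>
    then consider a c where "a < c" "c < n" "(a, c) \<notin> Y" "Lin (negp e) u G2 = Lin Pos (y a c) (lin_act Neg (x a c) (Cst 1))"
      | a c where "a < c" "c < n" "(a, c) \<in> Y" "f c \<le> a" "Lin (negp e) u G2 = Lin Neg (x a c) (Cst 1)"
      unfolding forwarders_mem by (auto split: if_splits)
    then show ?thesis
    proof cases
      case (1 a c)
      then have e: "e = Neg" "u = y a c" "G2 = lin_act Neg (x a c) (Cst 1)" by (cases e; simp)+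
      have "Lin e u G1 \<in># threads f Y" using \<open>threads f Y = _\<close> by simp
      then have "a < f a \<and> G1 = Cst 1" unfolding threads_mem e by (auto simp: next_item_def split: if_splits)
      then have "net_state k Q' f (insert (a, c) Y)"
        using net_state_step_y[OF assms(1) 1(1,2) _ 1(3) H w] \<open>threads f Y = _\<close> 2 exposes e by simp
      then show ?thesis by blast
    next
      case (2 a c)
      then have e: "e = Pos" "u = x a c" "G2 = Cst 1" by (cases e; simp)+
      have "Lin e u G1 \<in># threads f Y" using \<open>threads f Y = _\<close> by simp
      then have "f c = a \<and> exposed f c \<and> G1 = stage c (Suc a)" unfolding threads_mem e by (auto simp: next_item_def split: if_splits)
      then have "net_state k Q' (f(c := Suc a)) Y"
        using net_state_step_x[OF assms(1) 2(1,2,3) _ _ H(2,3) w] \<open>threads f Y = _\<close> \<open>forwarders f Y = _\<close> exposes e by simp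
      then show ?thesis by blast
    qed
  qed simp
qed

text \<open>A thread with all its signals has seen every earlier event performed, hence it belongs
  to the first event still missing. Here the totality of the order fixes the sequence of visible
  actions.\<close>

lemma net_state_fired: assumes "net_state k Q f Y" "f b = b" "b < n" shows "b = k"
proof -
  have m: "state_ok f Y" and k: "\<And>a. a < n \<Longrightarrow> a < f a \<longleftrightarrow> a < k" using assms(1) by (auto simp: net_state_def)
  have "a < k" if "a < b" for a
  proof -
    have "(a, b) \<in> Y" using state_okD(1)[OF m that] that assms by simp
    then have "a < f a" using state_okD(2)[OF m] by blast
    then show ?thesis using k[of a] that assms by simp
  qed
  moreover have "\<not> b < k" using k[of b] assms by simp
  ultimately show ?thesis using assms(1) by (metis linorder_neqE_nat less_irrefl)
qed

lemma net_state_vis: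
  fixes Q :: "'a::comm_semiring_1 tm"
  assumes "net_state k Q f Y" "vis Q e u (z k) Q'"
  shows "st Q' = 0 \<or> k < n \<and> e = fst (s ! k) \<and> u = subj T k \<and> (\<exists>f Y. net_state (Suc k) Q' f Y)"
proof -
  obtain H where H: "net Q H (threads f Y) (forwarders f Y)" "sync_names \<subseteq> H" "H \<inter> public_names = {}" and m: "state_ok f Y"
    using assms(1) by (auto simp: net_state_def)
  have "z k \<notin> H" using H(3) by blast
  note v = net_vis[OF H(1) assms(2) this]
  then have uH: "u \<notin> H" by blast
  \<comment> \<open>Forwarders carry only signal names, which are restricted; this closes the
    alternative left open by \<open>net_vis\<close>.\<close>
  have "\<not> Lin e u G \<in># forwarders f Y" for G :: "'a tm"
    unfolding forwarders_mem using uH H(2) sync_names_less by (auto split: if_splits)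
  with v have "st Q' = 0 \<or> (\<exists>G M0. threads f Y = add_mset (Lin e u G) M0 \<and> (\<forall>M'. exposes (opn 0 (z k) G) M' \<longrightarrow> net Q' H (M0 + M') (forwarders f Y)))"
    by blast
  then show ?thesis
  proof (elim disjE exE conjE)
    fix G M0 assume G: "threads f Y = add_mset (Lin e u G) M0" and exposes: "\<forall>M'. exposes (opn 0 (z k) G) M' \<longrightarrow> net Q' H (M0 + M') (forwarders f Y)"
    have "Lin e u G \<in># threads f Y" using G by simp
    then obtain b where b: "b < n" "exposed f b" "f b \<le> b" "Lin e u G = next_item b (f b)"
      unfolding threads_mem using uH H(2) sync_names_less by blast
    \<comment> \<open>A thread still waiting for a signal has a restricted subject, so it cannot be
      the one that acts visibly.\<close>
    have fb: "f b = b"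
    proof (rule ccontr)
      assume "f b \<noteq> b"
      then have "f b < b" using b by simp
      then show False using b uH H(2) sync_names_less[of "f b" b] by (auto simp: next_item_def)
    qed
    then have k: "b = k" using net_state_fired[OF assms(1)] b by simp
    have e: "e = fst (s ! k)" "u = subj T k" "G = cls 0 (z k) (body k)" using b(4) fb k by (auto simp: next_item_def)
    have "net_state (Suc k) Q' (f(k := Suc k)) Y"
      using net_state_step_act[OF assms(1) _ _ _ H, of M0 Q'] b fb k G exposes e by simp
    then show ?thesis using e b k by blast
  qed simp
qed

text \<open>Signals are moved as long as possible. When none can move, event \<open>k\<close> has
  received all of its own and can act; after the last event there are only performed actions to be
  completed.\<close>

lemma net_state_progress:
  fixes Q :: "'a::comm_semiring_1 tm"
  assumes "net_state k Q f Y" "z k \<notin> fv Q"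
  shows "(\<exists>Q' f Y. tau Q Q' \<and> net_state k Q' f Y) \<or> (k < n \<and> (\<exists>Q' f Y. vis Q (fst (s ! k)) (subj T k) (z k) Q' \<and> net_state (Suc k) Q' f Y))
    \<or> (k = n \<and> final Q)"
proof -
  obtain H where H: "net Q H (threads f Y) (forwarders f Y)" "sync_names \<subseteq> H" "H \<inter> public_names = {}" and m: "state_ok f Y"
    and k: "\<And>a. a < n \<Longrightarrow> a < f a \<longleftrightarrow> a < k" "k \<le> n"
    using assms(1) by (auto simp: net_state_def)
  consider (y) a c where "a < c" "c < n" "a < f a" "(a, c) \<notin> Y"
    | (x) c where "c < n" "exposed f c" "f c < c" "(f c, c) \<in> Y"
    | (n) "\<And>a c. a < c \<Longrightarrow> c < n \<Longrightarrow> a < f a \<Longrightarrow> (a, c) \<in> Y" "\<And>c. c < n \<Longrightarrow> exposed f c \<Longrightarrow> f c < c \<Longrightarrow> (f c, c) \<notin> Y"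
    by blast
  then show ?thesis
  proof cases
    case y
    have "Lin Neg (y a c) (Cst 1 :: 'a tm) \<in># threads f Y" unfolding threads_mem using y by blast
    then obtain M0 where M0: "threads f Y = add_mset (Lin Neg (y a c) (Cst 1 :: 'a tm)) M0" by (rule mset_add)
    have "Lin (negp Neg) (y a c) (lin_act Neg (x a c) (Cst 1 :: 'a tm)) \<in># forwarders f Y"
      unfolding forwarders_mem by (intro exI[of _ a] exI[of _ c]) (use y in simp)
    then obtain N0 where N0: "forwarders f Y = add_mset (Lin (negp Neg) (y a c) (lin_act Neg (x a c) (Cst 1 :: 'a tm))) N0" by (rule mset_add)
    obtain w Q' where "w \<notin> public_names" "tau Q Q'" "\<forall>M' N'. exposes (opn 0 w (Cst 1)) M' \<longrightarrow> exposes (opn 0 w (lin_act Neg (x a c) (Cst 1))) N' \<longrightarrow> net Q' (insert w H) (M0 + M') (N0 + N')"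
      using net_sync[OF infinite_private_names H(1) M0 N0] by blast
    then have "net_state k Q' f (insert (a, c) Y)"
      using net_state_step_y[OF assms(1) y H _ M0, of w N0 Q'] N0 by simp
    then show ?thesis using \<open>tau Q Q'\<close> by blast
  next
    case x
    let ?a = "f c"
    have "Lin Pos (x ?a c) (stage c (Suc ?a) :: 'a tm) = next_item c (f c)" using x by (simp add: next_item_def)
    then have "Lin Pos (x ?a c) (stage c (Suc ?a) :: 'a tm) \<in># threads f Y" unfolding threads_mem using x by (metis less_imp_le)
    then obtain M0 where M0: "threads f Y = add_mset (Lin Pos (x ?a c) (stage c (Suc ?a) :: 'a tm)) M0" by (rule mset_add)
    have "Lin (negp Pos) (x ?a c) (Cst 1 :: 'a tm) \<in># forwarders f Y"
      unfolding forwarders_mem by (intro exI[of _ ?a] exI[of _ c]) (use x in simp)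
    then obtain N0 where N0: "forwarders f Y = add_mset (Lin (negp Pos) (x ?a c) (Cst 1 :: 'a tm)) N0" by (rule mset_add)
    obtain w Q' where "w \<notin> public_names" "tau Q Q'" "\<forall>M' N'. exposes (opn 0 w (stage c (Suc ?a))) M' \<longrightarrow> exposes (opn 0 w (Cst 1)) N' \<longrightarrow> net Q' (insert w H) (M0 + M') (N0 + N')"
      using net_sync[OF infinite_private_names H(1) M0 N0] by blast
    then have "net_state k Q' (f(c := Suc ?a)) Y"
      using net_state_step_x[OF assms(1) x(3,1,4) HOL.refl x(2) H(2,3) _ M0, of w N0 Q'] N0 by simp
    then show ?thesis using \<open>tau Q Q'\<close> by blast
  next
    case n
    show ?thesis
    proof (cases "k < n")
      case True
      have ex: "exposed f k"
      proof (intro allI impI)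
        fix a assume "snd (s ! k) = Inr a"
        then have "a < k" using src_less True by blast
        then show "a < f a" using k(1)[of a] True by simp
      qed
      have "\<not> k < f k" using k(1)[of k] True by simp
      \<comment> \<open>Otherwise the next signal for \<open>k\<close> comes from event
        \<open>f k\<close>, already performed; its forwarder must have taken the signal and could
        then deliver it.\<close>
      moreover have "\<not> f k < k"
      proof
        assume fk: "f k < k"
        then have "f k < f (f k)" using k(1)[of "f k"] True by simp
        then show False using n(1)[OF fk True] n(2)[OF True ex fk] by simp
      qed
      ultimately have fk: "f k = k" by simp
      have "(next_item k (f k) :: 'a item) \<in># threads f Y" unfolding threads_mem using True ex fk by (metis order_refl)
      then have "Lin (fst (s ! k)) (subj T k) (cls 0 (z k) (body k :: 'a tm)) \<in># threads f Y" using fk by (simp add: next_item_def)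
      then obtain M0 where M0: "threads f Y = add_mset (Lin (fst (s ! k)) (subj T k) (cls 0 (z k) (body k :: 'a tm))) M0" by (rule mset_add)
      have "subj T k \<notin> H" "z k \<notin> H" using subj_cases[OF True] H(3) by blast+
      then obtain Q' where "vis Q (fst (s ! k)) (subj T k) (z k) Q'"
        "\<forall>M'. exposes (opn 0 (z k) (cls 0 (z k) (body k))) M' \<longrightarrow> net Q' H (M0 + M') (forwarders f Y)"
        using net_Lin[OF H(1) M0 _ _ assms(2)] by blast
      then show ?thesis using net_state_step_act[OF assms(1) True fk ex H M0] True by blast
    next
      case False
      then have kn: "k = n" using k(2) by simp
      then have all: "a < f a" if "a < n" for a using k(1) that by simp
      have "(a, c) \<in> Y \<and> a < f c" if "a < c" "c < n" for a c using n(1)[OF that] all[of a] all[of c] that by auto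
      then have "i \<notin># forwarders f Y" for i :: "'a item" unfolding forwarders_mem by (auto simp: not_le)
      then have forwarders: "forwarders f Y = ({#} :: 'a item multiset)" by (metis multiset_nonemptyE)
      have "Lin e u G \<notin># threads f Y" for e u and G :: "'a tm"
        unfolding threads_mem using all n(1) by (auto simp: not_le)
      then have "\<exists>Q'. tau Q Q' \<and> net Q' H (threads f Y) (forwarders f Y)" if "tau Q Q''" for Q''
        using net_progress[OF H(1) forwarders _ that] by blast
      then show ?thesis using assms(1) H kn unfolding net_state_def final_tau by blast
    qed
  qed
qed

text \<open>A pending linear action always has an internal step, so a final term contains none.
  Hence all events are performed, and only the elements of \<open>N\<close> on objects are still
  offered.\<close>

lemma net_state_final:
  fixes Q :: "'a::comm_semiring_1 tm"
  assumes "net_state k Q f Y" "final Q" "z k \<notin> fv Q"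
  shows "k = n" and "inits Q = {(e, z a) |e a. (e, Inr a) \<in> N}"
proof -
  obtain H where H: "net Q H (threads f Y) (forwarders f Y)" "sync_names \<subseteq> H" "H \<inter> public_names = {}" and m: "state_ok f Y"
    and k: "\<And>a. a < n \<Longrightarrow> a < f a \<longleftrightarrow> a < k" "k \<le> n"
    using assms(1) by (auto simp: net_state_def)
  have noLI: "Lin e u G \<notin># threads f Y" "Lin e u G \<notin># forwarders f Y" for e u and G :: "'a tm"
    using net_Lin_tau[OF H(1), of e u G] assms(2) by (auto simp: final_tau)
  have next_item: "\<exists>e u G. next_item b j = Lin e u G" for b j by (simp add: next_item_def)
  have Y: "(a, c) \<in> Y \<and> a < f c" if "a < c" "c < n" for a c
    using noLI(2) that unfolding forwarders_mem by (metis not_le)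
  \<comment> \<open>Induction along the order: the source of \<open>b\<close> has been performed, so
    its thread is exposed, and an unfinished thread would show a pending action.\<close>
  have all: "b < f b" if "b < n" for b
    using that
  proof (induction b rule: less_induct)
    case (less b)
    have "exposed f b" using less src_less src_less_n by blast
    then show ?case using noLI(1) next_item[of b "f b"] less.prems unfolding threads_mem by (metis not_le)
  qed
  show kn: "k = n"
  proof (rule ccontr)
    assume "k \<noteq> n"
    then show False using k(1)[of k] all[of k] k(2) by simp
  qed
  have zH: "z a \<notin> H" for a using H(3) by blast
  have "(\<exists>Q'. vis Q e u (z k) Q') \<longleftrightarrow> (\<exists>a. u = z a \<and> (e, Inr a) \<in> N)" for e u
  proof
    assume "\<exists>Q'. vis Q e u (z k) Q'"
    then obtain Q' where Q': "vis Q e u (z k) Q'" by blast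
    have "(Blk e u :: 'a item) \<in># threads f Y + forwarders f Y"
      using net_vis[OF H(1) Q' zH] noLI by (metis union_single_eq_member)
    then show "\<exists>a. u = z a \<and> (e, Inr a) \<in> N" by (auto simp: threads_mem forwarders_mem next_item_def split: if_splits)
  next
    assume "\<exists>a. u = z a \<and> (e, Inr a) \<in> N"
    then obtain a where a: "u = z a" "(e, Inr a) \<in> N" by blast
    then have "(Blk e u :: 'a item) \<in># threads f Y" unfolding threads_mem using N_less all by blast
    then show "\<exists>Q'. vis Q e u (z k) Q'" using net_Blk[OF H(1) _ _ zH assms(3)] a zH by blast
  qed
  then show "inits Q = {(e, z a) |e a. (e, Inr a) \<in> N}" using inits_iff[OF assms(3)] by auto
qed

section \<open>The whole implementation, with the prefixes of \<open>N\<close> on free names\<close>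

text \<open>The last conjunct keeps \<open>z k\<close>, \<open>z (Suc k)\<close>, ... fresh, so the
  next visible action can take the object \<open>z k\<close>.\<close>

definition impl_state :: "nat \<Rightarrow> 'k::comm_semiring_1 tm \<Rightarrow> bool" where
  "impl_state k P \<longleftrightarrow> (\<exists>Q R f Y M0. P = Sep Q R \<and> exposes R M0 \<and> set_mset M0 = {Blk e u |e u. (e, Inl u) \<in> N} \<and> net_state k Q f Y
     \<and> fv P \<inter> z ` {k..} = {})"

lemma impl_stateE: assumes "impl_state k P" obtains Q R f Y M0 where "P = Sep Q R" "exposes R M0" "set_mset M0 = {Blk e u |e u. (e, Inl u) \<in> N}"
  "net_state k Q f Y" "fv P \<inter> z ` {k..} = {}"
  using assms unfolding impl_state_def by blast

lemma impl_state_tau: assumes "impl_state k P" "tau P P'" shows "st P' = 0 \<or> impl_state k P'"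
proof -
  obtain Q R f Y M0 where I: "P = Sep Q R" "exposes R M0" "set_mset M0 = {Blk e u |e u. (e, Inl u) \<in> N}" "net_state k Q f Y" "fv P \<inter> z ` {k..} = {}"
    using assms(1) by (rule impl_stateE)
  have fv: "fv P' \<inter> z ` {k..} = {}" using tau_fv[OF assms(2)] I(5) by blast
  from assms(2) consider Q' where "P' = Sep Q' R" "tau Q Q'" | R' where "P' = Sep Q R'" "tau R R'"
    unfolding I(1) tau_Sep by blast
  then show ?thesis
  proof cases
    case 1
    then show ?thesis using net_state_tau[OF I(4) 1(2)] I fv unfolding impl_state_def by (metis mult_zero_left st.simps(6))
  next
    case 2
    then show ?thesis using exposes_tau[OF I(2) 2(2)] I fv unfolding impl_state_def by (metis mult_zero_right st.simps(6))
  qed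
qed

lemma impl_state_vis: assumes "impl_state k P" "vis P e u (z k) P'"
  shows "st P' = 0 \<or> k < n \<and> e = fst (s ! k) \<and> u = subj T k \<and> impl_state (Suc k) P'"
proof -
  obtain Q R f Y M0 where I: "P = Sep Q R" "exposes R M0" "set_mset M0 = {Blk e u |e u. (e, Inl u) \<in> N}" "net_state k Q f Y" "fv P \<inter> z ` {k..} = {}"
    using assms(1) by (rule impl_stateE)
  have fv: "fv P' \<inter> z ` {Suc k..} = {}" using fv_shift vis_fv[OF assms(2)] I(5) by blast
  from assms(2) consider Q' where "P' = Sep Q' R" "vis Q e u (z k) Q'" | R' where "P' = Sep Q R'" "vis R e u (z k) R'"
    unfolding I(1) vis_Sep by blast
  then show ?thesis
  proof cases
    case 1
    then show ?thesis using net_state_vis[OF I(4) 1(2)] I fv unfolding impl_state_def by (metis mult_zero_left st.simps(6))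
  next
    case 2
    have "Lin e u G \<notin># M0" for G using I(3) by auto
    then have "st R' = 0" using exposes_vis[OF I(2) 2(2)] by (metis union_single_eq_member)
    then show ?thesis using 2 by simp
  qed
qed

lemma impl_state_progress: assumes "impl_state k P"
  shows "(\<exists>P'. tau P P' \<and> impl_state k P') \<or> (k < n \<and> (\<exists>P'. vis P (fst (s ! k)) (subj T k) (z k) P' \<and> impl_state (Suc k) P')) \<or> (k = n \<and> final P)"
proof -
  obtain Q R f Y M0 where I: "P = Sep Q R" "exposes R M0" "set_mset M0 = {Blk e u |e u. (e, Inl u) \<in> N}" "net_state k Q f Y" "fv P \<inter> z ` {k..} = {}"
    using assms(1) by (rule impl_stateE)
  have zk: "z k \<notin> fv Q" "z k \<notin> fv R" using I(1,5) by auto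
  have Lin: "Lin e u G \<notin># M0" for e u G using I(3) by auto
  show ?thesis using net_state_progress[OF I(4) zk(1)]
  proof (elim disjE exE conjE)
    fix Q' f Y assume *: "tau Q Q'" "net_state k Q' f Y"
    then have t: "tau P (Sep Q' R)" using I(1) by (auto simp: tau_Sep)
    have "fv (Sep Q' R) \<inter> z ` {k..} = {}" using tau_fv[OF t] I(5) by blast
    then have "impl_state k (Sep Q' R)" unfolding impl_state_def using I * by blast
    then show ?thesis using t by blast
  next
    fix Q' f Y assume *: "k < n" "vis Q (fst (s ! k)) (subj T k) (z k) Q'" "net_state (Suc k) Q' f Y"
    then have t: "vis P (fst (s ! k)) (subj T k) (z k) (Sep Q' R)" using I(1) zk by (auto simp: vis_Sep)
    have "fv (Sep Q' R) \<inter> z ` {Suc k..} = {}" using fv_shift vis_fv[OF t] I(5) by blast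
    then have "impl_state (Suc k) (Sep Q' R)" unfolding impl_state_def using I * by blast
    then show ?thesis using t * by blast
  next
    assume *: "k = n" "final Q"
    show ?thesis
    proof (cases "final R")
      case True
      then show ?thesis using * I(1) by (auto simp: final_tau tau_Sep)
    next
      case False
      then obtain R' where R': "tau R R'" "exposes R' M0" using exposes_progress[OF I(2) Lin] by (auto simp: final_tau)
      then have t: "tau P (Sep Q R')" using I(1) by (auto simp: tau_Sep)
      have "fv (Sep Q R') \<inter> z ` {k..} = {}" using tau_fv[OF t] I(5) by blast
      then have "impl_state k (Sep Q R')" unfolding impl_state_def using I R' by blast
      then show ?thesis using t by blast
    qed
  qed
qed

lemma impl_state_st: "impl_state k P \<Longrightarrow> st P = 1"
  by (auto elim!: impl_stateE simp: net_state_def net_st exposes_st)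

lemma impl_state_final: assumes "impl_state k P" "final P" shows "k = n" and "inits P = apsnd (inst z) ` N"
proof -
  obtain Q R f Y M0 where I: "P = Sep Q R" "exposes R M0" "set_mset M0 = {Blk e u |e u. (e, Inl u) \<in> N}" "net_state k Q f Y" "fv P \<inter> z ` {k..} = {}"
    using assms(1) by (rule impl_stateE)
  have zk: "z k \<notin> fv Q" "z k \<notin> fv R" "z k \<notin> fv P" using I(1,5) by auto
  have fin: "final Q" "final R" using assms(2) I(1) by (auto simp: final_tau tau_Sep)
  note Q = net_state_final[OF I(4) fin(1) zk(1)]
  show "k = n" by (rule Q(1))
  have Lin: "Lin e u G \<notin># M0" for e u G using I(3) by auto
  have R: "(\<exists>R'. vis R e u (z k) R') \<longleftrightarrow> (e, Inl u) \<in> N" for e u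
  proof
    assume "\<exists>R'. vis R e u (z k) R'"
    then have "Blk e u \<in># M0" using exposes_vis[OF I(2)] Lin by (metis union_single_eq_member)
    then show "(e, Inl u) \<in> N" using I(3) by auto
  next
    assume "(e, Inl u) \<in> N"
    then have "Blk e u \<in># M0" using I(3) by auto
    then show "\<exists>R'. vis R e u (z k) R'" using exposes_Blk[OF I(2) _ zk(2)] by blast
  qed
  have "(e, u) \<in> inits P \<longleftrightarrow> (e, u) \<in> inits Q \<or> (e, Inl u) \<in> N" for e u
  proof -
    have "(\<exists>P'. vis P e u (z k) P') \<longleftrightarrow> (\<exists>Q'. vis Q e u (z k) Q') \<or> (\<exists>R'. vis R e u (z k) R')"
      unfolding I(1) vis_Sep using zk(1,2) by blast
    then show ?thesis unfolding inits_iff[OF zk(3)] inits_iff[OF zk(1)] R .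
  qed
  moreover have "(e, u) \<in> apsnd (inst z) ` N \<longleftrightarrow> (\<exists>a. u = z a \<and> (e, Inr a) \<in> N) \<or> (e, Inl u) \<in> N" for e u
  proof -
    have "(e, u) \<in> apsnd (inst z) ` N \<longleftrightarrow> (\<exists>v. (e, v) \<in> N \<and> u = inst z v)" by force
    also have "\<dots> \<longleftrightarrow> (\<exists>a. u = z a \<and> (e, Inr a) \<in> N) \<or> (e, Inl u) \<in> N"
      by (metis inst_simps sum.exhaust)
    finally show ?thesis .
  qed
  moreover have "(e, u) \<in> inits Q \<longleftrightarrow> (\<exists>a. u = z a \<and> (e, Inr a) \<in> N)" for e u unfolding Q(2) by auto
  ultimately have "(e, u) \<in> inits P \<longleftrightarrow> (e, u) \<in> apsnd (inst z) ` N" for e u by simp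
  then show "inits P = apsnd (inst z) ` N" by (metis subrelI subset_antisym)
qed

lemma impl_state_init: "impl_state 0 (impl T :: 'k::comm_semiring_1 tm)"
proof -
  have "state_ok (\<lambda>_. 0) {}" by (auto simp: state_ok_def)
  moreover have "sync_names \<inter> public_names = {}" using names_fnT by (auto simp: sync_names_def)
  ultimately have n: "net_state 0 (core :: 'k tm) (\<lambda>_. 0) {}" unfolding net_state_def using net_core by blast
  have "fv (impl T :: 'k tm) \<inter> z ` {0..} = {}" using fv_impl names_fnT by blast
  then show ?thesis unfolding impl_state_def impl_eq using n exposes_blocks0 by blast
qed

section \<open>Triples of the implementation\<close>

abbreviation "labels \<equiv> map (apsnd (inst z)) s"

lemma drop_labels: "k < n \<Longrightarrow> drop k labels = (fst (s ! k), subj T k) # drop (Suc k) labels"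
  by (simp add: Cons_nth_drop_Suc[symmetric] subj_inst apsnd_def map_prod_def case_prod_unfold)

text \<open>The state of a term divides the states of its successors, so a nonzero final state
  excludes the alternatives of state 0 at every step and the invariant persists.\<close>

lemma run_sound: "run z k P t Q \<Longrightarrow> impl_state k P \<Longrightarrow> final Q \<Longrightarrow> st Q \<noteq> 0 \<Longrightarrow>
  t = drop k labels \<and> inits Q = apsnd (inst z) ` N \<and> st Q = 1"
proof (induction rule: run.induct)
  case (nil k P)
  then show ?case using impl_state_final[of k P] impl_state_st[of k P] by simp
next
  case (tau P P' k t Q)
  have "st P' \<noteq> 0" using tau.hyps(2) tau.prems(3) by (induction rule: run.induct) (auto dest: st_zero_tau st_zero_vis)
  then show ?case using tau impl_state_tau by blast
next
  case (vis P e u k P' t Q)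
  have "st P' \<noteq> 0" using vis.hyps(2) vis.prems(3) by (induction rule: run.induct) (auto dest: st_zero_tau st_zero_vis)
  then show ?case using vis impl_state_vis[OF vis.prems(1) vis.hyps(1)] drop_labels by auto
qed

text \<open>Progress preserves the invariant and never gets stuck before the last event, and each
  step uses up a prefix.\<close>

lemma run_complete: "impl_state k P \<Longrightarrow> \<exists>Q. run z k P (drop k labels) Q \<and> final Q \<and> st Q = 1"
proof (induction "num_acts P" arbitrary: k P rule: less_induct)
  case less
  from impl_state_progress[OF less.prems] show ?case
  proof (elim disjE exE conjE)
    fix P' assume *: "tau P P'" "impl_state k P'"
    then obtain Q where "run z k P' (drop k labels) Q" "final Q" "st Q = 1" using less.hyps tau_num_acts by blast
    then show ?thesis using run.tau[OF *(1)] by blast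
  next
    fix P' assume *: "k < n" "vis P (fst (s ! k)) (subj T k) (z k) P'" "impl_state (Suc k) P'"
    then obtain Q where "run z (Suc k) P' (drop (Suc k) labels) Q" "final Q" "st Q = 1" using less.hyps vis_num_acts by blast
    then show ?thesis unfolding drop_labels[OF *(1)] using run.vis[where f = z and n = k, OF *(2)] by blast
  next
    assume "k = n" "final P"
    then show ?thesis using run.nil impl_state_st[OF less.prems] by (intro exI[of _ P]) simp
  qed
qed

lemma test_triples_impl: "k \<noteq> 0 \<Longrightarrow> (t, M, k) \<in> test_triples z (impl T :: 'k::comm_semiring_1 tm) \<longleftrightarrow>
   k = 1 \<and> t = labels \<and> M = apsnd (inst z) ` N"
proof
  assume k: "k \<noteq> 0" and "(t, M, k) \<in> test_triples z (impl T :: 'k tm)"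
  then obtain Q :: "'k tm" where Q: "run z 0 (impl T) t Q" "final Q" "M = inits Q" "k = st Q" by (auto simp: test_triples_def)
  then show "k = 1 \<and> t = labels \<and> M = apsnd (inst z) ` N" using run_sound[OF Q(1) impl_state_init Q(2)] k by simp
next
  assume *: "k = 1 \<and> t = labels \<and> M = apsnd (inst z) ` N"
  obtain Q :: "'k tm" where Q: "run z 0 (impl T) labels Q" "final Q" "st Q = 1" using run_complete[OF impl_state_init] by auto
  then have "inits Q = M" using run_sound[OF Q(1) impl_state_init Q(2)] * by simp
  then show "(t, M, k) \<in> test_triples z (impl T :: 'k tm)" unfolding test_triples_def using Q * by force
qed

text \<open>The supply \<open>z\<close> is exchanged for \<open>f\<close> through the abstract
  sequence; injectivity of \<open>inst z\<close> on the subjects that can occur recovers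
  \<open>s\<close> and \<open>N\<close> from their images.\<close>

lemma test_triples_impl_avoids:
  assumes f: "avoids f (fnT T)" and k: "k \<noteq> 0"
  shows "(t, M, k) \<in> test_triples f (impl T :: 'k::comm_semiring_1 tm) \<longleftrightarrow>
   k = 1 \<and> t = map (apsnd (inst f)) s \<and> M = apsnd (inst f) ` N"
proof
  assume "(t, M, k) \<in> test_triples f (impl T :: 'k tm)"
  then obtain s' N' where *: "ok_trace (fnT T) s' N'" "t = map (apsnd (inst f)) s'" "M = apsnd (inst f) ` N'"
    and m: "(map (apsnd (inst f)) s', apsnd (inst f) ` N', k) \<in> test_triples f (impl T :: 'k tm)"
    using test_triples_abs[OF _ fv_impl f] by metis
  have "(map (apsnd (inst z)) s', apsnd (inst z) ` N', k) \<in> test_triples z (impl T :: 'k tm)"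
    by (rule test_triples_indep[OF f avoids_z fv_impl *(1) m])
  then have eq: "k = 1" "map (apsnd (inst z)) s' = labels" "apsnd (inst z) ` N' = apsnd (inst z) ` N"
    using test_triples_impl[OF k] by blast+
  let ?A = "Inl ` fnT T \<union> range Inr"
  have A: "snd ` set r \<subseteq> ?A \<and> snd ` M \<subseteq> ?A" if "ok_trace (fnT T) r M" for r M
  proof -
    have "snd (r ! i) \<in> ?A" if "i < length r" for i using \<open>ok_trace (fnT T) r M\<close> that unfolding ok_trace_def by blast
    then have "snd w \<in> ?A" if "w \<in> set r" for w using that by (metis in_set_conv_nth)
    then have "snd ` set r \<subseteq> ?A" by blast
    then show ?thesis using that unfolding ok_trace_def by blast
  qed
  have inj: "inj_on (apsnd (inst z) :: pol \<times> asub \<Rightarrow> _) (UNIV \<times> ?A)"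
  proof (rule inj_onI)
    fix v w :: "pol \<times> asub"
    assume *: "v \<in> UNIV \<times> ?A" "w \<in> UNIV \<times> ?A" "apsnd (inst z) v = apsnd (inst z) w"
    then have "snd v = snd w" using inj_onD[OF inst_inj[OF avoids_z]] by (metis mem_Times_iff snd_apsnd)
    moreover have "fst v = fst w" using *(3) by (metis fst_apsnd)
    ultimately show "v = w" by (rule prod_eqI[rotated])
  qed
  have U: "W \<subseteq> UNIV \<times> ?A" if "snd ` W \<subseteq> ?A" for W :: "(pol \<times> asub) set"
  proof
    fix w assume "w \<in> W"
    then have "snd w \<in> ?A" using that by (rule subsetD[OF _ imageI, rotated])
    then show "w \<in> UNIV \<times> ?A" by (simp only: mem_Times_iff UNIV_I simp_thms)
  qed
  have "set s' \<union> set s \<subseteq> UNIV \<times> ?A" "N' \<union> N \<subseteq> UNIV \<times> ?A"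
    using A[OF *(1)] A[OF ok_trace_fnT] by (simp_all only: U Un_least)
  then have "s' = s" "N' = N"
    using map_inj_on[OF eq(2) inj_on_subset[OF inj]] inj_on_image_eq_iff[OF inj, of N' N] eq(3) by simp_all
  then show "k = 1 \<and> t = map (apsnd (inst f)) s \<and> M = apsnd (inst f) ` N" using * eq by simp
next
  assume *: "k = 1 \<and> t = map (apsnd (inst f)) s \<and> M = apsnd (inst f) ` N"
  have "(labels, apsnd (inst z) ` N, k) \<in> test_triples z (impl T :: 'k tm)" using test_triples_impl[OF k] * by blast
  from test_triples_indep[OF avoids_z f fv_impl ok_trace_fnT this] show "(t, M, k) \<in> test_triples f (impl T :: 'k tm)" using * by simp
qed

end

theorem theorem6p1:
  fixes P :: "'k::comm_semiring_1 tm"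
  assumes idem: "\<And>x::'k. x + x = x"
    and P_term: "lc P"
  shows "\<exists>Ts :: ('k \<times> trc) list.
           (\<forall>(k, T) \<in> set Ts. wf_trace T \<and> linear_order_on (tev T) (tord T))
         \<and> obs_eq P (msum (map (\<lambda>(k, T). scal k (impl T)) Ts))"
proof -
  \<comment> \<open>A reference supply of objects; by \<open>test_triples_indep\<close> the abstract
    triples in \<open>S\<close> do not depend on it.\<close>
  define g :: "nat \<Rightarrow> nat" where "g i = Suc (Max (insert 0 (fv P))) + i" for i
  have "x < g i" if "x \<in> fv P" for x i
    unfolding g_def using that by (intro trans_less_add1 le_imp_less_Suc Max_ge) auto
  then have g: "avoids g (fv P)" unfolding avoids_def by (force simp: inj_def g_def)
  define S where "S = {(s, N, k). ok_trace (fv P) s N \<and> (map (apsnd (inst g)) s, apsnd (inst g) ` N, k) \<in> test_triples g P}"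
  have "finite S" unfolding S_def by (rule finite_test_triples[OF g finite_fv])
  then obtain L where L: "set L = S" using finite_list by blast
  define Ts where "Ts = map (\<lambda>(s, N, k). (k, seq_trace s N)) L"
  have S: "total_trace s N (fv P)" if "(s, N, k) \<in> S" for s N k
    using that by (auto simp: S_def total_trace_def)
  let ?Q = "msum (map (\<lambda>(k, T). scal k (impl T)) Ts) :: 'k tm"
  have set_Ts: "set (map (\<lambda>(k, T). scal k (impl T)) Ts) = {scal k (impl (seq_trace s N)) |s N k. (s, N, k) \<in> S}"
    unfolding Ts_def using L by force
  have lcs: "lc X" if "X \<in> set (map (\<lambda>(k, T). scal k (impl T)) Ts)" for X :: "'k tm"
    using that total_trace.lc_impl[OF S] unfolding set_Ts by (auto simp: scal_def)
  have "obs_eq P ?Q"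
  proof (rule obs_eq_test_triples[OF idem P_term lc_msum[OF lcs]])
    fix f t M and k :: 'k
    assume f: "good f 0 P" "good f 0 ?Q" and k: "k \<noteq> 0"
    have fP: "avoids f (fv P)" using f(1) by (simp add: good_avoids)
    have impl: "(t, M, c) \<in> test_triples f (scal k' (impl (seq_trace s N))) \<longleftrightarrow> c = k' \<and> t = map (apsnd (inst f)) s \<and> M = apsnd (inst f) ` N"
      if s: "(s, N, k') \<in> S" and c: "c \<noteq> 0" for s N c and k' :: 'k
    proof -
      interpret total_trace s N "fv P" by (rule S[OF s])
      have fT: "avoids f (fnT (seq_trace s N))" by (rule avoids_subset[OF fP fnT_subset])
      have "(t, M, c) \<in> test_triples f (scal k' (impl (seq_trace s N))) \<longleftrightarrow> (\<exists>c'. c = k' * c' \<and> (t, M, c') \<in> test_triples f (impl (seq_trace s N) :: 'k tm))"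
        unfolding test_triples_ctx[OF inert_ctx_scal lc_impl, simplified] by force
      \<comment> \<open>A nonzero product has a nonzero factor \<open>c'\<close>, to which
        \<open>test_triples_impl_avoids\<close> applies and gives \<open>c' = 1\<close>.\<close>
      also have "\<dots> \<longleftrightarrow> (\<exists>c'. c = k' * c' \<and> c' \<noteq> 0 \<and> (t, M, c') \<in> test_triples f (impl (seq_trace s N) :: 'k tm))"
        using c by (metis mult_zero_right)
      also have "\<dots> \<longleftrightarrow> c = k' \<and> t = map (apsnd (inst f)) s \<and> M = apsnd (inst f) ` N"
        using test_triples_impl_avoids[OF fT] by (metis mult.right_neutral zero_neq_one)
      finally show ?thesis .
    qed
    \<comment> \<open>The comparison goes through the abstract form, since \<open>S\<close> was
      defined with the supply \<open>g\<close> while the test brings its own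
      \<open>f\<close>.\<close>
    have "(t, M, k) \<in> test_triples f P \<longleftrightarrow> (\<exists>s N. (s, N, k) \<in> S \<and> t = map (apsnd (inst f)) s \<and> M = apsnd (inst f) ` N)"
    proof
      assume t: "(t, M, k) \<in> test_triples f P"
      then obtain s N where *: "ok_trace (fv P) s N" "t = map (apsnd (inst f)) s" "M = apsnd (inst f) ` N"
        using test_triples_abs[OF _ order_refl fP] by metis
      then have "(s, N, k) \<in> S" using test_triples_indep[OF fP g order_refl *(1)] t unfolding S_def by blast
      then show "\<exists>s N. (s, N, k) \<in> S \<and> t = map (apsnd (inst f)) s \<and> M = apsnd (inst f) ` N" using * by blast
    next
      assume "\<exists>s N. (s, N, k) \<in> S \<and> t = map (apsnd (inst f)) s \<and> M = apsnd (inst f) ` N"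
      then show "(t, M, k) \<in> test_triples f P" using test_triples_indep[OF g fP order_refl] unfolding S_def by blast
    qed
    also have "\<dots> \<longleftrightarrow> (\<exists>s N k'. (s, N, k') \<in> S \<and> (t, M, k) \<in> test_triples f (scal k' (impl (seq_trace s N)) :: 'k tm))"
      using impl[OF _ k] by blast
    also have "\<dots> \<longleftrightarrow> (\<exists>X\<in>set (map (\<lambda>(k, T). scal k (impl T)) Ts). (t, M, k) \<in> test_triples f X)"
      unfolding set_Ts by blast
    also have "\<dots> \<longleftrightarrow> (t, M, k) \<in> test_triples f ?Q" by (rule test_triples_msum[OF lcs f(2) k, symmetric])
    finally show "(t, M, k) \<in> test_triples f P \<longleftrightarrow> (t, M, k) \<in> test_triples f ?Q" .
  qed
  moreover have "\<forall>(k, T) \<in> set Ts. wf_trace T \<and> linear_order_on (tev T) (tord T)"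
    unfolding Ts_def using L total_trace.wf_trace_seq_trace[OF S] total_trace.linear_order_seq_trace[OF S] by auto
  ultimately show ?thesis by blast
qed

end
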